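(* Let $M$ be an oriented smooth manifold, $T\in\mathcal D'(M)$ a distribution and $X$ a smooth vector field on $M$. Then, in $\hat{\mathcal G}(M)$, $$\tilde\nabla_X\iota(T)=\tilde{\mathcal L}_X\iota(T)\approx\iota(\mathcal L_XT)=\iota(\nabla_XT),$$ where $\approx$ denotes association.
   Context: $M$ is an oriented smooth ($C^\infty$, Hausdorff, second countable) manifold of dimension $n$. $C^\infty(M)$ is the space of real-valued smooth functions, $\mathfrak X(M)$ the space of smooth vector fields, $\Omega^n_c(M)$ the space of smooth compactly supported $n$-forms with its usual (LF) topology, and $\mathcal D'(M)$ (distributions) is the topological dual of $\Omega^n_c(M)$. $\mathcal L_X$ denotes the usual Lie derivative; on distributions $\langle\mathcal L_XT,\mu\rangle=-\langle T,\mathcal L_X\mu\rangle$ for $\mu\in\Omega^n_c(M)$. On smooth functions and on scalar distributions the covariant (directional) derivative $\nabla_X$ is the same as $\mathcal L_X$. Smoothing kernels. $\mathrm{SK}(M)=C^\infty(M,\Omega^n_c(M))$; its elements are smooth maps $\omega\colon x\mapsto\omega_x$, and it carries the topology of uniform convergence on compact sets in all derivatives. For $X\in\mathfrak X(M)$, $\mathcal L^{C^\infty}_X\omega$ denotes the directional derivative along $X$ of the map $x\mapsto\omega_x$ (differentiation in the parameter $x$ only). Basic space. $\hat{\mathcal E}(M)$ is the set of all maps $F\colon \mathrm{SK}(M)\to C^\infty(M)$ which are smooth in the sense of the convenient setting of global analysis of Kriegl–Michor (a map between locally convex spaces is smooth if it maps smooth curves to smooth curves) and which are local: if $\omega,\tilde\omega\in\mathrm{SK}(M)$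 satisfy $\omega_x=\tilde\omega_x$ for all $x$ in an open set $U\subseteq M$, then $F(\omega)|_U=F(\tilde\omega)|_U$. It is an algebra under pointwise operations. $d^jF$ is the $j$-th differential of $F$, so $(d^jF)(\omega)(\omega_1,\dots,\omega_j)\in C^\infty(M)$, with $d^0F=F$. Delta nets. $\tilde{\mathcal A}(M)$ is the set of nets $(\omega_\varepsilon)_{\varepsilon\in(0,1]}$ in $\mathrm{SK}(M)$ (write $\omega_{x,\varepsilon}$ for $(\omega_\varepsilon)_x$) such that, on any compact $K\subset M$: (1) $\forall r>0\ \exists\varepsilon_0>0\ \forall x\in K\ \forall\varepsilon\le\varepsilon_0$: $\operatorname{supp}\omega_{x,\varepsilon}\subseteq B_r(x)$, balls being taken with respect to some Riemannian metric on $M$ (the condition does not depend on the choice); (2) for all $f\in C^\infty(M)$, $k\in\mathbb N_0$, $X_1,\dots,X_k\in\mathfrak X(M)$ and all $m\in\mathbb N$: $\sup_{x\in K}\left|\int_M f\,\mathcal L^{C^\infty}_{X_1}\cdots\mathcal L^{C^\infty}_{X_k}\omega_{x,\varepsilon}-\mathcal L_{X_1}\cdots\mathcal L_{X_k}f(x)\right|=O(\varepsilon^m)$ as $\varepsilon\to0$; (3) $\forall u\in\mathcal D'(M)\ \forall k\in\mathbb N_0\ \exists N\in\mathbb N\ \forall X_1,\dots,X_k\in\mathfrak X(M)$: $\sup_{x\in K}\left|\mathcal L_{X_1}\cdots\mathcal L_{X_k}\langle u,\omega_{x,\varepsilon}\rangle\right|=O(\varepsilon^{-N})$ as $\varepsilon\to0$;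 (4) $\forall u\in\mathcal D'(M)\ \forall\mu\in\Omega^n_c(M)$: $\lim_{\varepsilon\to0}\int_{x\in M}\langle u,\omega_{x,\varepsilon}\rangle\,\mu(x)=\langle u,\mu\rangle$. Further, $\tilde{\mathcal A}_0(M)=\{\omega^0\in\mathrm{SK}(M)^{(0,1]}:\ \omega\in\tilde{\mathcal A}(M)\Rightarrow\omega^0+\omega\in\tilde{\mathcal A}(M)\}$. Moderate and negligible elements. $F\in\hat{\mathcal E}(M)$ is moderate ($F\in\hat{\mathcal E}_M(M)$) if for every compact $K\subset M$: $\forall k,j\in\mathbb N_0\ \forall\omega\in\tilde{\mathcal A}(M)\ \forall\omega_1,\dots,\omega_j\in\tilde{\mathcal A}_0(M)\ \exists N\in\mathbb N_0\ \forall X_1,\dots,X_k\in\mathfrak X(M)$: $$\sup_{x\in K}\left|\mathcal L_{X_1}\cdots\mathcal L_{X_k}\big((d^jF)(\omega_\varepsilon)(\omega_{1,\varepsilon},\dots,\omega_{j,\varepsilon})\big)(x)\right|=O(\varepsilon^{-N})\quad(\varepsilon\to0).$$ $F\in\hat{\mathcal E}(M)$ is negligible ($F\in\hat{\mathcal N}(M)$) if for every compact $K\subset M$: $\forall k,j,m\in\mathbb N_0\ \forall X_1,\dots,X_k\in\mathfrak X(M)\ \forall\omega\in\tilde{\mathcal A}(M)\ \forall\omega_1,\dots,\omega_j\in\tilde{\mathcal A}_0(M)$ the same supremum is $O(\varepsilon^m)$ as $\varepsilon\to0$. The Colombeau algebra is $\hat{\mathcal G}(M)=\hat{\mathcal E}_M(M)/\hat{\mathcal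 N}(M)$, and $[F]$ is the class of $F$. Embedding and derivatives. $\iota\colon\mathcal D'(M)\to\hat{\mathcal G}(M)$ is $\iota(T)=[\tilde T]$ with $\tilde T(\omega)(x)=\langle T,\omega_x\rangle$. The ordinary Lie derivative $\tilde{\mathcal L}_X$ and the covariant derivative $\tilde\nabla_X$ of generalised scalar fields are defined on representatives by $(\tilde{\mathcal L}_XF)(\omega)=\mathcal L_X(F(\omega))$ and $(\tilde\nabla_XF)(\omega)=\nabla_X(F(\omega))$. Association. $[F]\in\hat{\mathcal G}(M)$ is associated to $0$, $[F]\approx0$, if for each $\mu\in\Omega^n_c(M)$ and each $(\omega_\varepsilon)_\varepsilon\in\tilde{\mathcal A}(M)$, $\lim_{\varepsilon\to0}\int_{x\in M}F(\omega_\varepsilon)(x)\,\mu(x)=0$; and $[F]\approx[G]$ means $[F-G]\approx0$. *)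

theory Defs
  imports "HOL-Analysis.Analysis" "HOL-Library.Function_Algebras"
begin

instantiation "fun" :: (type, scaleR) scaleR
begin

definition scaleR_fun :: "real \<Rightarrow> ('a \<Rightarrow> 'b) \<Rightarrow> 'a \<Rightarrow> 'b" where
  "r *\<^sub>R f = (\<lambda>x. r *\<^sub>R f x)"

instance ..

end

instance "fun" :: (type, real_vector) real_vector
  by standard (simp_all add: scaleR_fun_def fun_eq_iff scaleR_add_right scaleR_add_left)


section \<open>Smooth functions on open subsets of normed spaces\<close>

primrec Ck_on ::
  "nat \<Rightarrow> 'e::real_normed_vector set \<Rightarrow> ('e \<Rightarrow> 'f::real_normed_vector) \<Rightarrow> bool" where
  "Ck_on 0 S f \<longleftrightarrow> continuous_on S f"
| "Ck_on (Suc k) S f \<longleftrightarrow>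
     (\<forall>x\<in>S. f differentiable (at x)) \<and>
     (\<forall>v. Ck_on k S (\<lambda>x. frechet_derivative f (at x) v))"

definition smooth_on :: "'e::real_normed_vector set \<Rightarrow> ('e \<Rightarrow> 'f::real_normed_vector) \<Rightarrow> bool" where
  "smooth_on S f \<longleftrightarrow> (\<forall>k. Ck_on k S f)"


section \<open>Locally convex spaces\<close>

text \<open>A locally convex space is given by the set of its elements, a subspace of an ambient
  type of real vectors, and a family of seminorms on it generating the topology. The seminorms are
  only meaningful on \<open>pts E\<close>; they are not required to form a saturated family.\<close>

record 'v lcs =
  pts :: "'v set"
  seminorms :: "('v \<Rightarrow> real) set"

definition seminorm_on :: "'v::real_vector set \<Rightarrow> ('v \<Rightarrow> real) \<Rightarrow> bool" where
  "seminorm_on V p \<longleftrightarrow>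
     (\<forall>v\<in>V. \<forall>w\<in>V. p (v + w) \<le> p v + p w) \<and> (\<forall>r. \<forall>v\<in>V. p (r *\<^sub>R v) = \<bar>r\<bar> * p v)"

definition lc_tendsto :: "'v::real_vector lcs \<Rightarrow> ('i \<Rightarrow> 'v) \<Rightarrow> 'v \<Rightarrow> 'i filter \<Rightarrow> bool" where
  "lc_tendsto E f l F \<longleftrightarrow> (\<forall>p\<in>seminorms E. ((\<lambda>t. p (f t - l)) \<longlongrightarrow> 0) F)"

definition lc_has_deriv :: "'v::real_vector lcs \<Rightarrow> (real \<Rightarrow> 'v) \<Rightarrow> 'v \<Rightarrow> real \<Rightarrow> bool" where
  "lc_has_deriv E c l t \<longleftrightarrow>
     l \<in> pts E \<and> lc_tendsto E (\<lambda>h. (c (t + h) - c t) /\<^sub>R h) l (at 0)"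

definition lc_deriv :: "'v::real_vector lcs \<Rightarrow> (real \<Rightarrow> 'v) \<Rightarrow> real \<Rightarrow> 'v" where
  "lc_deriv E c t = (THE l. lc_has_deriv E c l t)"

definition smooth_curve :: "'v::real_vector lcs \<Rightarrow> (real \<Rightarrow> 'v) \<Rightarrow> bool" where
  "smooth_curve E c \<longleftrightarrow>
     (\<exists>D :: nat \<Rightarrow> real \<Rightarrow> 'v. D 0 = c \<and>
        (\<forall>k t. D k t \<in> pts E \<and> lc_has_deriv E (D k) (D (Suc k) t) t))"

definition convenient_smooth ::
  "'v::real_vector lcs \<Rightarrow> 'w::real_vector lcs \<Rightarrow> ('v \<Rightarrow> 'w) \<Rightarrow> bool" where
  "convenient_smooth E E' F \<longleftrightarrow> (\<forall>c. smooth_curve E c \<longrightarrow> smooth_curve E' (F \<circ> c))"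

text \<open>\<open>differential E' F [v\<^sub>1, \<dots>, v\<^sub>j] \<omega>\<close> is $(d^jF)(\omega)(v_1,\dots,v_j)$, for a map
  \<open>F\<close> with values in \<open>E'\<close>, as an iterated directional derivative.\<close>

primrec differential ::
  "'w::real_vector lcs \<Rightarrow> ('v::real_vector \<Rightarrow> 'w) \<Rightarrow> 'v list \<Rightarrow> 'v \<Rightarrow> 'w" where
  "differential E' F [] \<omega> = F \<omega>"
| "differential E' F (v # vs) \<omega> = lc_deriv E' (\<lambda>t. differential E' F vs (\<omega> + t *\<^sub>R v)) 0"

text \<open>Smoothness of a map from an open subset of a Euclidean space to a locally convex space:
  \<open>D [i\<^sub>1, \<dots>, i\<^sub>k]\<close> is the iterated partial derivative, and each of them is
  differentiable (in particular continuous) with respect to each seminorm.\<close>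

definition lc_smooth_on ::
  "'v::real_vector lcs \<Rightarrow> (real ^ 'n::finite) set \<Rightarrow> (real ^ 'n \<Rightarrow> 'v) \<Rightarrow> bool" where
  "lc_smooth_on E S g \<longleftrightarrow>
     (\<exists>D :: 'n list \<Rightarrow> real ^ 'n \<Rightarrow> 'v.
        (\<forall>y\<in>S. D [] y = g y) \<and>
        (\<forall>is. \<forall>y\<in>S. D is y \<in> pts E \<and>
           lc_tendsto E
             (\<lambda>h. (D is (y + h) - D is y - (\<Sum>i\<in>UNIV. (h $ i) *\<^sub>R D (i # is) y)) /\<^sub>R norm h)
             0 (at 0)))"


section \<open>Oriented smooth manifolds\<close>

text \<open>A chart is its domain together with a coordinate map; the values of the map outside of the
  domain are irrelevant. The manifold is the whole type \<open>'a\<close>; \<open>'n\<close> is only an index type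
  for the coordinates, so that the dimension is \<open>CARD('n)\<close>.\<close>

type_synonym ('a, 'n) chart = "'a set \<times> ('a \<Rightarrow> (real, 'n) vec)"

abbreviation cdom :: "('a, 'n) chart \<Rightarrow> 'a set" where "cdom \<equiv> fst"

abbreviation cmap :: "('a, 'n) chart \<Rightarrow> 'a \<Rightarrow> (real, 'n) vec" where "cmap \<equiv> snd"

definition cimg :: "('a, 'n) chart \<Rightarrow> (real, 'n) vec set" where
  "cimg c = cmap c ` cdom c"

definition cinv :: "('a, 'n) chart \<Rightarrow> (real, 'n) vec \<Rightarrow> 'a" where
  "cinv c = inv_into (cdom c) (cmap c)"

definition jacobian :: "('a, 'n::finite) chart \<Rightarrow> ('a, 'n) chart \<Rightarrow> 'a \<Rightarrow> real ^ 'n ^ 'n" where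
  "jacobian c d x = matrix (frechet_derivative (cmap d \<circ> cinv c) (at (cmap c x)))"

definition oriented_smooth_atlas ::
  "('a::{t2_space, second_countable_topology}, 'n::finite) chart set \<Rightarrow> bool" where
  "oriented_smooth_atlas A \<longleftrightarrow>
     (\<forall>c\<in>A. open (cdom c) \<and> open (cimg c) \<and>
            homeomorphism (cdom c) (cimg c) (cmap c) (cinv c)) \<and>
     (\<Union>c\<in>A. cdom c) = UNIV \<and>
     (\<forall>c\<in>A. \<forall>d\<in>A.
        smooth_on (cmap c ` (cdom c \<inter> cdom d)) (cmap d \<circ> cinv c) \<and>
        (\<forall>x\<in>cdom c \<inter> cdom d. 0 < det (jacobian c d x)))"

text \<open>Notions defined below by means of \<open>chart_at\<close> would be the same for any other chart at the
  point, by the chain rule and the transformation laws.\<close>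

definition chart_at :: "('a, 'n) chart set \<Rightarrow> 'a \<Rightarrow> ('a, 'n) chart" where
  "chart_at A x = (SOME c. c \<in> A \<and> x \<in> cdom c)"

definition smooth_fun :: "('a, 'n::finite) chart set \<Rightarrow> ('a \<Rightarrow> real) \<Rightarrow> bool" where
  "smooth_fun A f \<longleftrightarrow> (\<forall>c\<in>A. smooth_on (cimg c) (f \<circ> cinv c))"

text \<open>Tensor fields are given by their components in the charts of the atlas, subject to the
  usual transformation law. \<open>X x c\<close> is the vector of components of \<open>X\<close> at \<open>x\<close> in the chart \<open>c\<close>;
  for an \<open>n\<close>-form \<open>\<mu>\<close>, \<open>\<mu> x c\<close> is the coefficient of \<open>\<mu>\<close> at \<open>x\<close> with respect to the frame
  $dc^1\wedge\dots\wedge dc^n$. Where these make no sense they are set to zero, so that equality of tensors is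
  equality of functions.\<close>

type_synonym ('a, 'n) vfield = "'a \<Rightarrow> ('a, 'n) chart \<Rightarrow> (real, 'n) vec"
type_synonym ('a, 'n) form = "'a \<Rightarrow> ('a, 'n) chart \<Rightarrow> real"

definition vfields :: "('a, 'n::finite) chart set \<Rightarrow> ('a, 'n) vfield set" where
  "vfields A = {X.
     (\<forall>x c. \<not> (c \<in> A \<and> x \<in> cdom c) \<longrightarrow> X x c = 0) \<and>
     (\<forall>c\<in>A. \<forall>d\<in>A. \<forall>x\<in>cdom c \<inter> cdom d. X x d = jacobian c d x *v X x c) \<and>
     (\<forall>c\<in>A. smooth_on (cimg c) (\<lambda>y. X (cinv c y) c))}"

definition forms :: "('a, 'n::finite) chart set \<Rightarrow> ('a, 'n) form set" where
  "forms A = {\<mu>.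
     (\<forall>x c. \<not> (c \<in> A \<and> x \<in> cdom c) \<longrightarrow> \<mu> x c = 0) \<and>
     (\<forall>c\<in>A. \<forall>d\<in>A. \<forall>x\<in>cdom c \<inter> cdom d. \<mu> x c = det (jacobian c d x) * \<mu> x d) \<and>
     (\<forall>c\<in>A. smooth_on (cimg c) (\<lambda>y. \<mu> (cinv c y) c))}"

definition supp :: "('a::topological_space \<Rightarrow> 'b::zero) \<Rightarrow> 'a set" where
  "supp f = closure {x. f x \<noteq> 0}"

definition mult_form :: "('a \<Rightarrow> real) \<Rightarrow> ('a, 'n) form \<Rightarrow> ('a, 'n) form" where
  "mult_form f \<mu> = (\<lambda>x c. f x * \<mu> x c)"

text \<open>The Lie derivative of an \<open>n\<close>-form in local coordinates:
  $\mathcal L_X(f\,dy^1\wedge\dots\wedge dy^n) = (X f + f\,\mathrm{div} X)\,dy^1\wedge\dots\wedge dy^n$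
  with $\mathrm{div} X = \sum_i\partial_iX^i$.\<close>

definition lie_fun :: "('a, 'n::finite) chart set \<Rightarrow> ('a, 'n) vfield \<Rightarrow> ('a \<Rightarrow> real) \<Rightarrow> 'a \<Rightarrow> real" where
  "lie_fun A X f x =
     (let c = chart_at A x in frechet_derivative (f \<circ> cinv c) (at (cmap c x)) (X x c))"

definition lie_form ::
  "('a, 'n::finite) chart set \<Rightarrow> ('a, 'n) vfield \<Rightarrow> ('a, 'n) form \<Rightarrow> ('a, 'n) form" where
  "lie_form A X \<mu> x c =
     (if c \<in> A \<and> x \<in> cdom c then
        frechet_derivative (\<lambda>y. \<mu> (cinv c y) c) (at (cmap c x)) (X x c) +
        \<mu> x c * trace (matrix (frechet_derivative (\<lambda>y. X (cinv c y) c) (at (cmap c x))))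
      else 0)"

text \<open>The integral of a compactly supported \<open>n\<close>-form, by a finite smooth partition of unity on its
  support; the value does not depend on the choice of the partition and of the charts.\<close>

definition form_integral ::
  "('a::topological_space, 'n::finite) chart set \<Rightarrow> ('a, 'n) form \<Rightarrow> real" where
  "form_integral A \<mu> = (THE I. \<exists>N (c :: nat \<Rightarrow> ('a, 'n) chart) \<rho>.
     (\<forall>i<N. c i \<in> A \<and> smooth_fun A (\<rho> i) \<and> (\<forall>x. 0 \<le> \<rho> i x \<and> \<rho> i x \<le> 1) \<and>
            supp (\<rho> i) \<subseteq> cdom (c i)) \<and>
     (\<forall>x\<in>supp \<mu>. (\<Sum>i<N. \<rho> i x) = 1) \<and>
     I = (\<Sum>i<N. integral (cimg (c i)) (\<lambda>y. \<rho> i (cinv (c i) y) * \<mu> (cinv (c i) y) (c i))))"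


section \<open>Function spaces and distributions\<close>

text \<open>Lists of vector fields stand for iterated Lie derivatives:
  \<open>foldr (lie_fun A) [X\<^sub>1, \<dots>, X\<^sub>k] f\<close> is
  $\mathcal L_{X_1}\cdots\mathcal L_{X_k}f$.\<close>

definition Cinf :: "('a::topological_space, 'n::finite) chart set \<Rightarrow> ('a \<Rightarrow> real) lcs" where
  "Cinf A = \<lparr>pts = {f. smooth_fun A f},
     seminorms = {\<lambda>f. (SUP x\<in>K. \<bar>foldr (lie_fun A) Xs f x\<bar>) | K Xs.
       compact K \<and> K \<noteq> {} \<and> set Xs \<subseteq> vfields A}\<rparr>"

text \<open>The LF topology is the finest locally convex topology for which the inclusions of the
  Frechet spaces \<open>forms_in A K\<close>, \<open>K\<close> compact, are continuous. Hence the continuous seminorms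
  are those whose restriction to each \<open>forms_in A K\<close> is continuous, i.e. bounded by
  finitely many of the defining seminorms. These are written with Lie derivatives
  (of coefficients in charts, on compact sets), which gives the same topology as partial derivatives
  of the coefficients.\<close>

definition forms_in ::
  "('a::topological_space, 'n::finite) chart set \<Rightarrow> 'a set \<Rightarrow> ('a, 'n) form set" where
  "forms_in A K = {\<mu>\<in>forms A. supp \<mu> \<subseteq> K}"

definition form_seminorms ::
  "('a::topological_space, 'n::finite) chart set \<Rightarrow> (('a, 'n) form \<Rightarrow> real) set" where
  "form_seminorms A = {\<lambda>\<mu>. (SUP x\<in>L. \<bar>foldr (lie_form A) Xs \<mu> x c\<bar>) | L c Xs.
     c \<in> A \<and> compact L \<and> L \<noteq> {} \<and> L \<subseteq> cdom c \<and> set Xs \<subseteq> vfields A}"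

definition cforms :: "('a::topological_space, 'n::finite) chart set \<Rightarrow> ('a, 'n) form set" where
  "cforms A = {\<mu>\<in>forms A. compact (supp \<mu>)}"

definition Omega_c :: "('a::topological_space, 'n::finite) chart set \<Rightarrow> ('a, 'n) form lcs" where
  "Omega_c A = \<lparr>pts = cforms A,
     seminorms = {p. seminorm_on (cforms A) p \<and>
       (\<forall>K. compact K \<longrightarrow> (\<exists>Q C. finite Q \<and> Q \<subseteq> form_seminorms A \<and>
          (\<forall>\<mu>\<in>forms_in A K. p \<mu> \<le> C * (\<Sum>q\<in>Q. q \<mu>))))}\<rparr>"

text \<open>Only the values of a distribution on \<open>cforms A\<close> matter. As \<open>Omega_c A\<close> has all continuous
  seminorms, a linear functional is continuous iff its modulus is one of them.\<close>

definition distributions ::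
  "('a::topological_space, 'n::finite) chart set \<Rightarrow> (('a, 'n) form \<Rightarrow> real) set" where
  "distributions A = {T.
     (\<forall>\<mu>\<in>cforms A. \<forall>\<nu>\<in>cforms A. T (\<mu> + \<nu>) = T \<mu> + T \<nu>) \<and>
     (\<forall>r. \<forall>\<mu>\<in>cforms A. T (r *\<^sub>R \<mu>) = r * T \<mu>) \<and>
     (\<lambda>\<mu>. \<bar>T \<mu>\<bar>) \<in> seminorms (Omega_c A)}"

definition lie_dist ::
  "('a, 'n::finite) chart set \<Rightarrow> ('a, 'n) vfield \<Rightarrow> (('a, 'n) form \<Rightarrow> real) \<Rightarrow> ('a, 'n) form \<Rightarrow> real" where
  "lie_dist A X T = (\<lambda>\<mu>. - T (lie_form A X \<mu>))"

text \<open>On scalars the covariant derivative is the directional derivative.\<close>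

definition cov_fun :: "('a, 'n::finite) chart set \<Rightarrow> ('a, 'n) vfield \<Rightarrow> ('a \<Rightarrow> real) \<Rightarrow> 'a \<Rightarrow> real" where
  "cov_fun A X f = lie_fun A X f"

definition cov_dist ::
  "('a, 'n::finite) chart set \<Rightarrow> ('a, 'n) vfield \<Rightarrow> (('a, 'n) form \<Rightarrow> real) \<Rightarrow> ('a, 'n) form \<Rightarrow> real" where
  "cov_dist A X T = lie_dist A X T"


section \<open>Smoothing kernels\<close>

type_synonym ('a, 'n) kernel = "'a \<Rightarrow> ('a, 'n) form"

text \<open>\<open>lie_par A X \<omega>\<close> is the derivative in the parameter \<open>x\<close> only; the limit
  is taken in \<open>Omega_c A\<close>.\<close>

definition lie_par ::
  "('a::topological_space, 'n::finite) chart set \<Rightarrow> ('a, 'n) vfield \<Rightarrow> ('a, 'n) kernel \<Rightarrow> ('a, 'n) kernel" where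
  "lie_par A X \<omega> x =
     (let c = chart_at A x
      in lc_deriv (Omega_c A) (\<lambda>t. \<omega> (cinv c (cmap c x + t *\<^sub>R X x c))) 0)"

definition SK :: "('a::topological_space, 'n::finite) chart set \<Rightarrow> ('a, 'n) kernel lcs" where
  "SK A = \<lparr>pts = {\<omega>. \<forall>c\<in>A. lc_smooth_on (Omega_c A) (cimg c) (\<omega> \<circ> cinv c)},
     seminorms = {\<lambda>\<omega>. (SUP x\<in>K. p (foldr (lie_par A) Xs \<omega> x)) | K Xs p.
       compact K \<and> K \<noteq> {} \<and> set Xs \<subseteq> vfields A \<and> p \<in> seminorms (Omega_c A)}\<rparr>"


section \<open>Riemannian balls\<close>

definition riemannian_metric ::
  "('a, 'n::finite) chart set \<Rightarrow> ('a \<Rightarrow> ('a, 'n) chart \<Rightarrow> real ^ 'n ^ 'n) \<Rightarrow> bool" where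
  "riemannian_metric A g \<longleftrightarrow>
     (\<forall>c\<in>A. \<forall>x\<in>cdom c. transpose (g x c) = g x c \<and> (\<forall>v. v \<noteq> 0 \<longrightarrow> 0 < v \<bullet> (g x c *v v))) \<and>
     (\<forall>c\<in>A. \<forall>d\<in>A. \<forall>x\<in>cdom c \<inter> cdom d.
        g x c = transpose (jacobian c d x) ** g x d ** jacobian c d x) \<and>
     (\<forall>c\<in>A. smooth_on (cimg c) (\<lambda>y. g (cinv c y) c))"

definition smooth_path ::
  "('a::topological_space, 'n::finite) chart set \<Rightarrow> (real \<Rightarrow> 'a) \<Rightarrow> bool" where
  "smooth_path A \<gamma> \<longleftrightarrow>
     continuous_on UNIV \<gamma> \<and> (\<forall>c\<in>A. smooth_on (\<gamma> -` cdom c) (cmap c \<circ> \<gamma>))"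

definition path_len ::
  "('a, 'n::finite) chart set \<Rightarrow> ('a \<Rightarrow> ('a, 'n) chart \<Rightarrow> real ^ 'n ^ 'n) \<Rightarrow> (real \<Rightarrow> 'a) \<Rightarrow> real" where
  "path_len A g \<gamma> = integral {0..1} (\<lambda>t.
     let c = chart_at A (\<gamma> t); v = vector_derivative (cmap c \<circ> \<gamma>) (at t)
     in sqrt (v \<bullet> (g (\<gamma> t) c *v v)))"

text \<open>The Riemannian distance is the infimum of the lengths of connecting curves (it is infinite
  between different components). Smooth curves yield the same infimum as piecewise smooth ones.\<close>

definition riemannian_ball ::
  "('a::topological_space, 'n::finite) chart set \<Rightarrow> ('a \<Rightarrow> ('a, 'n) chart \<Rightarrow> real ^ 'n ^ 'n) \<Rightarrow>
   'a \<Rightarrow> real \<Rightarrow> 'a set" where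
  "riemannian_ball A g x r =
     {y. \<exists>\<gamma>. smooth_path A \<gamma> \<and> \<gamma> 0 = x \<and> \<gamma> 1 = y \<and> path_len A g \<gamma> < r}"


section \<open>Delta nets\<close>

text \<open>\<open>unif_bigo K f e\<close>: the supremum of \<open>\<bar>f \<epsilon> x\<bar>\<close> over \<open>x \<in> K\<close> is
  \<open>O(\<epsilon>\<^sup>e)\<close> as \<open>\<epsilon> \<rightarrow> 0\<close>. It is spelled out because the real supremum of the empty set is
  not \<open>0\<close>.\<close>

definition unif_bigo :: "'a set \<Rightarrow> (real \<Rightarrow> 'a \<Rightarrow> real) \<Rightarrow> int \<Rightarrow> bool" where
  "unif_bigo K f e \<longleftrightarrow>
     (\<exists>C. \<forall>\<^sub>F \<epsilon> in at_right 0. \<forall>x\<in>K. \<bar>f \<epsilon> x\<bar> \<le> C * \<epsilon> powi e)"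

text \<open>Nets are indexed by \<open>{0<..1}\<close>; their values at other indices are irrelevant.\<close>

type_synonym ('a, 'n) net = "real \<Rightarrow> ('a, 'n) kernel"

definition nets :: "('a::topological_space, 'n::finite) chart set \<Rightarrow> ('a, 'n) net set" where
  "nets A = {\<omega>. \<forall>\<epsilon>\<in>{0<..1}. \<omega> \<epsilon> \<in> pts (SK A)}"

definition delta_nets :: "('a::topological_space, 'n::finite) chart set \<Rightarrow> ('a, 'n) net set" where
  "delta_nets A = {\<omega>\<in>nets A.
     (\<forall>K. compact K \<longrightarrow>
        (\<exists>g. riemannian_metric A g \<and>
           (\<forall>r>0. \<exists>\<epsilon>0>0. \<forall>x\<in>K. \<forall>\<epsilon>\<in>{0<..1}. \<epsilon> \<le> \<epsilon>0 \<longrightarrow>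
              supp (\<omega> \<epsilon> x) \<subseteq> riemannian_ball A g x r)) \<and>
        (\<forall>f Xs (m::nat). smooth_fun A f \<longrightarrow> set Xs \<subseteq> vfields A \<longrightarrow>
           unif_bigo K
             (\<lambda>\<epsilon> x. form_integral A (mult_form f (foldr (lie_par A) Xs (\<omega> \<epsilon>) x))
                     - foldr (lie_fun A) Xs f x)
             (int m)) \<and>
        (\<forall>u\<in>distributions A. \<forall>k::nat. \<exists>N::nat. \<forall>Xs.
           length Xs = k \<longrightarrow> set Xs \<subseteq> vfields A \<longrightarrow>
           unif_bigo K (\<lambda>\<epsilon> x. foldr (lie_fun A) Xs (\<lambda>z. u (\<omega> \<epsilon> z)) x) (- int N))) \<and>
     (\<forall>u\<in>distributions A. \<forall>\<mu>\<in>cforms A.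
        ((\<lambda>\<epsilon>. form_integral A (mult_form (\<lambda>x. u (\<omega> \<epsilon> x)) \<mu>)) \<longlongrightarrow> u \<mu>) (at_right 0))}"

definition delta_nets0 :: "('a::topological_space, 'n::finite) chart set \<Rightarrow> ('a, 'n) net set" where
  "delta_nets0 A = {\<omega>0\<in>nets A. \<forall>\<omega>\<in>delta_nets A. \<omega>0 + \<omega> \<in> delta_nets A}"


section \<open>The Colombeau algebra\<close>

text \<open>Only the restriction of such maps to \<open>pts (SK A)\<close> matters: maps which coincide there have the
  same class in \<open>Ghat A\<close>.\<close>

type_synonym ('a, 'n) gmap = "('a, 'n) kernel \<Rightarrow> 'a \<Rightarrow> real"

definition Ehat :: "('a::topological_space, 'n::finite) chart set \<Rightarrow> ('a, 'n) gmap set" where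
  "Ehat A = {F. F ` pts (SK A) \<subseteq> pts (Cinf A) \<and> convenient_smooth (SK A) (Cinf A) F \<and>
     (\<forall>\<omega>\<in>pts (SK A). \<forall>\<omega>'\<in>pts (SK A). \<forall>U. open U \<and> (\<forall>x\<in>U. \<omega> x = \<omega>' x) \<longrightarrow>
        (\<forall>x\<in>U. F \<omega> x = F \<omega>' x))}"

definition moderate :: "('a::topological_space, 'n::finite) chart set \<Rightarrow> ('a, 'n) gmap set" where
  "moderate A = {F\<in>Ehat A.
     \<forall>K. compact K \<longrightarrow>
       (\<forall>(k::nat) (j::nat). \<forall>\<omega>\<in>delta_nets A. \<forall>\<eta>s. length \<eta>s = j \<longrightarrow> set \<eta>s \<subseteq> delta_nets0 A \<longrightarrow>
          (\<exists>N::nat. \<forall>Xs. length Xs = k \<longrightarrow> set Xs \<subseteq> vfields A \<longrightarrow>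
             unif_bigo K
               (\<lambda>\<epsilon> x. foldr (lie_fun A) Xs (differential (Cinf A) F (map (\<lambda>\<eta>. \<eta> \<epsilon>) \<eta>s) (\<omega> \<epsilon>)) x)
               (- int N)))}"

definition negligible_maps :: "('a::topological_space, 'n::finite) chart set \<Rightarrow> ('a, 'n) gmap set" where
  "negligible_maps A = {F\<in>Ehat A.
     \<forall>K. compact K \<longrightarrow>
       (\<forall>(k::nat) (j::nat) (m::nat). \<forall>Xs. length Xs = k \<longrightarrow> set Xs \<subseteq> vfields A \<longrightarrow>
          (\<forall>\<omega>\<in>delta_nets A. \<forall>\<eta>s. length \<eta>s = j \<longrightarrow> set \<eta>s \<subseteq> delta_nets0 A \<longrightarrow>
             unif_bigo K
               (\<lambda>\<epsilon> x. foldr (lie_fun A) Xs (differential (Cinf A) F (map (\<lambda>\<eta>. \<eta> \<epsilon>) \<eta>s) (\<omega> \<epsilon>)) x)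
               (int m)))}"

definition Ghat_rel :: "('a::topological_space, 'n::finite) chart set \<Rightarrow> ('a, 'n) gmap rel" where
  "Ghat_rel A = {(F, G). F \<in> moderate A \<and> G \<in> moderate A \<and> F - G \<in> negligible_maps A}"

definition Ghat :: "('a::topological_space, 'n::finite) chart set \<Rightarrow> ('a, 'n) gmap set set" where
  "Ghat A = moderate A // Ghat_rel A"

definition gclass ::
  "('a::topological_space, 'n::finite) chart set \<Rightarrow> ('a, 'n) gmap \<Rightarrow> ('a, 'n) gmap set" where
  "gclass A F = Ghat_rel A `` {F}"

definition iota ::
  "('a::topological_space, 'n::finite) chart set \<Rightarrow> (('a, 'n) form \<Rightarrow> real) \<Rightarrow> ('a, 'n) gmap set" where
  "iota A T = gclass A (\<lambda>\<omega> x. T (\<omega> x))"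

definition lie_gen ::
  "('a::topological_space, 'n::finite) chart set \<Rightarrow> ('a, 'n) vfield \<Rightarrow>
   ('a, 'n) gmap set \<Rightarrow> ('a, 'n) gmap set" where
  "lie_gen A X \<alpha> = (\<Union>F\<in>\<alpha>. gclass A (\<lambda>\<omega>. lie_fun A X (F \<omega>)))"

definition cov_gen ::
  "('a::topological_space, 'n::finite) chart set \<Rightarrow> ('a, 'n) vfield \<Rightarrow>
   ('a, 'n) gmap set \<Rightarrow> ('a, 'n) gmap set" where
  "cov_gen A X \<alpha> = (\<Union>F\<in>\<alpha>. gclass A (\<lambda>\<omega>. cov_fun A X (F \<omega>)))"

definition assoc_zero :: "('a::topological_space, 'n::finite) chart set \<Rightarrow> ('a, 'n) gmap \<Rightarrow> bool" where
  "assoc_zero A F \<longleftrightarrow>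
     (\<forall>\<mu>\<in>cforms A. \<forall>\<omega>\<in>delta_nets A.
        ((\<lambda>\<epsilon>. form_integral A (mult_form (F (\<omega> \<epsilon>)) \<mu>)) \<longlongrightarrow> 0) (at_right 0))"

text \<open>Association does not depend on the representatives, since negligible maps are associated
  to zero. Elements of \<open>Ghat A\<close> are never empty; this is required here because \<open>gclass A F\<close> is empty
  if \<open>F\<close> is not moderate.\<close>

definition associated ::
  "('a::topological_space, 'n::finite) chart set \<Rightarrow> ('a, 'n) gmap set \<Rightarrow> ('a, 'n) gmap set \<Rightarrow> bool" where
  "associated A \<alpha> \<beta> \<longleftrightarrow>
     \<alpha> \<noteq> {} \<and> \<beta> \<noteq> {} \<and> (\<forall>F\<in>\<alpha>. \<forall>G\<in>\<beta>. assoc_zero A (F - G))"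

end

theory Submission
  imports Defs
begin

text \<open>
  On representatives, the association says that
  $\int \mathcal L_X(\tilde T(\omega_\varepsilon))\,\mu$ and
  $\langle \mathcal L_X T, \mu\rangle = -\langle T, \mathcal L_X\mu\rangle$ have the same limit. By
  Stokes' theorem the former is $-\int \tilde T(\omega_\varepsilon)\,\mathcal L_X\mu$, and property (4) of
  delta nets gives its limit. Other representatives differ by negligible maps, which vanish uniformly on the support
  of \<open>\<mu>\<close> together with their first derivatives.

  Moderateness of $\tilde T$ and $\mathcal L_X\circ\tilde T$ rests on
  $\mathcal L_{X_1}\cdots\mathcal L_{X_k}\langle T,\omega_x\rangle =
  \langle T, \mathcal L^{C^\infty}_{X_1}\cdots\mathcal L^{C^\infty}_{X_k}\omega_x\rangle$ and on linearity in
  \<open>\<omega>\<close>, by which the differentials of order at least two vanish.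
\<close>

section \<open>Calculus of smooth functions\<close>

text \<open>Three obstacles shape the development. (a) \<open>lie_form\<close> is given by a formula
  in each chart, so before property (4) can be applied to \<open>lie_form A X \<mu>\<close> this
  must be shown to be a form again. A direct check of the transformation law would need the
  derivative of a Jacobian determinant; a duality argument replaces it. (b) \<open>lie_par\<close>
  is a limit in \<open>Omega_c A\<close>, taken in a chart that may jump with the point. Point
  evaluations of coefficients are distributions, so distributions separate forms; hence derivatives
  in \<open>Omega_c A\<close> are unique, and identities between kernels, in particular independence
  of the chart, reduce to identities between real functions. (c) \<open>moderate\<close> involves
  differentials in directions from \<open>delta_nets0 A\<close>, for which no growth is prescribed:
  a linear map takes at \<eta> the difference of its values at \<eta> + \<omega> and at \<omega>,
  and both of these are delta nets. Since \<open>lie_gen\<close> is a union over all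
  representatives, the association is verified for every member of that union, without a separate
  proof that \<open>lie_gen\<close> is well defined.\<close>

lemma Ck_on_cong:
  assumes "open S" "\<And>x. x \<in> S \<Longrightarrow> f x = g x"
  shows "Ck_on k S f \<longleftrightarrow> Ck_on k S g"
proof -
  have *: "Ck_on k S g" if "\<forall>x\<in>S. f x = g x" "Ck_on k S f" for f g :: "'a \<Rightarrow> 'b"
    using that
  proof (induction k arbitrary: f g)
    case 0
    then show ?case
      using continuous_on_cong[of S S f g] by auto
  next
    case (Suc k)
    have der: "(g has_derivative frechet_derivative f (at x)) (at x)" if "x \<in> S" for x
      using Suc.prems that has_derivative_transform_within_open[of f _ x UNIV S g] assms(1)
      by (auto simp: frechet_derivative_works)
    then have eq: "frechet_derivative g (at x) = frechet_derivative f (at x)" if "x \<in> S" for x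
      using that frechet_derivative_at by metis
    have "Ck_on k S (\<lambda>x. frechet_derivative g (at x) v)" for v
      using Suc.IH[of "\<lambda>x. frechet_derivative f (at x) v" "\<lambda>x. frechet_derivative g (at x) v"]
        Suc.prems eq by auto
    with der show ?case
      by (auto simp: differentiable_def)
  qed
  show ?thesis
    using *[of f g] *[of g f] assms(2) by auto
qed

lemma Ck_on_eqI:
  "open S \<Longrightarrow> Ck_on k S f \<Longrightarrow> (\<And>x. x \<in> S \<Longrightarrow> f x = g x) \<Longrightarrow> Ck_on k S g"
  using Ck_on_cong by blast

lemma Ck_on_Suc_imp: "Ck_on (Suc k) S f \<Longrightarrow> Ck_on k S f"
proof (induction k arbitrary: f)
  case 0
  then have "f differentiable_on S"
    by (simp add: differentiable_at_imp_differentiable_on)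
  then show ?case
    by (simp add: differentiable_imp_continuous_on)
next
  case (Suc k)
  then show ?case
    by (metis Ck_on.simps(2))
qed

lemma Ck_on_subset: "Ck_on k S f \<Longrightarrow> T \<subseteq> S \<Longrightarrow> Ck_on k T f"
  by (induction k arbitrary: f) (auto intro: continuous_on_subset)

text \<open>Every derivative in \<open>Ck_on\<close> is taken \<open>at x\<close> in the whole
  space, so only arbitrarily small neighbourhoods of the points matter. This glues charts in
  \<open>smooth_fun_local\<close> and extensions by zero in
  \<open>smooth_on_extend_zero\<close>.\<close>

lemma Ck_on_local:
  assumes "\<And>x. x \<in> S \<Longrightarrow> \<exists>U. open U \<and> x \<in> U \<and> Ck_on k U f"
  shows "Ck_on k S f"
  using assms
proof (induction k arbitrary: f)
  case 0
  have "continuous (at x within S) f" if x: "x \<in> S" for x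
  proof -
    obtain U where "open U" "x \<in> U" "continuous_on U f"
      using "0.prems"[OF x] by (simp only: Ck_on.simps) blast
    then show ?thesis
      by (metis continuous_on_eq_continuous_at continuous_at_imp_continuous_at_within)
  qed
  then show ?case
    by (simp add: continuous_on_eq_continuous_within)
next
  case (Suc k)
  have "f differentiable (at x)" if "x \<in> S" for x
    using Suc.prems[OF that] by auto
  moreover have "Ck_on k S (\<lambda>x. frechet_derivative f (at x) v)" for v
  proof (rule Suc.IH)
    fix x assume "x \<in> S"
    from Suc.prems[OF this] show "\<exists>U. open U \<and> x \<in> U \<and> Ck_on k U (\<lambda>x. frechet_derivative f (at x) v)"
      by auto
  qed
  ultimately show ?case by simp
qed

lemma Ck_on_const: "Ck_on k S (\<lambda>_. c)"
  by (induction k arbitrary: c) (auto simp: frechet_derivative_const)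

lemma Ck_on_add:
  assumes "open S" "Ck_on k S f" "Ck_on k S g"
  shows "Ck_on k S (\<lambda>x. f x + g x)"
  using assms(2,3)
proof (induction k arbitrary: f g)
  case 0
  then show ?case by (auto intro: continuous_intros)
next
  case (Suc k)
  have der: "((\<lambda>x. f x + g x) has_derivative
     (\<lambda>v. frechet_derivative f (at x) v + frechet_derivative g (at x) v)) (at x)" if "x \<in> S" for x
    using Suc.prems that by (intro has_derivative_add) (auto simp: frechet_derivative_works)
  have eq: "frechet_derivative f (at x) v + frechet_derivative g (at x) v
     = frechet_derivative (\<lambda>x. f x + g x) (at x) v" if "x \<in> S" for x v
    by (rule fun_cong[OF frechet_derivative_at[OF der[OF that]]])
  have "Ck_on k S (\<lambda>x. frechet_derivative f (at x) v + frechet_derivative g (at x) v)" for v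
    by (rule Suc.IH) (use Suc.prems in simp_all)
  then have "Ck_on k S (\<lambda>x. frechet_derivative (\<lambda>x. f x + g x) (at x) v)" for v
    by (rule Ck_on_eqI[OF assms(1)]) (rule eq)
  with der show ?case
    by (auto simp: differentiable_def)
qed

lemma Ck_on_sum:
  assumes "open S" "\<And>i. i \<in> I \<Longrightarrow> Ck_on k S (f i)"
  shows "Ck_on k S (\<lambda>x. \<Sum>i\<in>I. f i x)"
  using assms(2) by (induction I rule: infinite_finite_induct) (auto intro: Ck_on_add assms(1) Ck_on_const)

lemma Ck_on_linear:
  assumes "open S" "bounded_linear L" "Ck_on k S f"
  shows "Ck_on k S (\<lambda>x. L (f x))"
  using assms(3)
proof (induction k arbitrary: f)
  case 0
  then show ?case using assms(2)
    by (auto intro: bounded_linear.continuous_on)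
next
  case (Suc k)
  have der: "((\<lambda>x. L (f x)) has_derivative (\<lambda>v. L (frechet_derivative f (at x) v))) (at x)" if "x \<in> S" for x
    using Suc.prems that bounded_linear.has_derivative[OF assms(2)]
    by (auto simp: frechet_derivative_works)
  have eq: "L (frechet_derivative f (at x) v) = frechet_derivative (\<lambda>x. L (f x)) (at x) v"
    if "x \<in> S" for x v
    by (rule fun_cong[OF frechet_derivative_at[OF der[OF that]]])
  have "Ck_on k S (\<lambda>x. L (frechet_derivative f (at x) v))" for v
    by (rule Suc.IH) (use Suc.prems in simp_all)
  then have "Ck_on k S (\<lambda>x. frechet_derivative (\<lambda>x. L (f x)) (at x) v)" for v
    by (rule Ck_on_eqI[OF assms(1)]) (rule eq)
  with der show ?case
    by (auto simp: differentiable_def)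
qed

lemma Ck_on_bilinear:
  assumes "open S" "bounded_bilinear b" "Ck_on k S f" "Ck_on k S g"
  shows "Ck_on k S (\<lambda>x. b (f x) (g x))"
  using assms(3,4)
proof (induction k arbitrary: f g)
  case 0
  then show ?case using assms(2)
    by (auto intro: bounded_bilinear.continuous_on)
next
  case (Suc k)
  have der: "((\<lambda>x. b (f x) (g x)) has_derivative
     (\<lambda>v. b (f x) (frechet_derivative g (at x) v) + b (frechet_derivative f (at x) v) (g x))) (at x)" if "x \<in> S" for x
    using Suc.prems that by (intro bounded_bilinear.FDERIV[OF assms(2)]) (auto simp: frechet_derivative_works)
  have eq: "b (f x) (frechet_derivative g (at x) v) + b (frechet_derivative f (at x) v) (g x)
     = frechet_derivative (\<lambda>x. b (f x) (g x)) (at x) v" if "x \<in> S" for x v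
    by (rule fun_cong[OF frechet_derivative_at[OF der[OF that]]])
  \<comment> \<open>The derivative contains undifferentiated factors, so these are needed at order
    \<open>k\<close> too.\<close>
  have "Ck_on k S f" "Ck_on k S g"
    by (rule Ck_on_Suc_imp, rule Suc.prems)+
  then have "Ck_on k S (\<lambda>x. b (f x) (frechet_derivative g (at x) v) + b (frechet_derivative f (at x) v) (g x))" for v
    using Suc.IH Suc.prems by (intro Ck_on_add assms) auto
  then have "Ck_on k S (\<lambda>x. frechet_derivative (\<lambda>x. b (f x) (g x)) (at x) v)" for v
    by (rule Ck_on_eqI[OF assms(1)]) (rule eq)
  with der show ?case
    by (auto simp: differentiable_def)
qed

lemma linear_Basis_sum:
  fixes v :: "'e::euclidean_space"
  assumes "linear D"
  shows "D v = (\<Sum>b\<in>Basis. (v \<bullet> b) *\<^sub>R D b)"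
proof -
  have "D v = D (\<Sum>b\<in>Basis. (v \<bullet> b) *\<^sub>R b)"
    by (simp add: euclidean_representation)
  then show ?thesis
    by (simp add: linear_sum[OF assms] linear_scale[OF assms])
qed

text \<open>\<open>Ck_on\<close> iterates derivatives in fixed directions only, while the chain rule
  applies the derivative of \<open>g\<close> to \<open>frechet_derivative f (at x) v\<close>, which
  moves with \<open>x\<close>. Expanding this vector in \<open>Basis\<close> gives a finite sum of
  products, to which the induction hypothesis applies; hence the Euclidean codomain of
  \<open>f\<close>.\<close>

lemma Ck_on_compose:
  fixes f :: "'e::real_normed_vector \<Rightarrow> 'f::euclidean_space" and g :: "'f \<Rightarrow> 'g::real_normed_vector"
  assumes "open S" "open T" "Ck_on k S f" "Ck_on k T g" "f ` S \<subseteq> T"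
  shows "Ck_on k S (\<lambda>x. g (f x))"
  using assms(3,4)
proof (induction k arbitrary: g)
  case 0
  then show ?case using assms(5)
    by (auto intro: continuous_on_compose2)
next
  case (Suc k)
  have der: "((\<lambda>x. g (f x)) has_derivative
     (\<lambda>v. frechet_derivative g (at (f x)) (frechet_derivative f (at x) v))) (at x)" if "x \<in> S" for x
    using Suc.prems assms(5) that by (intro has_derivative_compose[where f=f and g=g])
     (auto simp: frechet_derivative_works image_subset_iff)
  have eq: "(\<Sum>b\<in>Basis. (frechet_derivative f (at x) v \<bullet> b) *\<^sub>R frechet_derivative g (at (f x)) b)
      = frechet_derivative (\<lambda>x. g (f x)) (at x) v" if "x \<in> S" for x v
  proof -
    have "linear (frechet_derivative g (at (f x)))"
      using Suc.prems assms(5) that by (auto intro!: linear_frechet_derivative)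
    note lin = linear_Basis_sum[OF this, of "frechet_derivative f (at x) v"]
    show ?thesis
      by (rule trans[OF lin[symmetric] fun_cong[OF frechet_derivative_at[OF der[OF that]]]])
  qed
  have "Ck_on k S f"
    by (rule Ck_on_Suc_imp[OF Suc.prems(1)])
  then have comp: "Ck_on k S (\<lambda>x. frechet_derivative g (at (f x)) b)" for b
    by (rule Suc.IH) (use Suc.prems in simp)
  have "Ck_on k S (\<lambda>x. frechet_derivative f (at x) v)" for v
    using Suc.prems(1) by simp
  then have "Ck_on k S (\<lambda>x. (frechet_derivative f (at x) v \<bullet> b) *\<^sub>R frechet_derivative g (at (f x)) b)" for v b
    by (intro Ck_on_bilinear[OF assms(1) bounded_bilinear_scaleR]
       Ck_on_linear[OF assms(1) bounded_linear_inner_left] comp)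
  then have "Ck_on k S (\<lambda>x. (\<Sum>b\<in>Basis. (frechet_derivative f (at x) v \<bullet> b) *\<^sub>R frechet_derivative g (at (f x)) b))" for v
    by (rule Ck_on_sum[OF assms(1)])
  then have "Ck_on k S (\<lambda>x. frechet_derivative (\<lambda>x. g (f x)) (at x) v)" for v
    by (rule Ck_on_eqI[OF assms(1)]) (rule eq)
  with der show ?case
    by (auto simp: differentiable_def)
qed

section \<open>Closure properties of smooth functions on open sets\<close>

lemma smooth_on_cong: "open S \<Longrightarrow> (\<And>x. x \<in> S \<Longrightarrow> f x = g x) \<Longrightarrow> smooth_on S f \<longleftrightarrow> smooth_on S g"
  unfolding smooth_on_def using Ck_on_cong by blast

lemma smooth_on_eqI:
  "open S \<Longrightarrow> smooth_on S f \<Longrightarrow> (\<And>x. x \<in> S \<Longrightarrow> f x = g x) \<Longrightarrow> smooth_on S g"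
  using smooth_on_cong by blast

lemma smooth_on_subset: "smooth_on S f \<Longrightarrow> T \<subseteq> S \<Longrightarrow> smooth_on T f"
  unfolding smooth_on_def using Ck_on_subset by blast

lemma smooth_on_local:
  assumes "\<And>x. x \<in> S \<Longrightarrow> \<exists>U. open U \<and> x \<in> U \<and> smooth_on U f"
  shows "smooth_on S f"
  using assms unfolding smooth_on_def by (meson Ck_on_local)

lemma smooth_on_const: "smooth_on S (\<lambda>_. c)"
  by (simp add: smooth_on_def Ck_on_const)

lemma smooth_on_add: "open S \<Longrightarrow> smooth_on S f \<Longrightarrow> smooth_on S g \<Longrightarrow> smooth_on S (\<lambda>x. f x + g x)"
  by (simp add: smooth_on_def Ck_on_add)

lemma smooth_on_sum: "open S \<Longrightarrow> (\<And>i. i \<in> I \<Longrightarrow> smooth_on S (f i)) \<Longrightarrow> smooth_on S (\<lambda>x. \<Sum>i\<in>I. f i x)"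
  by (simp add: smooth_on_def Ck_on_sum)

lemma smooth_on_linear: "open S \<Longrightarrow> bounded_linear L \<Longrightarrow> smooth_on S f \<Longrightarrow> smooth_on S (\<lambda>x. L (f x))"
  by (simp add: smooth_on_def Ck_on_linear)

lemma smooth_on_scaleR: "open S \<Longrightarrow> smooth_on S f \<Longrightarrow> smooth_on S g \<Longrightarrow> smooth_on S (\<lambda>x. f x *\<^sub>R g x)"
  by (simp add: smooth_on_def Ck_on_bilinear[OF _ bounded_bilinear_scaleR])

lemma smooth_on_mult:
  fixes f g :: "'e::real_normed_vector \<Rightarrow> real"
  shows "open S \<Longrightarrow> smooth_on S f \<Longrightarrow> smooth_on S g \<Longrightarrow> smooth_on S (\<lambda>x. f x * g x)"
  by (simp add: smooth_on_def Ck_on_bilinear[OF _ bounded_bilinear_mult])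

lemma smooth_on_prod:
  fixes f :: "'i \<Rightarrow> 'e::real_normed_vector \<Rightarrow> real"
  shows "open S \<Longrightarrow> (\<And>i. i \<in> I \<Longrightarrow> smooth_on S (f i)) \<Longrightarrow> smooth_on S (\<lambda>x. \<Prod>i\<in>I. f i x)"
  by (induction I rule: infinite_finite_induct) (auto intro: smooth_on_mult smooth_on_const)

lemma smooth_on_diff:
  assumes "open S" "smooth_on S f" "smooth_on S g"
  shows "smooth_on S (\<lambda>x. f x - g x)"
proof -
  have "smooth_on S (\<lambda>x. - g x)"
    by (rule smooth_on_linear[OF assms(1) _ assms(3)]) (rule bounded_linear_minus[OF bounded_linear_ident])
  from smooth_on_add[OF assms(1,2) this] show ?thesis by simp
qed

lemma smooth_on_compose:
  fixes f :: "'e::real_normed_vector \<Rightarrow> 'f::euclidean_space" and g :: "'f \<Rightarrow> 'g::real_normed_vector"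
  shows "open S \<Longrightarrow> open T \<Longrightarrow> smooth_on S f \<Longrightarrow> smooth_on T g \<Longrightarrow> f ` S \<subseteq> T \<Longrightarrow> smooth_on S (\<lambda>x. g (f x))"
  by (simp add: smooth_on_def Ck_on_compose)

lemma smooth_on_imp_differentiable: "smooth_on S f \<Longrightarrow> x \<in> S \<Longrightarrow> f differentiable (at x)"
  unfolding smooth_on_def using Ck_on.simps(2)[of 0 S f] by simp

lemma smooth_on_imp_has_derivative:
  "smooth_on S f \<Longrightarrow> x \<in> S \<Longrightarrow> (f has_derivative frechet_derivative f (at x)) (at x)"
  using smooth_on_imp_differentiable frechet_derivative_works by blast

lemma smooth_on_imp_continuous_on: "smooth_on S f \<Longrightarrow> continuous_on S f"
  unfolding smooth_on_def using Ck_on.simps(1)[of S f] by simp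

lemma smooth_on_deriv: "smooth_on S f \<Longrightarrow> smooth_on S (\<lambda>x. frechet_derivative f (at x) v)"
  unfolding smooth_on_def using Ck_on.simps(2)[of _ S f] by simp

lemma smooth_on_id: "open S \<Longrightarrow> smooth_on S (\<lambda>x. x)"
  unfolding smooth_on_def
proof
  fix k assume "open S"
  show "Ck_on k S (\<lambda>x. x)"
  proof (cases k)
    case (Suc m)
    have "frechet_derivative (\<lambda>x::'a. x) (at x) v = v" for x v
      using frechet_derivative_at[of "\<lambda>x. x" "\<lambda>x. x" x] by (simp add: fun_eq_iff)
    then show ?thesis using Suc by (simp add: Ck_on_const)
  qed (simp add: continuous_on_id)
qed

text \<open>The same expansion in \<open>Basis\<close> as for the chain rule, now for a direction
  given by a vector field; this is the shape of a Lie derivative in a chart.\<close>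

lemma smooth_on_deriv_along:
  fixes f :: "'e::euclidean_space \<Rightarrow> 'f::real_normed_vector"
  assumes "open S" "smooth_on S f" "smooth_on S V"
  shows "smooth_on S (\<lambda>x. frechet_derivative f (at x) (V x))"
proof -
  have eq: "frechet_derivative f (at x) (V x) = (\<Sum>b\<in>Basis. (V x \<bullet> b) *\<^sub>R frechet_derivative f (at x) b)"
    if "x \<in> S" for x
    using that assms(2)
    by (intro linear_Basis_sum linear_frechet_derivative smooth_on_imp_differentiable)
  have "smooth_on S (\<lambda>x. (V x \<bullet> b) *\<^sub>R frechet_derivative f (at x) b)" for b
    by (intro smooth_on_scaleR smooth_on_deriv[OF assms(2)]
        smooth_on_linear[OF _ bounded_linear_inner_left] assms)
  then show ?thesis
    by (subst smooth_on_cong[OF assms(1) eq]) (auto intro: smooth_on_sum assms)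
qed

section \<open>Bump functions and compactly supported derivatives\<close>

text \<open>The functions t^(-m) exp(-1/t), extended by zero. Differentiating exp(-1/t) produces
  negative powers of t; with the index \<open>m\<close> the span of the family is closed under
  differentiation, which is what the induction in \<open>Ck_on_flat_exp\<close> runs on.\<close>

definition flat_exp :: "nat \<Rightarrow> real \<Rightarrow> real" where
  "flat_exp m t = (if 0 < t then inverse t ^ m * exp (- inverse t) else 0)"

lemma flat_exp_tendsto_0: "(flat_exp m \<longlongrightarrow> 0) (at 0)"
proof -
  have "((\<lambda>x::real. x ^ m / exp x) \<longlongrightarrow> 0) at_top"
    by (rule tendsto_power_div_exp_0)
  from filterlim_compose[OF this filterlim_inverse_at_top_right]
  have "((\<lambda>t::real. inverse t ^ m / exp (inverse t)) \<longlongrightarrow> 0) (at_right 0)" .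
  then have "(flat_exp m \<longlongrightarrow> 0) (at_right 0)"
    by (rule Lim_transform_eventually)
      (auto simp: flat_exp_def eventually_at_right_less divide_inverse exp_minus
        intro: eventually_mono[OF eventually_at_right_less])
  moreover have "(flat_exp m \<longlongrightarrow> 0) (at_left 0)"
    by (rule Lim_transform_eventually[OF tendsto_const])
      (auto simp: flat_exp_def eventually_at_left_field intro!: exI[of _ "-1"])
  ultimately show ?thesis
    by (simp add: filterlim_split_at)
qed

lemma flat_exp_deriv:
  "(flat_exp m has_real_derivative flat_exp (m + 2) t - real m * flat_exp (m + 1) t) (at t)"
proof -
  consider "t < 0" | "t = 0" | "t > 0" by linarith
  then show ?thesis
  proof cases
    case 1
    have "((\<lambda>_. 0) has_real_derivative 0) (at t)" by simp
    then have "(flat_exp m has_real_derivative 0) (at t)"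
      by (rule has_field_derivative_transform_within_open[where S="{..<0}"])
        (use 1 in \<open>auto simp: flat_exp_def\<close>)
    then show ?thesis using 1 by (simp add: flat_exp_def)
  next
    case 2
    \<comment> \<open>The difference quotient at 0 is \<open>flat_exp (Suc m)\<close>, because
      \<open>flat_exp m 0 = 0\<close>.\<close>
    have "((\<lambda>h. flat_exp m h / h) \<longlongrightarrow> 0) (at 0)"
      by (rule Lim_transform_eventually[OF flat_exp_tendsto_0[of "Suc m"]])
        (auto simp: flat_exp_def eventually_at divide_inverse intro!: exI[of _ 1])
    then show ?thesis using 2 by (simp add: DERIV_def flat_exp_def)
  next
    case 3
    have "((\<lambda>t. inverse t ^ m) has_real_derivative
        real m * (- (inverse t ^ Suc (Suc 0)) * inverse t ^ (m - Suc 0))) (at t)"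
      using 3 by (intro DERIV_power DERIV_inverse) simp
    moreover have "((\<lambda>t. exp (- inverse t)) has_real_derivative
        exp (- inverse t) * inverse t ^ Suc (Suc 0)) (at t)"
      using 3 by (auto intro!: derivative_eq_intros)
    ultimately have "((\<lambda>t. inverse t ^ m * exp (- inverse t)) has_real_derivative
        real m * (- (inverse t ^ Suc (Suc 0)) * inverse t ^ (m - Suc 0)) * exp (- inverse t) +
        exp (- inverse t) * inverse t ^ Suc (Suc 0) * inverse t ^ m) (at t)"
      by (rule DERIV_mult)
    \<comment> \<open>The truncated exponent \<open>m - Suc 0\<close> is harmless for
      \<open>m = 0\<close>, as its factor \<open>real m\<close> vanishes.\<close>
    also have "real m * (- (inverse t ^ Suc (Suc 0)) * inverse t ^ (m - Suc 0)) * exp (- inverse t) +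
        exp (- inverse t) * inverse t ^ Suc (Suc 0) * inverse t ^ m =
        flat_exp (m + 2) t - real m * flat_exp (m + 1) t"
      using 3 by (cases m) (auto simp: flat_exp_def)
    finally have "((\<lambda>t. inverse t ^ m * exp (- inverse t)) has_real_derivative
        flat_exp (m + 2) t - real m * flat_exp (m + 1) t) (at t)" .
    then show ?thesis
      by (rule has_field_derivative_transform_within_open[where S="{0<..}"])
        (use 3 in \<open>auto simp: flat_exp_def\<close>)
  qed
qed

lemma Ck_on_flat_exp: "Ck_on k UNIV (flat_exp m)"
proof (induction k arbitrary: m)
  case 0
  show ?case
    using flat_exp_deriv by (auto intro!: continuous_at_imp_continuous_on DERIV_isCont)
next
  case (Suc k)
  have der: "(flat_exp m has_derivative (*) (flat_exp (m + 2) t - real m * flat_exp (m + 1) t)) (at t)" for t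
    using flat_exp_deriv[of m t] by (simp add: has_field_derivative_def)
  have lin: "Ck_on k UNIV (\<lambda>t. c * flat_exp j t)" for c j
    by (rule Ck_on_linear[OF open_UNIV bounded_linear_mult_right Suc.IH])
  have "Ck_on k UNIV (\<lambda>t. v * flat_exp (m + 2) t + (- v * real m) * flat_exp (m + 1) t)" for v
    by (rule Ck_on_add[OF open_UNIV lin lin])
  then have "Ck_on k UNIV (\<lambda>t. frechet_derivative (flat_exp m) (at t) v)" for v
    by (rule Ck_on_eqI[OF open_UNIV])
      (simp add: frechet_derivative_at[OF der, symmetric] algebra_simps)
  then show ?case
    using der by (auto simp: differentiable_def)
qed

lemma smooth_on_inverse: "smooth_on {0<..} (inverse :: real \<Rightarrow> real)"
  unfolding smooth_on_def
proof
  fix k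
  have der: "(inverse has_derivative (\<lambda>v. - (inverse x * v * inverse x))) (at x)" if "x \<in> {0<..}" for x :: real
    using has_derivative_inverse'[of x UNIV] that by simp
  show "Ck_on k {0<..} (inverse :: real \<Rightarrow> real)"
  proof (induction k)
    case 0
    show ?case by (auto intro!: continuous_intros)
  next
    case (Suc k)
    have "Ck_on k {0<..} (\<lambda>x::real. - v * (inverse x * inverse x))" for v
      by (rule Ck_on_linear[OF _ bounded_linear_mult_right])
         (auto intro!: Ck_on_bilinear[OF _ bounded_bilinear_mult] Suc.IH)
    then have "Ck_on k {0<..} (\<lambda>x. frechet_derivative (inverse :: real \<Rightarrow> real) (at x) v)" for v
      by (rule Ck_on_eqI[rotated])
        (simp_all add: frechet_derivative_at[OF der, symmetric] algebra_simps)
    then show ?case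
      using der by (auto simp: differentiable_def)
  qed
qed

text \<open>One of \<open>t\<close> and \<open>1 - t\<close> is positive, so the inverse is only
  taken of positive numbers.\<close>

definition smooth_step :: "real \<Rightarrow> real" where
  "smooth_step t = flat_exp 0 t * inverse (flat_exp 0 t + flat_exp 0 (1 - t))"

lemma smooth_on_smooth_step: "smooth_on UNIV smooth_step"
proof -
  have flat: "smooth_on UNIV (flat_exp 0)"
    by (simp add: smooth_on_def Ck_on_flat_exp)
  have "smooth_on UNIV (\<lambda>t::real. 1 - t)"
    by (intro smooth_on_diff smooth_on_const smooth_on_id open_UNIV)
  then have "smooth_on UNIV (\<lambda>t. flat_exp 0 (1 - t))"
    by (rule smooth_on_compose[OF open_UNIV open_UNIV _ flat]) simp
  then have den: "smooth_on UNIV (\<lambda>t. flat_exp 0 t + flat_exp 0 (1 - t))"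
    by (intro smooth_on_add flat open_UNIV)
  have "smooth_on UNIV (\<lambda>t. inverse (flat_exp 0 t + flat_exp 0 (1 - t)))"
    by (rule smooth_on_compose[OF open_UNIV _ den smooth_on_inverse])
      (auto simp: flat_exp_def add_pos_pos)
  then have "smooth_on UNIV (\<lambda>t. flat_exp 0 t * inverse (flat_exp 0 t + flat_exp 0 (1 - t)))"
    by (intro smooth_on_mult flat open_UNIV)
  then show ?thesis
    by (simp add: smooth_step_def[abs_def])
qed

lemma smooth_step_bounds: "0 \<le> smooth_step t" "smooth_step t \<le> 1"
proof -
  have "0 \<le> flat_exp 0 s" for s by (simp add: flat_exp_def)
  then have *: "0 \<le> flat_exp 0 t" "0 \<le> flat_exp 0 (1 - t)" by auto
  then show "0 \<le> smooth_step t" by (simp add: smooth_step_def)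
  show "smooth_step t \<le> 1"
    using * by (simp add: smooth_step_def divide_inverse[symmetric] divide_le_eq_1 add_nonneg_eq_0_iff)
      (use * in linarith)
qed

lemma smooth_step_eq: "1 \<le> t \<Longrightarrow> smooth_step t = 1" "t \<le> 0 \<Longrightarrow> smooth_step t = 0"
  by (auto simp: smooth_step_def flat_exp_def)

lemma bump_exists:
  fixes a :: "'e::euclidean_space"
  assumes "open U" "a \<in> U"
  obtains \<psi> :: "'e \<Rightarrow> real" and V K where "smooth_on UNIV \<psi>" "\<And>y. 0 \<le> \<psi> y" "\<And>y. \<psi> y \<le> 1"
    "open V" "a \<in> V" "\<And>y. y \<in> V \<Longrightarrow> \<psi> y = 1"
    "compact K" "K \<subseteq> U" "\<And>y. y \<notin> K \<Longrightarrow> \<psi> y = 0"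
proof -
  obtain e where e: "e > 0" "cball a e \<subseteq> U"
    using assms open_contains_cball by blast
  define r where "r = e / 2"
  \<comment> \<open>The squared distance is smooth also at \<open>a\<close>. The argument is at
    least 1 within distance \<open>r\<close> and at most 0 from distance \<open>sqrt 2 * r\<close>
    on, which is less than \<open>e = 2 * r\<close>.\<close>
  define \<psi> where "\<psi> y = smooth_step (2 - inverse (r\<^sup>2) * ((y - a) \<bullet> (y - a)))" for y
  have r: "r > 0" using e by (simp add: r_def)
  have "smooth_on UNIV (\<lambda>y. y - a)"
    by (intro smooth_on_diff smooth_on_const smooth_on_id open_UNIV)
  then have "smooth_on UNIV (\<lambda>y. (y - a) \<bullet> (y - a))"
    by (simp add: smooth_on_def Ck_on_bilinear[OF _ bounded_bilinear_inner])
  then have "smooth_on UNIV (\<lambda>y. 2 - inverse (r\<^sup>2) * ((y - a) \<bullet> (y - a)))"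
    by (intro smooth_on_diff smooth_on_const smooth_on_mult open_UNIV)
  then have 1: "smooth_on UNIV \<psi>"
    unfolding \<psi>_def by (rule smooth_on_compose[OF open_UNIV open_UNIV _ smooth_on_smooth_step]) simp
  have 2: "\<psi> y = 1" if "y \<in> ball a r" for y
  proof -
    have "(y - a) \<bullet> (y - a) \<le> r\<^sup>2"
      using that by (simp add: dot_square_norm dist_norm norm_minus_commute power_mono)
    then show ?thesis
      unfolding \<psi>_def using r by (intro smooth_step_eq) (simp add: field_simps)
  qed
  have 3: "\<psi> y = 0" if "y \<notin> cball a e" for y
  proof -
    have "norm (y - a) \<ge> 2 * r"
      using that by (simp add: dist_norm norm_minus_commute r_def)
    then have "(norm (y - a))\<^sup>2 \<ge> (2 * r)\<^sup>2"
      using r by (intro power_mono) auto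
    then have "(y - a) \<bullet> (y - a) \<ge> 4 * r\<^sup>2"
      by (simp add: dot_square_norm power_mult_distrib)
    moreover have "0 \<le> r\<^sup>2" by simp
    ultimately have "(y - a) \<bullet> (y - a) \<ge> 2 * r\<^sup>2" by linarith
    then show ?thesis
      unfolding \<psi>_def using r by (intro smooth_step_eq) (simp add: field_simps)
  qed
  show thesis
    by (rule that[OF 1 _ _ open_ball _ 2 compact_cball e(2) 3])
      (use r in \<open>auto simp: \<psi>_def smooth_step_bounds\<close>)
qed

text \<open>\<open>S\<close> and the complement of \<open>K\<close> form an open cover, and on the
  second set the extension is zero.\<close>

lemma smooth_on_extend_zero:
  assumes "open S" "smooth_on S g" "closed K" "K \<subseteq> S" "\<And>y. y \<in> S \<Longrightarrow> y \<notin> K \<Longrightarrow> g y = 0"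
  shows "smooth_on UNIV (\<lambda>y. if y \<in> S then g y else 0)"
proof (rule smooth_on_local)
  fix x
  show "\<exists>U. open U \<and> x \<in> U \<and> smooth_on U (\<lambda>y. if y \<in> S then g y else 0)"
  proof (cases "x \<in> S")
    case True
    have "smooth_on S (\<lambda>y. if y \<in> S then g y else 0) = smooth_on S g"
      by (rule smooth_on_cong) (auto simp: assms)
    then show ?thesis using True assms by blast
  next
    case False
    have "smooth_on (-K) (\<lambda>y. if y \<in> S then g y else 0) = smooth_on (-K) (\<lambda>y. 0 :: 'b)"
      by (rule smooth_on_cong) (auto simp: assms open_Compl)
    moreover have "open (- K)" "x \<in> - K"
      using False assms by auto
    ultimately show ?thesis using smooth_on_const by blast
  qed
qed

section \<open>Integrals of derivatives of compactly supported functions\<close>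

lemma integral_supset_eq_UNIV:
  fixes g :: "'e::euclidean_space \<Rightarrow> 'b::euclidean_space"
  assumes "\<And>x. x \<notin> S \<Longrightarrow> g x = 0"
  shows "integral S g = integral UNIV g"
  unfolding integral_restrict_UNIV[symmetric, of S g]
  by (rule integral_cong) (use assms in auto)

text \<open>Differentiate the translation invariant integral of \<open>g (x + t e)\<close> at \<open>t = 0\<close>.\<close>

lemma integral_directional_derivative_eq_0:
  fixes g :: "'e::euclidean_space \<Rightarrow> real"
  assumes "smooth_on UNIV g" "compact K" "\<And>x. x \<notin> K \<Longrightarrow> g x = 0"
  shows "integral UNIV (\<lambda>x. frechet_derivative g (at x) e) = 0"
proof -
  obtain R where R: "\<And>x. x \<in> K \<Longrightarrow> norm x \<le> R"
    using compact_imp_bounded[OF assms(2)] by (auto simp: bounded_iff)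
  \<comment> \<open>Large enough that the box shifted by \<open>t *\<^sub>R e\<close> still contains
    \<open>K\<close> whenever \<bar>t\<bar> \<le> 1; near \<open>t = 0\<close> the integral over the
    fixed box is therefore constant in \<open>t\<close>.\<close>
  define b :: 'e where "b = (R + norm e) *\<^sub>R One"
  have in_box: "x \<in> cbox (- b + t *\<^sub>R e) (b + t *\<^sub>R e)" if "x \<in> K" "\<bar>t\<bar> \<le> 1" for x t
  proof -
    have "\<bar>x \<bullet> i - t * (e \<bullet> i)\<bar> \<le> R + norm e" if "i \<in> Basis" for i
    proof -
      have "\<bar>x \<bullet> i\<bar> \<le> R"
        using Basis_le_norm[OF that, of x] R[OF \<open>x \<in> K\<close>] by linarith
      moreover have "\<bar>t\<bar> * \<bar>e \<bullet> i\<bar> \<le> 1 * norm e"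
        using Basis_le_norm[OF that, of e] \<open>\<bar>t\<bar> \<le> 1\<close> by (intro mult_mono) auto
      ultimately show ?thesis
        by (simp add: abs_mult[symmetric])
    qed
    then show ?thesis
      by (fastforce simp: mem_box b_def inner_simps abs_le_iff)
  qed
  have der: "((\<lambda>t. g (x + t *\<^sub>R e)) has_field_derivative frechet_derivative g (at (x + t *\<^sub>R e)) e) (at t within UNIV)"
    for x t
  proof -
    have "((\<lambda>t. g (x + t *\<^sub>R e)) has_derivative (\<lambda>s. frechet_derivative g (at (x + t *\<^sub>R e)) (s *\<^sub>R e))) (at t)"
      by (rule has_derivative_compose[OF _ smooth_on_imp_has_derivative[OF assms(1)]])
        (auto intro!: derivative_eq_intros)
    moreover have "linear (frechet_derivative g (at y))" for y
      by (intro linear_frechet_derivative smooth_on_imp_differentiable[OF assms(1)]) simp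
    moreover have "(\<lambda>s. s * c) = (*) c" for c :: real
      by (simp add: fun_eq_iff)
    ultimately show ?thesis
      by (simp add: has_field_derivative_def linear_scale)
  qed
  have cont: "continuous_on UNIV (\<lambda>x. frechet_derivative g (at x) e)"
    by (intro smooth_on_imp_continuous_on smooth_on_deriv assms)
  have "((\<lambda>t. integral (cbox (- b) b) (\<lambda>x. g (x + t *\<^sub>R e))) has_field_derivative
      integral (cbox (- b) b) (\<lambda>x. frechet_derivative g (at (x + 0 *\<^sub>R e)) e)) (at 0 within UNIV)"
  proof (rule leibniz_rule_field_derivative[OF der])
    show "(\<lambda>x. g (x + t *\<^sub>R e)) integrable_on cbox (- b) b" for t
      by (intro integrable_continuous continuous_on_compose2[OF smooth_on_imp_continuous_on[OF assms(1)]]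
          continuous_intros) auto
    show "continuous_on (UNIV \<times> cbox (- b) b) (\<lambda>(t, x). frechet_derivative g (at (x + t *\<^sub>R e)) e)"
      unfolding case_prod_beta
      by (rule continuous_on_compose2[OF cont]) (auto intro!: continuous_intros)
  qed auto
  moreover have "((\<lambda>t. integral (cbox (- b) b) (\<lambda>x. g (x + t *\<^sub>R e))) has_field_derivative 0) (at 0 within UNIV)"
  proof (rule has_field_derivative_transform_within_open[where S="{-1<..<1}"])
    show "((\<lambda>_. integral UNIV g) has_field_derivative 0) (at 0)" by simp
    fix t :: real assume t: "t \<in> {-1<..<1}"
    have "integral (cbox (- b) b) (\<lambda>x. g (x + t *\<^sub>R e)) = integral (cbox (- b + t *\<^sub>R e) (b + t *\<^sub>R e)) g"
      using integral_shift_cbox[of "- b + t *\<^sub>R e" "t *\<^sub>R e" "b + t *\<^sub>R e" g] by simp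
    also have "\<dots> = integral UNIV g"
      by (rule integral_supset_eq_UNIV) (use in_box[of _ t] assms(3) t in fastforce)
    finally show "integral UNIV g = integral (cbox (- b) b) (\<lambda>x. g (x + t *\<^sub>R e))" ..
  qed auto
  ultimately have "integral (cbox (- b) b) (\<lambda>x. frechet_derivative g (at x) e) = 0"
    using DERIV_unique by fastforce
  moreover have "frechet_derivative g (at x) e = 0" if "x \<notin> cbox (- b) b" for x
  proof -
    have "x \<in> - K" using that in_box[of x 0] by auto
    moreover have "open (- K)"
      using assms(2) by (simp add: compact_imp_closed open_Compl)
    moreover have "((\<lambda>_. 0) has_derivative (\<lambda>_. 0)) (at x)" by simp
    ultimately have "(g has_derivative (\<lambda>_. 0)) (at x)"
      using has_derivative_transform_within_open[of "\<lambda>_. 0" _ x UNIV "- K" g] assms(3) by simp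
    from frechet_derivative_at[OF this] show ?thesis by metis
  qed
  ultimately show ?thesis
    using integral_supset_eq_UNIV[of "cbox (- b) b" "\<lambda>x. frechet_derivative g (at x) e"] by simp
qed

section \<open>Charts and partitions of unity\<close>

text \<open>The summands are the partition functions of \<open>partition_exists\<close>. The product
  on the right vanishes as soon as one \<open>\<psi> j\<close> is 1, so the sum is then exactly 1
  without any normalisation.\<close>

lemma sum_telescoping_prod:
  "(\<Sum>i<N. \<psi> i * (\<Prod>j<i. 1 - \<psi> j)) = 1 - (\<Prod>j<N. 1 - \<psi> j :: real)" for N :: nat
  by (induction N) (auto simp: algebra_simps)

text \<open>The change of variables theorem for \<open>real ^ 'n\<close> asks for a well-ordered
  index type, hence the sort of \<open>'n\<close>.\<close>

locale oriented_atlas =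
  fixes A :: "('a::{t2_space, second_countable_topology}, 'n::{finite, wellorder}) chart set"
  assumes atlas: "oriented_smooth_atlas A"
begin

lemma open_cdom: "c \<in> A \<Longrightarrow> open (cdom c)"
  and open_cimg: "c \<in> A \<Longrightarrow> open (cimg c)"
  and chart_homeomorphism: "c \<in> A \<Longrightarrow> homeomorphism (cdom c) (cimg c) (cmap c) (cinv c)"
  using atlas by (auto simp: oriented_smooth_atlas_def)

lemma cinv_cmap: "c \<in> A \<Longrightarrow> x \<in> cdom c \<Longrightarrow> cinv c (cmap c x) = x"
  and cmap_in_cimg: "x \<in> cdom c \<Longrightarrow> cmap c x \<in> cimg c"
  and cinv_in_cdom: "c \<in> A \<Longrightarrow> y \<in> cimg c \<Longrightarrow> cinv c y \<in> cdom c"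
  and cmap_cinv: "c \<in> A \<Longrightarrow> y \<in> cimg c \<Longrightarrow> cmap c (cinv c y) = y"
  using chart_homeomorphism[of c] by (auto simp: homeomorphism_def cimg_def)

lemma continuous_on_cmap: "c \<in> A \<Longrightarrow> continuous_on (cdom c) (cmap c)"
  and continuous_on_cinv: "c \<in> A \<Longrightarrow> continuous_on (cimg c) (cinv c)"
  using chart_homeomorphism[of c] by (auto simp: homeomorphism_def)

text \<open>Since \<open>cinv c\<close> is continuous, openness of chart images follows from this
  description.\<close>

lemma cmap_image_eq: "c \<in> A \<Longrightarrow> U \<subseteq> cdom c \<Longrightarrow> cmap c ` U = cimg c \<inter> cinv c -` U"
proof (intro set_eqI iffI)
  fix y assume c: "c \<in> A" "U \<subseteq> cdom c" and "y \<in> cmap c ` U"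
  then obtain x where "x \<in> U" "y = cmap c x" by blast
  with c show "y \<in> cimg c \<inter> cinv c -` U"
    using cinv_cmap[OF c(1), of x] cmap_in_cimg[of x c] by auto
next
  fix y assume c: "c \<in> A" and y: "y \<in> cimg c \<inter> cinv c -` U"
  then have "y = cmap c (cinv c y)" using cmap_cinv[OF c] by simp
  with y show "y \<in> cmap c ` U" by blast
qed

lemma open_cmap_image: "c \<in> A \<Longrightarrow> open U \<Longrightarrow> U \<subseteq> cdom c \<Longrightarrow> open (cmap c ` U)"
  by (simp add: cmap_image_eq continuous_open_preimage continuous_on_cinv open_cimg)

lemma open_cdom_preimage: "c \<in> A \<Longrightarrow> open S \<Longrightarrow> open (cdom c \<inter> cmap c -` S)"
  by (simp add: continuous_open_preimage continuous_on_cmap open_cdom)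

lemma chart_at: "chart_at A x \<in> A" "x \<in> cdom (chart_at A x)"
proof -
  have "\<exists>c. c \<in> A \<and> x \<in> cdom c"
    using atlas UNIV_I[of x] unfolding oriented_smooth_atlas_def by (metis UN_E)
  then have "chart_at A x \<in> A \<and> x \<in> cdom (chart_at A x)"
    unfolding chart_at_def by (rule someI_ex)
  then show "chart_at A x \<in> A" "x \<in> cdom (chart_at A x)" by auto
qed

lemma smooth_on_transition:
  "c \<in> A \<Longrightarrow> d \<in> A \<Longrightarrow> smooth_on (cmap c ` (cdom c \<inter> cdom d)) (cmap d \<circ> cinv c)"
  and det_jacobian_pos: "c \<in> A \<Longrightarrow> d \<in> A \<Longrightarrow> x \<in> cdom c \<Longrightarrow> x \<in> cdom d \<Longrightarrow> 0 < det (jacobian c d x)"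
  using atlas by (auto simp: oriented_smooth_atlas_def)

lemma has_derivative_transition:
  assumes "c \<in> A" "d \<in> A" "x \<in> cdom c" "x \<in> cdom d"
  shows "((cmap d \<circ> cinv c) has_derivative (*v) (jacobian c d x)) (at (cmap c x))"
proof -
  have "((cmap d \<circ> cinv c) has_derivative frechet_derivative (cmap d \<circ> cinv c) (at (cmap c x))) (at (cmap c x))"
    by (rule smooth_on_imp_has_derivative[OF smooth_on_transition[of c d]]) (use assms in auto)
  moreover from this have "linear (frechet_derivative (cmap d \<circ> cinv c) (at (cmap c x)))"
    by (rule has_derivative_linear)
  ultimately show ?thesis
    by (simp add: jacobian_def matrix_works)
qed

section \<open>Smooth functions and their Lie derivatives\<close>

lemma smooth_funD: "smooth_fun A f \<Longrightarrow> c \<in> A \<Longrightarrow> smooth_on (cimg c) (f \<circ> cinv c)"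
  by (simp add: smooth_fun_def)

text \<open>\<open>smooth_fun\<close> speaks of all charts of the atlas; composing with smooth
  transition maps reduces it to one chart around each point.\<close>

lemma smooth_fun_local:
  assumes "\<And>x. \<exists>c\<in>A. \<exists>U. open U \<and> x \<in> U \<and> U \<subseteq> cdom c \<and> smooth_on (cmap c ` U) (f \<circ> cinv c)"
  shows "smooth_fun A f"
  unfolding smooth_fun_def
proof (intro ballI smooth_on_local)
  fix d y assume d: "d \<in> A" and y: "y \<in> cimg d"
  from assms[of "cinv d y"] obtain c U where c: "c \<in> A" and U: "open U" "cinv d y \<in> U" "U \<subseteq> cdom c"
    "smooth_on (cmap c ` U) (f \<circ> cinv c)" by auto
  define W where "W = cmap d ` (U \<inter> cdom d)"
  have W: "open W" "y \<in> W"
    using U d y cinv_in_cdom[OF d y] cmap_cinv[OF d y]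
    by (auto simp: W_def image_iff intro!: open_cmap_image open_cdom open_Int bexI[of _ "cinv d y"])
  have "smooth_on W (\<lambda>y. (f \<circ> cinv c) ((cmap c \<circ> cinv d) y))"
  proof (rule smooth_on_compose[OF W(1) open_cmap_image[OF c U(1,3)] _ U(4)])
    show "smooth_on W (cmap c \<circ> cinv d)"
      by (rule smooth_on_subset[OF smooth_on_transition[OF d c]]) (use U in \<open>auto simp: W_def\<close>)
    show "(cmap c \<circ> cinv d) ` W \<subseteq> cmap c ` U"
      using cinv_cmap[OF d] by (auto simp: W_def)
  qed
  moreover have "(f \<circ> cinv c) ((cmap c \<circ> cinv d) y) = (f \<circ> cinv d) y" if "y \<in> W" for y
    using that U(3) cinv_cmap[OF c] cinv_cmap[OF d] by (auto simp: W_def)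
  ultimately have "smooth_on W (f \<circ> cinv d)"
    by (rule smooth_on_eqI[OF W(1)])
  with W show "\<exists>U. open U \<and> y \<in> U \<and> smooth_on U (f \<circ> cinv d)" by blast
qed

lemma smooth_fun_const: "smooth_fun A (\<lambda>_. r)"
  by (simp add: smooth_fun_def o_def smooth_on_const)

lemma smooth_fun_add: "smooth_fun A f \<Longrightarrow> smooth_fun A g \<Longrightarrow> smooth_fun A (\<lambda>x. f x + g x)"
  by (simp add: smooth_fun_def o_def open_cimg smooth_on_add)

lemma smooth_fun_mult: "smooth_fun A f \<Longrightarrow> smooth_fun A g \<Longrightarrow> smooth_fun A (\<lambda>x. f x * g x)"
  by (simp add: smooth_fun_def o_def open_cimg smooth_on_mult)

lemma smooth_fun_diff: "smooth_fun A f \<Longrightarrow> smooth_fun A g \<Longrightarrow> smooth_fun A (\<lambda>x. f x - g x)"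
  by (simp add: smooth_fun_def o_def open_cimg smooth_on_diff)

lemma smooth_fun_prod: "(\<And>i. i \<in> I \<Longrightarrow> smooth_fun A (f i)) \<Longrightarrow> smooth_fun A (\<lambda>x. \<Prod>i\<in>I. f i x)"
  by (induction I rule: infinite_finite_induct) (auto intro: smooth_fun_mult smooth_fun_const)

lemma vfieldsD:
  assumes "X \<in> vfields A"
  shows "c \<in> A \<Longrightarrow> d \<in> A \<Longrightarrow> x \<in> cdom c \<Longrightarrow> x \<in> cdom d \<Longrightarrow> X x d = jacobian c d x *v X x c"
    "c \<in> A \<Longrightarrow> smooth_on (cimg c) (\<lambda>y. X (cinv c y) c)"
  using assms unfolding vfields_def by blast+

lemma smooth_fun_has_derivative:
  assumes "smooth_fun A f" "c \<in> A" "x \<in> cdom c"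
  shows "((f \<circ> cinv c) has_derivative frechet_derivative (f \<circ> cinv c) (at (cmap c x))) (at (cmap c x))"
  by (rule smooth_on_imp_has_derivative[OF smooth_funD[OF assms(1,2)]])
    (use assms in \<open>simp add: cmap_in_cimg\<close>)

text \<open>The Jacobian from the chain rule is the one in the transformation law of
  \<open>X\<close>. Since \<open>chart_at\<close> may jump from point to point, smoothness of
  \<open>lie_fun A X f\<close> becomes visible only after passing to a fixed chart.\<close>

lemma lie_fun_chart:
  assumes f: "smooth_fun A f" and X: "X \<in> vfields A" and c: "c \<in> A" "x \<in> cdom c"
  shows "lie_fun A X f x = frechet_derivative (f \<circ> cinv c) (at (cmap c x)) (X x c)"
proof -
  define d where "d = chart_at A x"
  have d: "d \<in> A" "x \<in> cdom d" using chart_at by (auto simp: d_def)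
  define D where "D = frechet_derivative (f \<circ> cinv c) (at (cmap c x))"
  have "((f \<circ> cinv c) has_derivative D) (at ((cmap c \<circ> cinv d) (cmap d x)))"
    using smooth_fun_has_derivative[OF f c] d by (simp add: D_def cinv_cmap)
  from has_derivative_compose[OF has_derivative_transition[OF d(1) c(1) d(2) c(2)] this]
  have "((\<lambda>y. (f \<circ> cinv c) ((cmap c \<circ> cinv d) y)) has_derivative (\<lambda>v. D (jacobian d c x *v v))) (at (cmap d x))" .
  then have "((f \<circ> cinv d) has_derivative (\<lambda>v. D (jacobian d c x *v v))) (at (cmap d x))"
    by (rule has_derivative_transform_within_open[where s="cmap d ` (cdom d \<inter> cdom c)"])
     (use c d cinv_cmap[OF c(1)] cinv_cmap[OF d(1)] in \<open>auto intro!: open_cmap_image open_cdom\<close>)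
  from fun_cong[OF frechet_derivative_at[OF this], of "X x d", symmetric]
  have "frechet_derivative (f \<circ> cinv d) (at (cmap d x)) (X x d) = D (jacobian d c x *v X x d)" .
  then show ?thesis
    using vfieldsD(1)[OF X d(1) c(1) d(2) c(2)] by (simp add: lie_fun_def D_def d_def Let_def)
qed

lemma smooth_fun_lie_fun:
  assumes "smooth_fun A f" "X \<in> vfields A"
  shows "smooth_fun A (lie_fun A X f)"
  unfolding smooth_fun_def
proof
  fix c assume c: "c \<in> A"
  have "smooth_on (cimg c) (\<lambda>y. frechet_derivative (f \<circ> cinv c) (at y) (X (cinv c y) c))"
    by (intro smooth_on_deriv_along open_cimg c smooth_funD vfieldsD assms)
  moreover have "frechet_derivative (f \<circ> cinv c) (at y) (X (cinv c y) c) = (lie_fun A X f \<circ> cinv c) y"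
    if "y \<in> cimg c" for y
    using lie_fun_chart[OF assms c cinv_in_cdom[OF c that]] cmap_cinv[OF c that] by simp
  ultimately show "smooth_on (cimg c) (lie_fun A X f \<circ> cinv c)"
    by (rule smooth_on_eqI[OF open_cimg[OF c]])
qed

lemma lie_fun_add:
  assumes "smooth_fun A f" "smooth_fun A g"
  shows "lie_fun A X (\<lambda>x. f x + g x) = (\<lambda>x. lie_fun A X f x + lie_fun A X g x)"
proof
  fix x
  define c where "c = chart_at A x"
  have c: "c \<in> A" "x \<in> cdom c" using chart_at by (auto simp: c_def)
  have eq: "(\<lambda>x. f x + g x) \<circ> cinv c = (\<lambda>y. (f \<circ> cinv c) y + (g \<circ> cinv c) y)" by auto
  from has_derivative_add[OF smooth_fun_has_derivative[OF assms(1) c] smooth_fun_has_derivative[OF assms(2) c]]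
  show "lie_fun A X (\<lambda>x. f x + g x) x = lie_fun A X f x + lie_fun A X g x"
    unfolding lie_fun_def Let_def c_def[symmetric] eq
    by (rule fun_cong[OF frechet_derivative_at, symmetric])
qed

lemma lie_fun_scale:
  assumes "smooth_fun A f"
  shows "lie_fun A X (\<lambda>x. r * f x) = (\<lambda>x. r * lie_fun A X f x)"
proof
  fix x
  define c where "c = chart_at A x"
  have c: "c \<in> A" "x \<in> cdom c" using chart_at by (auto simp: c_def)
  have eq: "(\<lambda>x. r * f x) \<circ> cinv c = (\<lambda>y. r * (f \<circ> cinv c) y)" by auto
  from has_derivative_mult_right[OF smooth_fun_has_derivative[OF assms c]]
  show "lie_fun A X (\<lambda>x. r * f x) x = r * lie_fun A X f x"
    unfolding lie_fun_def Let_def c_def[symmetric] eq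
    by (rule fun_cong[OF frechet_derivative_at, symmetric])
qed

lemma lie_fun_zero: "lie_fun A X (\<lambda>_. 0) = (\<lambda>_. 0)"
  using lie_fun_scale[OF smooth_fun_const[of 0], of X 0] by simp

lemma lie_fun_diff:
  assumes "smooth_fun A f" "smooth_fun A g"
  shows "lie_fun A X (\<lambda>x. f x - g x) = (\<lambda>x. lie_fun A X f x - lie_fun A X g x)"
  using lie_fun_add[OF assms(1) smooth_fun_mult[OF smooth_fun_const[of "-1"] assms(2)], of X]
    lie_fun_scale[OF assms(2), of X "-1"] by simp

lemma lie_fun_local:
  assumes "smooth_fun A f" "open U" "\<And>x. x \<in> U \<Longrightarrow> f x = g x" "x \<in> U"
  shows "lie_fun A X f x = lie_fun A X g x"
proof -
  define c where "c = chart_at A x"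
  have c: "c \<in> A" "x \<in> cdom c" using chart_at by (auto simp: c_def)
  have "((g \<circ> cinv c) has_derivative frechet_derivative (f \<circ> cinv c) (at (cmap c x))) (at (cmap c x))"
    by (rule has_derivative_transform_within_open[OF smooth_fun_has_derivative[OF assms(1) c],
      where s="cmap c ` (cdom c \<inter> U)"])
     (use c assms cinv_cmap[OF c(1)] in \<open>auto intro!: open_cmap_image open_cdom\<close>)
  from frechet_derivative_at[OF this] show ?thesis
    by (simp add: lie_fun_def Let_def c_def)
qed

lemma smooth_fun_lie_funs:
  "smooth_fun A f \<Longrightarrow> set Xs \<subseteq> vfields A \<Longrightarrow> smooth_fun A (foldr (lie_fun A) Xs f)"
  by (induction Xs) (auto intro: smooth_fun_lie_fun)

lemma lie_funs_diff:
  "smooth_fun A f \<Longrightarrow> smooth_fun A g \<Longrightarrow> set Xs \<subseteq> vfields A \<Longrightarrow>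
    foldr (lie_fun A) Xs (\<lambda>x. f x - g x) = (\<lambda>x. foldr (lie_fun A) Xs f x - foldr (lie_fun A) Xs g x)"
  by (induction Xs) (auto simp: lie_fun_diff smooth_fun_lie_funs)

lemma lie_funs_zero: "foldr (lie_fun A) Xs (\<lambda>_. 0) = (\<lambda>_. 0)"
  by (induction Xs) (auto simp: lie_fun_zero)

section \<open>Bump functions and partitions of unity on the manifold\<close>

lemma compact_cinv_image: "c \<in> A \<Longrightarrow> compact K \<Longrightarrow> K \<subseteq> cimg c \<Longrightarrow> compact (cinv c ` K)"
  using continuous_on_subset[OF continuous_on_cinv] by (intro compact_continuous_image) auto

lemma compact_cmap_image: "c \<in> A \<Longrightarrow> compact K \<Longrightarrow> K \<subseteq> cdom c \<Longrightarrow> compact (cmap c ` K)"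
  using continuous_on_subset[OF continuous_on_cmap] by (intro compact_continuous_image) auto

text \<open>The manifold is Hausdorff, so the compact image of \<open>K\<close> is closed; near
  every point outside it, including the boundary of the chart domain, the extension is identically
  zero.\<close>

lemma extend_from_chart:
  assumes c: "c \<in> A" and S: "open S" "S \<subseteq> cimg c" and h: "smooth_on S h"
    and K: "compact K" "K \<subseteq> S" "\<And>y. y \<in> S \<Longrightarrow> y \<notin> K \<Longrightarrow> h y = 0"
  defines "f \<equiv> \<lambda>x. if x \<in> cdom c \<and> cmap c x \<in> S then h (cmap c x) else (0::real)"
  shows "smooth_fun A f" "supp f \<subseteq> cinv c ` K"
proof -
  let ?K = "cinv c ` K"
  have K': "compact ?K" "?K \<subseteq> cdom c"
    using K S cinv_in_cdom[OF c] by (auto intro!: compact_cinv_image c)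
  then have cl: "closed ?K" by (simp add: compact_imp_closed)
  have zero: "f x = 0" if "x \<notin> ?K" for x
    proof (cases "x \<in> cdom c \<and> cmap c x \<in> S")
    case True
    then have "cmap c x \<notin> K"
      using that cinv_cmap[OF c] by (metis imageI)
    then show ?thesis using True K(3) by (simp add: f_def)
  qed (auto simp: f_def)
  then show "supp f \<subseteq> ?K"
    unfolding supp_def by (intro closure_minimal cl) auto
  show "smooth_fun A f"
  proof (rule smooth_fun_local)
    fix x
    show "\<exists>c\<in>A. \<exists>U. open U \<and> x \<in> U \<and> U \<subseteq> cdom c \<and> smooth_on (cmap c ` U) (f \<circ> cinv c)"
    proof (cases "x \<in> ?K")
      case True
      let ?U = "cdom c \<inter> cmap c -` S"
      have op: "open ?U" "open (cmap c ` ?U)"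
        using c S by (auto intro!: open_cmap_image open_cdom_preimage)
      have "cmap c ` ?U = S"
        using S(2) cinv_in_cdom[OF c] cmap_cinv[OF c]
        by (subst cmap_image_eq[OF c]) (auto simp: subset_iff cmap_in_cimg)
      moreover have "h y = (f \<circ> cinv c) y" if "y \<in> S" for y
        using that S cmap_cinv[OF c] cinv_in_cdom[OF c] by (auto simp: f_def)
      ultimately have "smooth_on (cmap c ` ?U) (f \<circ> cinv c)"
        using smooth_on_eqI[OF S(1) h] by simp
      moreover have "x \<in> ?U"
      proof -
        obtain y where "y \<in> K" "x = cinv c y" using True by blast
        moreover from this have "y \<in> S" "y \<in> cimg c" using K(2) S(2) by auto
        ultimately show ?thesis using cmap_cinv[OF c, of y] cinv_in_cdom[OF c, of y] by simp
      qed
      ultimately show ?thesis using op c by blast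
    next
      case False
      define d where "d = chart_at A x"
      have d: "d \<in> A" "x \<in> cdom d" using chart_at by (auto simp: d_def)
      let ?U = "cdom d - ?K"
      have op: "open ?U" "open (cmap d ` ?U)"
        using d cl by (auto intro!: open_cmap_image open_Diff open_cdom)
      have "0 = (f \<circ> cinv d) y" if "y \<in> cmap d ` ?U" for y
        using that cinv_cmap[OF d(1)] zero by auto
      then have "smooth_on (cmap d ` ?U) (f \<circ> cinv d)"
        by (rule smooth_on_eqI[OF op(2) smooth_on_const])
      then show ?thesis using op d False by blast
    qed
  qed
qed

lemma smooth_bump:
  assumes c: "c \<in> A" and U: "open U" "x \<in> U" "U \<subseteq> cdom c"
  obtains \<rho> V where "smooth_fun A \<rho>" "\<And>x. 0 \<le> \<rho> x" "\<And>x. \<rho> x \<le> 1" "open V" "x \<in> V" "\<And>x. x \<in> V \<Longrightarrow> \<rho> x = 1"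
    "supp \<rho> \<subseteq> U" "compact (supp \<rho>)"
proof -
  let ?S = "cmap c ` U"
  have S: "open ?S" "cmap c x \<in> ?S" "?S \<subseteq> cimg c"
    using c U cmap_in_cimg[of _ c] by (auto intro!: open_cmap_image)
  obtain \<psi> :: "(real, 'n) vec \<Rightarrow> real" and V K where \<psi>: "smooth_on UNIV \<psi>" "\<And>y. 0 \<le> \<psi> y" "\<And>y. \<psi> y \<le> 1"
    "open V" "cmap c x \<in> V" "\<And>y. y \<in> V \<Longrightarrow> \<psi> y = 1"
    "compact K" "K \<subseteq> ?S" "\<And>y. y \<notin> K \<Longrightarrow> \<psi> y = 0"
    by (rule bump_exists[OF S(1,2)]) (rule that)
  define \<rho> where "\<rho> x = (if x \<in> cdom c \<and> cmap c x \<in> ?S then \<psi> (cmap c x) else 0)" for x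
  have 1: "smooth_fun A \<rho>" "supp \<rho> \<subseteq> cinv c ` K"
    unfolding \<rho>_def
    by (rule extend_from_chart[OF c S(1,3) smooth_on_subset[OF \<psi>(1) subset_UNIV] \<psi>(7,8,9)]; simp)+
  have K': "compact (cinv c ` K)"
    using \<psi> S by (intro compact_cinv_image c) auto
  then have co: "compact (supp \<rho>)"
    using 1(2) compact_Int_closed[of "cinv c ` K" "supp \<rho>"] by (simp add: supp_def Int_absorb1)
  have su: "supp \<rho> \<subseteq> U"
  proof
    fix z assume "z \<in> supp \<rho>"
    then obtain y where "y \<in> K" "z = cinv c y" using 1(2) by auto
    moreover from this obtain w where "w \<in> U" "y = cmap c w" using \<psi>(8) by auto
    ultimately show "z \<in> U" using cinv_cmap[OF c] U(3) by auto
  qed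
  have op: "open (cdom c \<inter> cmap c -` (V \<inter> ?S))"
    by (intro open_cdom_preimage c open_Int \<psi> S)
  have "0 \<le> \<rho> z" "\<rho> z \<le> 1" for z
    using \<psi>(2,3) by (simp_all add: \<rho>_def)
  moreover have "x \<in> cdom c \<inter> cmap c -` (V \<inter> ?S)"
    using U S(2) \<psi>(5) by auto
  moreover have "\<rho> z = 1" if "z \<in> cdom c \<inter> cmap c -` (V \<inter> ?S)" for z
    using that \<psi>(6) by (simp add: \<rho>_def)
  ultimately show thesis
    by (rule that[OF 1(1) _ _ op _ _ su co])
qed

text \<open>The condition inside the description in \<open>form_integral\<close>, with an arbitrary
  set \<open>K\<close> in place of the support, so that one partition can serve several
  forms.\<close>

definition partition_on_compact where
  "partition_on_compact K N (c :: nat \<Rightarrow> ('a, 'n) chart) \<rho> \<longleftrightarrow>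
     (\<forall>i<N. c i \<in> A \<and> smooth_fun A (\<rho> i) \<and> (\<forall>x. 0 \<le> \<rho> i x \<and> \<rho> i x \<le> 1) \<and>
            supp (\<rho> i) \<subseteq> cdom (c i)) \<and>
     (\<forall>x\<in>K. (\<Sum>i<N. \<rho> i x) = 1)"

lemma partition_exists:
  assumes "compact K"
  obtains N c \<rho> where "partition_on_compact K N c \<rho>"
proof -
  define good where "good V c \<psi> \<longleftrightarrow> open V \<and> c \<in> A \<and> smooth_fun A \<psi> \<and> (\<forall>x. 0 \<le> \<psi> x \<and> \<psi> x \<le> 1) \<and>
    supp \<psi> \<subseteq> cdom c \<and> (\<forall>x\<in>V. \<psi> x = 1)" for V and c :: "('a, 'n) chart" and \<psi>
  have ex: "\<exists>V c \<psi>. good V c \<psi> \<and> x \<in> V" for x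
  proof -
    obtain \<psi> V where "smooth_fun A \<psi>" "\<And>x. 0 \<le> \<psi> x" "\<And>x. \<psi> x \<le> 1" "open V" "x \<in> V" "\<And>x. x \<in> V \<Longrightarrow> \<psi> x = 1"
      "supp \<psi> \<subseteq> cdom (chart_at A x)"
      by (rule smooth_bump[OF chart_at(1) open_cdom[OF chart_at(1)] chart_at(2) subset_refl]) (rule that)
    then show ?thesis
      using chart_at(1) by (intro exI[of _ V] exI[of _ "chart_at A x"] exI[of _ \<psi>]) (auto simp: good_def)
  qed
  then obtain V c \<psi> where g: "\<And>x. good (V x) (c x) (\<psi> x)" "\<And>x. x \<in> V x" by metis
  obtain F where F: "finite F" "K \<subseteq> (\<Union>x\<in>F. V x)"
  proof (rule compactE_image[OF assms, of K V])
    show "open (V x)" for x using g by (auto simp: good_def)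
    show "K \<subseteq> (\<Union>x\<in>K. V x)" using g by auto
  qed auto
  obtain xs where xs: "set xs = F" using F finite_list by auto
  define N where "N = length xs"
  \<comment> \<open>Each bump is cut off by its predecessors. At a point of \<open>K\<close> some
    bump equals 1, which makes the product in \<open>sum_telescoping_prod\<close> zero.\<close>
  define \<rho> where "\<rho> i x = \<psi> (xs ! i) x * (\<Prod>j<i. 1 - \<psi> (xs ! j) x)" for i x
  have b: "0 \<le> \<psi> z x" "\<psi> z x \<le> 1" for z x using g by (auto simp: good_def)
  have p: "0 \<le> (\<Prod>j<i. 1 - \<psi> (xs ! j) x)" "(\<Prod>j<i. 1 - \<psi> (xs ! j) x) \<le> 1" for i x
    using b by (auto intro!: prod_nonneg prod_le_1)
  have "partition_on_compact K N (\<lambda>i. c (xs ! i)) \<rho>"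
    unfolding partition_on_compact_def
  proof (intro conjI allI impI ballI)
    fix i x
    show "c (xs ! i) \<in> A" using g by (auto simp: good_def)
    show "0 \<le> \<rho> i x" using b p by (simp add: \<rho>_def)
    show "\<rho> i x \<le> 1" using b p by (simp add: \<rho>_def mult_le_one)
    have "smooth_fun A (\<lambda>x. \<psi> (xs ! i) x * (\<Prod>j<i. 1 - \<psi> (xs ! j) x))"
      using g by (intro smooth_fun_mult smooth_fun_prod smooth_fun_diff smooth_fun_const) (auto simp: good_def)
    then show "smooth_fun A (\<rho> i)" by (simp add: \<rho>_def[abs_def])
    have "supp (\<rho> i) \<subseteq> supp (\<psi> (xs ! i))"
      unfolding supp_def by (rule closure_mono) (auto simp: \<rho>_def)
    then show "supp (\<rho> i) \<subseteq> cdom (c (xs ! i))"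
      using g by (force simp: good_def)
  next
    fix x assume "x \<in> K"
    then obtain z where "z \<in> F" "x \<in> V z" using F by auto
    then obtain j where "j < N" "\<psi> (xs ! j) x = 1"
      using xs g by (auto simp: good_def N_def in_set_conv_nth)
    then have "(\<Prod>j<N. 1 - \<psi> (xs ! j) x) = 0"
      by (intro prod_zero) auto
    then show "(\<Sum>i<N. \<rho> i x) = 1"
      by (simp add: \<rho>_def sum_telescoping_prod)
  qed
  then show thesis by (rule that)
qed

end

section \<open>Forms and their integrals\<close>

lemma compact_support_eq:
  fixes g :: "'e::euclidean_space \<Rightarrow> 'b::euclidean_space"
  assumes "T \<subseteq> S" "\<And>y. y \<in> S \<Longrightarrow> y \<notin> T \<Longrightarrow> g y = 0"
  shows "integral S g = integral T g"
    and "g absolutely_integrable_on S \<longleftrightarrow> g absolutely_integrable_on T"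
proof -
  have "(\<lambda>y. if y \<in> S then g y else 0) = (\<lambda>y. if y \<in> T then g y else 0)"
    using assms by (auto simp: fun_eq_iff)
  then show "integral S g = integral T g"
      "g absolutely_integrable_on S \<longleftrightarrow> g absolutely_integrable_on T"
    using integral_restrict_UNIV[of S g] integral_restrict_UNIV[of T g]
      absolutely_integrable_restrict_UNIV[of S g] absolutely_integrable_restrict_UNIV[of T g] by auto
qed

lemma absolutely_integrable_compact_support:
  fixes g :: "'e::euclidean_space \<Rightarrow> real"
  assumes "continuous_on S g" "compact K" "K \<subseteq> S" "\<And>y. y \<in> S \<Longrightarrow> y \<notin> K \<Longrightarrow> g y = 0"
  shows "g absolutely_integrable_on S"
proof -
  have "integrable lborel (\<lambda>x. indicator K x *\<^sub>R g x)"
    by (rule borel_integrable_compact[OF assms(2) continuous_on_subset[OF assms(1,3)]])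
  then have "g absolutely_integrable_on K"
    unfolding set_integrable_def by (subst integrable_completion) auto
  then show ?thesis
    using compact_support_eq(2)[OF assms(3,4)] by simp
qed

text \<open>The scalar case of the vector-valued change of variables, read off in
  \<open>real ^ 1\<close>.\<close>

lemma change_of_variables_real:
  fixes f :: "real^'m::{finite,wellorder} \<Rightarrow> real" and g :: "real^'m::_ \<Rightarrow> real^'m::_"
  assumes S: "S \<in> sets lebesgue"
    and der: "\<And>x. x \<in> S \<Longrightarrow> (g has_derivative g' x) (at x within S)"
    and inj: "inj_on g S" and f: "f absolutely_integrable_on g ` S"
  shows "integral S (\<lambda>x. \<bar>det (matrix (g' x))\<bar> * f (g x)) = integral (g ` S) f"
proof -
  let ?f = "\<lambda>x. vec (f x) :: real^1"
  have "(\<lambda>x. \<bar>det (matrix (g' x))\<bar> *\<^sub>R ?f (g x)) absolutely_integrable_on S \<and>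
           integral S (\<lambda>x. \<bar>det (matrix (g' x))\<bar> *\<^sub>R ?f (g x)) = vec (integral (g ` S) f)"
    by (subst has_absolute_integral_change_of_variables[OF S der inj])
      (use f in \<open>auto simp: absolutely_integrable_on_1_iff integral_on_1_eq vec_eq_iff\<close>)
  then show ?thesis
    by (simp add: integral_on_1_eq vec_eq_iff)
qed

lemma in_supp: "f x \<noteq> 0 \<Longrightarrow> x \<in> supp f"
  unfolding supp_def using closure_subset by fastforce

lemma closed_supp: "closed (supp f)"
  by (simp add: supp_def)

lemma supp_minimal: "closed S \<Longrightarrow> (\<And>x. f x \<noteq> 0 \<Longrightarrow> x \<in> S) \<Longrightarrow> supp f \<subseteq> S"
  unfolding supp_def by (intro closure_minimal) auto

context oriented_atlas
begin

lemma formsD: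
  assumes "\<mu> \<in> forms A"
  shows "\<not> (c \<in> A \<and> x \<in> cdom c) \<Longrightarrow> \<mu> x c = 0"
    "c \<in> A \<Longrightarrow> d \<in> A \<Longrightarrow> x \<in> cdom c \<Longrightarrow> x \<in> cdom d \<Longrightarrow> \<mu> x c = det (jacobian c d x) * \<mu> x d"
    "c \<in> A \<Longrightarrow> smooth_on (cimg c) (\<lambda>y. \<mu> (cinv c y) c)"
  using assms unfolding forms_def by blast+

lemma formsI:
  assumes "\<And>x c. \<not> (c \<in> A \<and> x \<in> cdom c) \<Longrightarrow> \<mu> x c = 0"
    "\<And>c d x. c \<in> A \<Longrightarrow> d \<in> A \<Longrightarrow> x \<in> cdom c \<Longrightarrow> x \<in> cdom d \<Longrightarrow> \<mu> x c = det (jacobian c d x) * \<mu> x d"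
    "\<And>c. c \<in> A \<Longrightarrow> smooth_on (cimg c) (\<lambda>y. \<mu> (cinv c y) c)"
  shows "\<mu> \<in> forms A"
  using assms unfolding forms_def by blast

lemma forms_add: "\<mu> \<in> forms A \<Longrightarrow> \<nu> \<in> forms A \<Longrightarrow> \<mu> + \<nu> \<in> forms A"
  by (rule formsI) (simp_all add: formsD(1,3) smooth_on_add open_cimg distrib_left
    formsD(2)[of \<mu>, symmetric] formsD(2)[of \<nu>, symmetric])

lemma smooth_fun_comp_cinv: "smooth_fun A f \<Longrightarrow> c \<in> A \<Longrightarrow> smooth_on (cimg c) (\<lambda>y. f (cinv c y))"
  using smooth_funD by (simp add: o_def)

lemma forms_mult:
  assumes f: "smooth_fun A f" and \<mu>: "\<mu> \<in> forms A"
  shows "mult_form f \<mu> \<in> forms A"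
proof (rule formsI)
  fix c d x assume "c \<in> A" "d \<in> A" "x \<in> cdom c" "x \<in> cdom d"
  from formsD(2)[OF \<mu> this] show "mult_form f \<mu> x c = det (jacobian c d x) * mult_form f \<mu> x d"
    by (simp add: mult_form_def)
qed (simp_all add: mult_form_def formsD(1,3)[OF \<mu>] smooth_on_mult open_cimg smooth_fun_comp_cinv[OF f])

lemma scaleR_form: "r *\<^sub>R \<mu> = mult_form (\<lambda>_. r) \<mu>"
  by (simp add: mult_form_def scaleR_fun_def)

lemma forms_zero: "0 \<in> forms A"
  by (rule formsI) (simp_all add: smooth_on_const)

lemma supp_add: "supp (\<mu> + \<nu>) \<subseteq> supp \<mu> \<union> supp \<nu>" for \<mu> \<nu> :: "('a, 'n) form"
proof (rule supp_minimal)
  fix x assume "(\<mu> + \<nu>) x \<noteq> 0"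
  then have "\<mu> x \<noteq> 0 \<or> \<nu> x \<noteq> 0" by auto
  then show "x \<in> supp \<mu> \<union> supp \<nu>" using in_supp by blast
qed (simp add: closed_supp closed_Un)

lemma mult_form_eq_0: "f x = 0 \<Longrightarrow> mult_form f \<mu> x = 0" "\<mu> x = 0 \<Longrightarrow> mult_form f \<mu> x = 0"
  by (auto simp: mult_form_def fun_eq_iff)

lemma supp_mult_form: "supp (mult_form f \<mu>) \<subseteq> supp f" "supp (mult_form f \<mu>) \<subseteq> supp \<mu>"
  for \<mu> :: "('a, 'n) form"
  using mult_form_eq_0 by (metis closed_supp in_supp supp_minimal)+

lemma compact_supp_subset: "compact K \<Longrightarrow> supp \<mu> \<subseteq> K \<Longrightarrow> compact (supp \<mu>)"
  using compact_Int_closed[OF _ closed_supp, of K \<mu>] by (simp add: Int_absorb1)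

lemma cformsD: "\<mu> \<in> cforms A \<Longrightarrow> \<mu> \<in> forms A" "\<mu> \<in> cforms A \<Longrightarrow> compact (supp \<mu>)"
  by (auto simp: cforms_def)

lemma cforms_mult: "smooth_fun A f \<Longrightarrow> \<mu> \<in> cforms A \<Longrightarrow> mult_form f \<mu> \<in> cforms A"
  using compact_supp_subset[OF _ supp_mult_form(2)] by (simp add: cforms_def forms_mult)

lemma cforms_add: "\<mu> \<in> cforms A \<Longrightarrow> \<nu> \<in> cforms A \<Longrightarrow> \<mu> + \<nu> \<in> cforms A"
  using compact_supp_subset[OF _ supp_add[of \<mu> \<nu>]] by (simp add: cforms_def forms_add compact_Un)

lemma cforms_scaleR: "\<mu> \<in> cforms A \<Longrightarrow> r *\<^sub>R \<mu> \<in> cforms A"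
  unfolding scaleR_form by (intro cforms_mult smooth_fun_const)

lemma cforms_zero: "0 \<in> cforms A"
  by (simp add: cforms_def forms_zero supp_def)

section \<open>Integration of forms supported in one chart\<close>

definition chart_integral :: "('a, 'n) chart \<Rightarrow> ('a, 'n) form \<Rightarrow> real" where
  "chart_integral c \<mu> = integral (cimg c) (\<lambda>y. \<mu> (cinv c y) c)"

lemma chart_support:
  assumes "\<mu> \<in> cforms A" "c \<in> A" "supp \<mu> \<subseteq> cdom c"
  shows "compact (cmap c ` supp \<mu>)" "cmap c ` supp \<mu> \<subseteq> cimg c"
    "y \<in> cimg c \<Longrightarrow> y \<notin> cmap c ` supp \<mu> \<Longrightarrow> \<mu> (cinv c y) c = 0"
proof -
  show "compact (cmap c ` supp \<mu>)" "cmap c ` supp \<mu> \<subseteq> cimg c"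
    using compact_cmap_image cformsD(2) assms cmap_in_cimg[of _ c] by auto
  assume y: "y \<in> cimg c" "y \<notin> cmap c ` supp \<mu>"
  then have "cinv c y \<notin> supp \<mu>"
    using cmap_cinv[OF assms(2)] by (metis imageI)
  then have "\<mu> (cinv c y) = 0" using in_supp by blast
  then show "\<mu> (cinv c y) c = 0" by simp
qed

lemma chart_absolutely_integrable:
  assumes "\<mu> \<in> cforms A" "c \<in> A" "supp \<mu> \<subseteq> cdom c"
  shows "(\<lambda>y. \<mu> (cinv c y) c) absolutely_integrable_on cimg c"
  by (rule absolutely_integrable_compact_support[OF _ chart_support(1,2)[OF assms]])
    (use assms chart_support(3)[OF assms] in
      \<open>auto intro: smooth_on_imp_continuous_on formsD(3) cformsD(1)\<close>)

lemma chart_integrable: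
  assumes "\<mu> \<in> cforms A" "c \<in> A" "supp \<mu> \<subseteq> cdom c"
  shows "(\<lambda>y. \<mu> (cinv c y) c) integrable_on cimg c"
  using chart_absolutely_integrable[OF assms] set_lebesgue_integral_eq_integral(1) by blast

text \<open>Formulated for a scalar function \<open>q\<close> and not for a form:
  \<open>lie_form_transform\<close> applies it to coefficients of \<open>lie_form A X \<mu>\<close>
  in the chart \<open>d\<close> alone, before these are known to transform like a form. Since
  \<open>q\<close> vanishes off \<open>K\<close>, both integrals live on the overlap of the
  charts.\<close>

lemma integral_change_chart:
  assumes c: "c \<in> A" and d: "d \<in> A" and K: "compact K" "K \<subseteq> cdom c" "K \<subseteq> cdom d"
    and q: "\<And>x. x \<in> cdom c \<union> cdom d \<Longrightarrow> x \<notin> K \<Longrightarrow> q x = 0" "continuous_on (cimg d) (\<lambda>y. q (cinv d y))"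
  shows "integral (cimg d) (\<lambda>y. q (cinv d y)) =
    integral (cimg c) (\<lambda>y. det (jacobian c d (cinv c y)) * q (cinv c y))"
proof -
  define S where "S = cmap c ` (cdom c \<inter> cdom d)"
  define g where "g = cmap d \<circ> cinv c"
  have S: "open S" unfolding S_def
    by (intro open_cmap_image c open_Int open_cdom d) auto
  have gS: "g ` S = cmap d ` (cdom c \<inter> cdom d)"
    using cinv_cmap[OF c] by (auto simp: g_def S_def image_image)
  have "inj_on g S"
  proof (rule inj_onI)
    fix y z assume "y \<in> S" "z \<in> S" and eq: "g y = g z"
    then obtain w x where w: "w \<in> cdom c" "w \<in> cdom d" "y = cmap c w"
      and x: "x \<in> cdom c" "x \<in> cdom d" "z = cmap c x"
      by (auto simp: S_def)
    have "g y = cmap d w" "g z = cmap d x"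
      using cinv_cmap[OF c w(1)] cinv_cmap[OF c x(1)] by (simp_all add: g_def w(3) x(3))
    then have "cinv d (cmap d w) = cinv d (cmap d x)" using eq by simp
    then have "w = x" unfolding cinv_cmap[OF d w(2)] cinv_cmap[OF d x(2)] .
    then show "y = z" by (simp add: w(3) x(3))
  qed
  have zero: "q (cinv e y) = 0" if "e \<in> A" "e = c \<or> e = d" "y \<in> cimg e" "y \<notin> cmap e ` (cdom c \<inter> cdom d)" for e y
  proof (rule q(1))
    show "cinv e y \<in> cdom c \<union> cdom d" using that cinv_in_cdom[of e y] by auto
    show "cinv e y \<notin> K"
      using that(4) cmap_cinv[OF that(1,3)] K(2,3) by (metis IntI imageI subset_iff)
  qed
  have sub: "S \<subseteq> cimg c" "g ` S \<subseteq> cimg d"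
    unfolding gS by (auto simp: S_def intro: cmap_in_cimg)
  have qK: "q (cinv d y) = 0" if "y \<in> cimg d" "y \<notin> cmap d ` K" for y
    using that q(1)[of "cinv d y"] cinv_in_cdom[OF d] cmap_cinv[OF d] by (metis UnI2 imageI)
  have "(\<lambda>y. q (cinv d y)) absolutely_integrable_on cimg d"
    by (rule absolutely_integrable_compact_support[OF q(2) compact_cmap_image[OF d K(1,3)] _ qK])
      (use K cmap_in_cimg[of _ d] in auto)
  then have int: "(\<lambda>y. q (cinv d y)) absolutely_integrable_on g ` S"
    using compact_support_eq(2)[OF sub(2), of "\<lambda>y. q (cinv d y)"] zero[OF d] gS by auto
  have "integral (cimg d) (\<lambda>y. q (cinv d y)) = integral (g ` S) (\<lambda>y. q (cinv d y))"
    by (rule compact_support_eq(1)[OF sub(2)]) (use zero[OF d] gS in auto)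
  also have "\<dots> = integral S (\<lambda>y. \<bar>det (matrix ((*v) (jacobian c d (cinv c y))))\<bar> * q (cinv d (g y)))"
  proof (rule change_of_variables_real[symmetric, OF _ _ \<open>inj_on g S\<close> int])
    show "S \<in> sets lebesgue" using S by (simp add: borel_open)
    fix y assume "y \<in> S"
    then obtain x where x: "x \<in> cdom c" "x \<in> cdom d" "y = cmap c x" by (auto simp: S_def)
    show "(g has_derivative (*v) (jacobian c d (cinv c y))) (at y within S)"
      using has_derivative_transition[OF c d x(1,2)] cinv_cmap[OF c x(1)] x(3)
      by (simp add: g_def has_derivative_at_withinI)
  qed
  also have "\<dots> = integral S (\<lambda>y. det (jacobian c d (cinv c y)) * q (cinv c y))"
  proof (rule integral_cong)
    fix y assume "y \<in> S"
    then obtain x where x: "x \<in> cdom c" "x \<in> cdom d" "y = cmap c x" by (auto simp: S_def)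
    show "\<bar>det (matrix ((*v) (jacobian c d (cinv c y))))\<bar> * q (cinv d (g y)) =
      det (jacobian c d (cinv c y)) * q (cinv c y)"
      using x det_jacobian_pos[OF c d x(1,2)] cinv_cmap[OF c x(1)] cinv_cmap[OF d x(2)]
      by (simp add: g_def matrix_of_matrix_vector_mul)
  qed
  also have "\<dots> = integral (cimg c) (\<lambda>y. det (jacobian c d (cinv c y)) * q (cinv c y))"
    by (rule compact_support_eq(1)[symmetric, OF sub(1)]) (use zero[OF c] S_def in auto)
  finally show ?thesis .
qed

text \<open>The determinant produced by the substitution is absorbed by the transformation law of
  \<open>\<mu>\<close>; points of the chart \<open>c\<close> outside \<open>cdom d\<close>
  contribute zero.\<close>

lemma chart_integral_change:
  assumes \<mu>: "\<mu> \<in> cforms A" and c: "c \<in> A" "supp \<mu> \<subseteq> cdom c" and d: "d \<in> A" "supp \<mu> \<subseteq> cdom d"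
  shows "chart_integral c \<mu> = chart_integral d \<mu>"
proof -
  have zero: "\<mu> x e = 0" if "x \<notin> supp \<mu>" for x e
    using that in_supp[of \<mu> x] by (metis zero_fun_apply)
  have "chart_integral d \<mu> = integral (cimg c) (\<lambda>y. det (jacobian c d (cinv c y)) * \<mu> (cinv c y) d)"
    unfolding chart_integral_def
    by (rule integral_change_chart[OF c(1) d(1) cformsD(2)[OF \<mu>] c(2) d(2)])
      (auto intro: zero smooth_on_imp_continuous_on formsD(3)[OF cformsD(1)[OF \<mu>] d(1)])
  also have "\<dots> = chart_integral c \<mu>"
    unfolding chart_integral_def
  proof (rule integral_cong)
    fix y assume y: "y \<in> cimg c"
    show "det (jacobian c d (cinv c y)) * \<mu> (cinv c y) d = \<mu> (cinv c y) c"
    proof (cases "cinv c y \<in> cdom d")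
      case True
      then show ?thesis
        using formsD(2)[OF cformsD(1)[OF \<mu>] c(1) d(1) cinv_in_cdom[OF c(1) y]] by simp
    next
      case False
      then show ?thesis using zero d(2) by (metis mult_zero_right subset_iff)
    qed
  qed
  finally show ?thesis ..
qed

lemma chart_integral_add:
  assumes "\<mu> \<in> cforms A" "\<nu> \<in> cforms A" "c \<in> A" "supp \<mu> \<subseteq> cdom c" "supp \<nu> \<subseteq> cdom c"
  shows "chart_integral c (\<mu> + \<nu>) = chart_integral c \<mu> + chart_integral c \<nu>"
  using integral_add[OF chart_integrable chart_integrable] assms by (simp add: chart_integral_def)

section \<open>The integral of a compactly supported form by partitions of unity\<close>

lemma partitionD:
  assumes "partition_on_compact K N c \<rho>" "i < N"
  shows "c i \<in> A" "smooth_fun A (\<rho> i)" "0 \<le> \<rho> i x" "\<rho> i x \<le> 1" "supp (\<rho> i) \<subseteq> cdom (c i)"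
  using assms unfolding partition_on_compact_def by blast+

lemma partition_sum: "partition_on_compact K N c \<rho> \<Longrightarrow> x \<in> K \<Longrightarrow> (\<Sum>i<N. \<rho> i x) = 1"
  unfolding partition_on_compact_def by blast

lemma partition_mult_form:
  assumes "partition_on_compact K N c \<rho>" "i < N" "\<mu> \<in> cforms A"
  shows "mult_form (\<rho> i) \<mu> \<in> cforms A" "supp (mult_form (\<rho> i) \<mu>) \<subseteq> cdom (c i)"
  using partitionD[OF assms(1,2)] assms(3) supp_mult_form(1)[of "\<rho> i" \<mu>] by (auto intro: cforms_mult)

lemma chart_integral_partition:
  assumes \<mu>: "\<mu> \<in> cforms A" and c: "c \<in> A" "supp \<mu> \<subseteq> cdom c"
    and p: "partition_on_compact K N d \<sigma>" "supp \<mu> \<subseteq> K"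
  shows "chart_integral c \<mu> = (\<Sum>j<N. chart_integral c (mult_form (\<sigma> j) \<mu>))"
proof -
  have eq: "\<mu> x e = (\<Sum>j<N. mult_form (\<sigma> j) \<mu> x e)" for x e
  proof (cases "x \<in> supp \<mu>")
    case True
    then have "(\<Sum>j<N. \<sigma> j x) = 1" using partition_sum p by blast
    then show ?thesis by (simp add: mult_form_def sum_distrib_right[symmetric])
  next
    case False
    then have "\<mu> x = 0" using in_supp by blast
    then show ?thesis by (simp add: mult_form_def)
  qed
  have "(\<lambda>y. mult_form (\<sigma> j) \<mu> (cinv c y) c) integrable_on cimg c" if "j < N" for j
    by (rule chart_integrable[OF partition_mult_form(1)[OF p(1) that \<mu>] c(1)])
      (use supp_mult_form(2)[of "\<sigma> j" \<mu>] c in blast)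
  then have "integral (cimg c) (\<lambda>y. \<Sum>j<N. mult_form (\<sigma> j) \<mu> (cinv c y) c) =
      (\<Sum>j<N. chart_integral c (mult_form (\<sigma> j) \<mu>))"
    unfolding chart_integral_def by (intro integral_sum) auto
  moreover have "(\<lambda>y. \<mu> (cinv c y) c) = (\<lambda>y. \<Sum>j<N. mult_form (\<sigma> j) \<mu> (cinv c y) c)"
    using eq by (rule ext)
  ultimately show ?thesis by (simp add: chart_integral_def)
qed

text \<open>Each partition is refined by the other. The form \<open>\<mu>\<close> multiplied by
  \<open>\<rho> i\<close> and \<open>\<sigma> j\<close> is supported in both charts
  \<open>c i\<close> and \<open>d j\<close>, where \<open>chart_integral_change\<close> identifies
  the two integrals; exchanging the order of summation then compares the totals.\<close>

lemma partition_independent: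
  assumes \<mu>: "\<mu> \<in> cforms A" and p: "partition_on_compact K N c \<rho>" "supp \<mu> \<subseteq> K"
    and q: "partition_on_compact L M d \<sigma>" "supp \<mu> \<subseteq> L"
  shows "(\<Sum>i<N. chart_integral (c i) (mult_form (\<rho> i) \<mu>)) = (\<Sum>j<M. chart_integral (d j) (mult_form (\<sigma> j) \<mu>))"
proof -
  have comm: "mult_form f (mult_form g \<mu>) = mult_form g (mult_form f \<mu>)" for f g
    by (simp add: mult_form_def mult.left_commute)
  have sub: "supp (mult_form f \<mu>) \<subseteq> S" if "supp \<mu> \<subseteq> S" for f S
    using supp_mult_form(2)[of f \<mu>] that by blast
  have 1: "chart_integral (c i) (mult_form (\<rho> i) \<mu>) =
      (\<Sum>j<M. chart_integral (c i) (mult_form (\<sigma> j) (mult_form (\<rho> i) \<mu>)))" if i: "i < N" for i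
    by (rule chart_integral_partition[OF partition_mult_form(1)[OF p(1) i \<mu>] partitionD(1)[OF p(1) i]
       partition_mult_form(2)[OF p(1) i \<mu>] q(1) sub[OF q(2)]])
  have 2: "chart_integral (d j) (mult_form (\<sigma> j) \<mu>) =
      (\<Sum>i<N. chart_integral (d j) (mult_form (\<rho> i) (mult_form (\<sigma> j) \<mu>)))" if j: "j < M" for j
    by (rule chart_integral_partition[OF partition_mult_form(1)[OF q(1) j \<mu>] partitionD(1)[OF q(1) j]
       partition_mult_form(2)[OF q(1) j \<mu>] p(1) sub[OF p(2)]])
  have 3: "chart_integral (c i) (mult_form (\<sigma> j) (mult_form (\<rho> i) \<mu>)) =
      chart_integral (d j) (mult_form (\<rho> i) (mult_form (\<sigma> j) \<mu>))" if "i < N" "j < M" for i j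
    unfolding comm[of "\<rho> i"]
  proof (rule chart_integral_change)
    show "mult_form (\<sigma> j) (mult_form (\<rho> i) \<mu>) \<in> cforms A"
      by (intro partition_mult_form(1)[OF q(1) that(2)] partition_mult_form(1)[OF p(1) that(1)] \<mu>)
    show "c i \<in> A" "d j \<in> A"
      using partitionD(1)[OF p(1) that(1)] partitionD(1)[OF q(1) that(2)] .
    show "supp (mult_form (\<sigma> j) (mult_form (\<rho> i) \<mu>)) \<subseteq> cdom (c i)"
      using supp_mult_form(2)[of "\<sigma> j" "mult_form (\<rho> i) \<mu>"] partition_mult_form(2)[OF p(1) that(1) \<mu>] by blast
    show "supp (mult_form (\<sigma> j) (mult_form (\<rho> i) \<mu>)) \<subseteq> cdom (d j)"
      using supp_mult_form(1)[of "\<sigma> j" "mult_form (\<rho> i) \<mu>"] partitionD(5)[OF q(1) that(2)] by blast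
  qed
  have "(\<Sum>i<N. chart_integral (c i) (mult_form (\<rho> i) \<mu>)) =
      (\<Sum>i<N. \<Sum>j<M. chart_integral (d j) (mult_form (\<rho> i) (mult_form (\<sigma> j) \<mu>)))"
    by (intro sum.cong refl) (simp add: 1 3)
  also have "\<dots> = (\<Sum>j<M. \<Sum>i<N. chart_integral (d j) (mult_form (\<rho> i) (mult_form (\<sigma> j) \<mu>)))"
    by (rule sum.swap)
  also have "\<dots> = (\<Sum>j<M. chart_integral (d j) (mult_form (\<sigma> j) \<mu>))"
    by (intro sum.cong refl) (simp add: 2)
  finally show ?thesis .
qed

lemma partition_mono: "partition_on_compact K N c \<rho> \<Longrightarrow> L \<subseteq> K \<Longrightarrow> partition_on_compact L N c \<rho>"
  unfolding partition_on_compact_def by blast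

text \<open>Resolves the \<open>THE\<close> in \<open>form_integral\<close>, with uniqueness from
  \<open>partition_independent\<close>. Allowing \<open>K\<close> to exceed the support makes it
  possible to evaluate several integrals with a common partition, as additivity requires.\<close>

lemma form_integral_eq:
  assumes \<mu>: "\<mu> \<in> cforms A" and p: "partition_on_compact K N c \<rho>" "supp \<mu> \<subseteq> K"
  shows "form_integral A \<mu> = (\<Sum>i<N. chart_integral (c i) (mult_form (\<rho> i) \<mu>))"
proof -
  have "form_integral A \<mu> = (THE I. \<exists>N c \<rho>. partition_on_compact (supp \<mu>) N c \<rho> \<and>
      I = (\<Sum>i<N. chart_integral (c i) (mult_form (\<rho> i) \<mu>)))"
    unfolding form_integral_def partition_on_compact_def chart_integral_def mult_form_def
    by (simp add: conj_assoc)
  also have "\<dots> = (\<Sum>i<N. chart_integral (c i) (mult_form (\<rho> i) \<mu>))"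
  proof (rule the_equality)
    show "\<exists>N' c' \<rho>'. partition_on_compact (supp \<mu>) N' c' \<rho>' \<and>
      (\<Sum>i<N. chart_integral (c i) (mult_form (\<rho> i) \<mu>)) = (\<Sum>i<N'. chart_integral (c' i) (mult_form (\<rho>' i) \<mu>))"
      using partition_mono[OF p] by blast
    fix I assume "\<exists>N c \<rho>. partition_on_compact (supp \<mu>) N c \<rho> \<and>
      I = (\<Sum>i<N. chart_integral (c i) (mult_form (\<rho> i) \<mu>))"
    then obtain M d \<sigma> where q: "partition_on_compact (supp \<mu>) M d \<sigma>"
      and I: "I = (\<Sum>i<M. chart_integral (d i) (mult_form (\<sigma> i) \<mu>))" by blast
    show "I = (\<Sum>i<N. chart_integral (c i) (mult_form (\<rho> i) \<mu>))"
      unfolding I by (rule partition_independent[OF \<mu> q subset_refl p])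
  qed
  finally show ?thesis .
qed

lemma mult_form_add: "mult_form f (\<mu> + \<nu>) = mult_form f \<mu> + mult_form f \<nu>"
  by (simp add: mult_form_def fun_eq_iff distrib_left)

lemma form_integral_add:
  assumes "\<mu> \<in> cforms A" "\<nu> \<in> cforms A"
  shows "form_integral A (\<mu> + \<nu>) = form_integral A \<mu> + form_integral A \<nu>"
proof -
  have "compact (supp \<mu> \<union> supp \<nu>)"
    using assms cformsD(2) by (intro compact_Un)
  then obtain N c \<rho> where p: "partition_on_compact (supp \<mu> \<union> supp \<nu>) N c \<rho>"
    by (rule partition_exists)
  have "chart_integral (c i) (mult_form (\<rho> i) (\<mu> + \<nu>)) =
      chart_integral (c i) (mult_form (\<rho> i) \<mu>) + chart_integral (c i) (mult_form (\<rho> i) \<nu>)" if "i < N" for i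
    unfolding mult_form_add
    by (intro chart_integral_add partition_mult_form[OF p that] partitionD(1)[OF p that] assms)
  then show ?thesis
    using form_integral_eq[OF assms(1) p] form_integral_eq[OF assms(2) p]
      form_integral_eq[OF cforms_add[OF assms] p supp_add]
    by (simp add: sum.distrib)
qed

lemma form_integral_chart:
  assumes "\<mu> \<in> cforms A" "c \<in> A" "supp \<mu> \<subseteq> cdom c"
  shows "form_integral A \<mu> = chart_integral c \<mu>"
proof -
  obtain N d \<rho> where p: "partition_on_compact (supp \<mu>) N d \<rho>"
    using partition_exists[OF cformsD(2)[OF assms(1)]] .
  have "chart_integral (d i) (mult_form (\<rho> i) \<mu>) = chart_integral c (mult_form (\<rho> i) \<mu>)" if "i < N" for i
    by (rule chart_integral_change[OF partition_mult_form(1)[OF p that assms(1)]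
       partitionD(1)[OF p that] partition_mult_form(2)[OF p that assms(1)] assms(2)])
      (use supp_mult_form(2)[of "\<rho> i" \<mu>] assms(3) in blast)
  then show ?thesis
    using form_integral_eq[OF assms(1) p subset_refl] chart_integral_partition[OF assms p subset_refl] by simp
qed

lemma form_integral_scale:
  assumes f: "smooth_fun A f" and \<mu>: "\<mu> \<in> cforms A"
  shows "form_integral A (mult_form (\<lambda>x. r * f x) \<mu>) = r * form_integral A (mult_form f \<mu>)"
proof -
  obtain N c \<rho> where p: "partition_on_compact (supp \<mu>) N c \<rho>"
    using partition_exists[OF cformsD(2)[OF \<mu>]] .
  have rf: "smooth_fun A (\<lambda>x. r * f x)"
    by (intro smooth_fun_mult smooth_fun_const f)
  have "chart_integral (c i) (mult_form (\<rho> i) (mult_form (\<lambda>x. r * f x) \<mu>)) =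
      r * chart_integral (c i) (mult_form (\<rho> i) (mult_form f \<mu>))" for i
    by (simp add: chart_integral_def mult_form_def mult.left_commute[of _ r] mult.assoc)
  then show ?thesis
    using form_integral_eq[OF cforms_mult[OF f \<mu>] p supp_mult_form(2)]
      form_integral_eq[OF cforms_mult[OF rf \<mu>] p supp_mult_form(2)]
    by (simp add: sum_distrib_left)
qed

text \<open>The constant is the sum of the L1 norms of the pieces
  \<open>mult_form (\<rho> i) \<mu>\<close> in their charts. It does not depend on \<open>f\<close>,
  which runs through a net in \<open>assoc_zero_small\<close>.\<close>

lemma form_integral_bound:
  assumes \<mu>: "\<mu> \<in> cforms A"
  obtains C where "\<And>f B. smooth_fun A f \<Longrightarrow> (\<And>x. x \<in> supp \<mu> \<Longrightarrow> \<bar>f x\<bar> \<le> B) \<Longrightarrow>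
    \<bar>form_integral A (mult_form f \<mu>)\<bar> \<le> C * B"
proof -
  obtain N c \<rho> where p: "partition_on_compact (supp \<mu>) N c \<rho>"
    using partition_exists[OF cformsD(2)[OF assms]] .
  define I where "I i = integral (cimg (c i)) (\<lambda>y. \<bar>mult_form (\<rho> i) \<mu> (cinv (c i) y) (c i)\<bar>)" for i
  have "\<bar>form_integral A (mult_form f \<mu>)\<bar> \<le> (\<Sum>i<N. I i) * B"
    if f: "smooth_fun A f" and B: "\<And>x. x \<in> supp \<mu> \<Longrightarrow> \<bar>f x\<bar> \<le> B" for f B
  proof -
    have "\<bar>chart_integral (c i) (mult_form (\<rho> i) (mult_form f \<mu>))\<bar> \<le> I i * B" if i: "i < N" for i
    proof -
      have sub: "supp (mult_form (\<rho> i) \<mu>) \<subseteq> cdom (c i)" "supp (mult_form (\<rho> i) (mult_form f \<mu>)) \<subseteq> cdom (c i)"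
        by (rule partition_mult_form(2)[OF p i] cforms_mult f \<mu>)+
      have fm: "mult_form (\<rho> i) (mult_form f \<mu>) \<in> cforms A"
        by (intro partition_mult_form(1)[OF p i] cforms_mult f \<mu>)
      have "(\<lambda>y. \<bar>mult_form (\<rho> i) \<mu> (cinv (c i) y) (c i)\<bar>) integrable_on cimg (c i)"
        using absolutely_integrable_norm[OF chart_absolutely_integrable[OF partition_mult_form(1)[OF p i \<mu>] partitionD(1)[OF p i] sub(1)]]
          set_lebesgue_integral_eq_integral(1) by (auto simp: o_def)
      then have "(\<lambda>y. \<bar>mult_form (\<rho> i) \<mu> (cinv (c i) y) (c i)\<bar> * B) integrable_on cimg (c i)"
        by (rule integrable_on_mult_left)
      then have "norm (chart_integral (c i) (mult_form (\<rho> i) (mult_form f \<mu>))) \<le>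
          integral (cimg (c i)) (\<lambda>y. \<bar>mult_form (\<rho> i) \<mu> (cinv (c i) y) (c i)\<bar> * B)"
        unfolding chart_integral_def
      proof (rule integral_norm_bound_integral[OF chart_integrable[OF fm partitionD(1)[OF p i] sub(2)]])
        fix y
        let ?x = "cinv (c i) y"
        show "norm (mult_form (\<rho> i) (mult_form f \<mu>) ?x (c i)) \<le> \<bar>mult_form (\<rho> i) \<mu> ?x (c i)\<bar> * B"
        proof (cases "?x \<in> supp \<mu>")
          case True
          then have "\<bar>\<rho> i ?x * \<mu> ?x (c i)\<bar> * \<bar>f ?x\<bar> \<le> \<bar>\<rho> i ?x * \<mu> ?x (c i)\<bar> * B"
            using B by (intro mult_left_mono) auto
          then show ?thesis by (simp add: mult_form_def abs_mult mult.assoc mult.commute[of "\<bar>f _\<bar>"])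
        next
          case False
          then have "\<mu> ?x = 0" using in_supp by blast
          then show ?thesis by (simp add: mult_form_def)
        qed
      qed
      then show ?thesis by (simp add: I_def)
    qed
    then have "\<bar>form_integral A (mult_form f \<mu>)\<bar> \<le> (\<Sum>i<N. I i * B)"
      unfolding form_integral_eq[OF cforms_mult[OF f \<mu>] p supp_mult_form(2)]
      by (intro order_trans[OF sum_abs] sum_mono) auto
    then show ?thesis by (simp add: sum_distrib_right)
  qed
  then show thesis by (rule that)
qed

end

section \<open>The Lie derivative of forms\<close>

lemma linear_axis_sum:
  fixes D :: "real^'n \<Rightarrow> 'b::real_vector"
  assumes "linear D"
  shows "D v = (\<Sum>i\<in>UNIV. v $ i *\<^sub>R D (axis i 1))"
proof -
  have "D v = D (\<Sum>i\<in>UNIV. v $ i *\<^sub>R axis i 1)"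
    using basis_expansion[of v] by (simp add: scalar_mult_eq_scaleR)
  also have "\<dots> = (\<Sum>i\<in>UNIV. v $ i *\<^sub>R D (axis i 1))"
    by (simp add: linear_sum[OF assms] linear_scale[OF assms])
  finally show ?thesis .
qed

lemma frechet_derivative_eq_0:
  assumes "open U" "x \<in> U" "\<And>y. y \<in> U \<Longrightarrow> f y = 0"
  shows "frechet_derivative f (at x) v = 0"
proof -
  have "((\<lambda>_. 0) has_derivative (\<lambda>_. 0)) (at x)" by simp
  then have "(f has_derivative (\<lambda>_. 0)) (at x)"
    by (rule has_derivative_transform_within_open[OF _ assms(1,2)]) (simp add: assms(3))
  from fun_cong[OF frechet_derivative_at[OF this], of v] show ?thesis by simp
qed

lemma integral_nonneg_eq_0_imp:
  fixes G :: "'e::euclidean_space \<Rightarrow> real"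
  assumes "continuous_on UNIV G" "\<And>y. 0 \<le> G y" "compact K" "\<And>y. y \<notin> K \<Longrightarrow> G y = 0" "integral UNIV G = 0"
  shows "G y = 0"
proof -
  \<comment> \<open>Including \<open>y\<close> makes the open box nonempty, as the criterion for a
    vanishing integral demands, and places \<open>y\<close> inside it.\<close>
  have "bounded (insert y K)" using assms(3) compact_imp_bounded by auto
  then obtain a where a: "insert y K \<subseteq> box (- a) a"
    using bounded_subset_box_symmetric by blast
  have "integral (cbox (- a) a) G = integral UNIV G"
    by (rule integral_supset_eq_UNIV) (use a assms(4) box_subset_cbox in blast)
  then have "\<forall>x\<in>cbox (- a) a. G x = 0"
    using integral_cbox_eq_0_iff[of "- a" a G] assms a continuous_on_subset by (metis empty_iff insert_subset subset_UNIV)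
  then show ?thesis using a box_subset_cbox by blast
qed

lemma smooth_on_vec_nth: "open S \<Longrightarrow> smooth_on S f \<Longrightarrow> smooth_on S (\<lambda>x. f x $ i)"
  by (rule smooth_on_linear[OF _ bounded_linear_vec_nth])

context oriented_atlas
begin

lemma form_has_derivative:
  assumes "\<mu> \<in> forms A" "c \<in> A" "y \<in> cimg c"
  shows "((\<lambda>y. \<mu> (cinv c y) c) has_derivative frechet_derivative (\<lambda>y. \<mu> (cinv c y) c) (at y)) (at y)"
  by (rule smooth_on_imp_has_derivative[OF formsD(3)[OF assms(1,2)] assms(3)])

lemma lie_form_chart:
  assumes "c \<in> A" "y \<in> cimg c"
  shows "lie_form A X \<mu> (cinv c y) c = frechet_derivative (\<lambda>y. \<mu> (cinv c y) c) (at y) (X (cinv c y) c) +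
    \<mu> (cinv c y) c * trace (matrix (frechet_derivative (\<lambda>y. X (cinv c y) c) (at y)))"
  using assms cinv_in_cdom cmap_cinv by (simp add: lie_form_def)

lemma lie_form_outside: "\<not> (c \<in> A \<and> x \<in> cdom c) \<Longrightarrow> lie_form A X \<mu> x c = 0"
  unfolding lie_form_def by (rule if_not_P)

lemma lie_form_add:
  assumes "\<mu> \<in> forms A" "\<nu> \<in> forms A"
  shows "lie_form A X (\<mu> + \<nu>) = lie_form A X \<mu> + lie_form A X \<nu>"
proof (intro ext)
  fix x c
  show "lie_form A X (\<mu> + \<nu>) x c = (lie_form A X \<mu> + lie_form A X \<nu>) x c"
  proof (cases "c \<in> A \<and> x \<in> cdom c")
    case True
    then have c: "c \<in> A" and y: "cmap c x \<in> cimg c" using cmap_in_cimg[of x c] by auto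
    from has_derivative_add[OF form_has_derivative[OF assms(1) c y] form_has_derivative[OF assms(2) c y]]
    show ?thesis using True
      by (simp add: lie_form_def frechet_derivative_at[symmetric] algebra_simps)
  qed (simp add: lie_form_outside)
qed

lemma lie_form_scaleR:
  assumes "\<mu> \<in> forms A"
  shows "lie_form A X (r *\<^sub>R \<mu>) = r *\<^sub>R lie_form A X \<mu>"
proof (intro ext)
  fix x c
  show "lie_form A X (r *\<^sub>R \<mu>) x c = (r *\<^sub>R lie_form A X \<mu>) x c"
  proof (cases "c \<in> A \<and> x \<in> cdom c")
    case True
    then have c: "c \<in> A" and y: "cmap c x \<in> cimg c" using cmap_in_cimg[of x c] by auto
    from has_derivative_mult_right[OF form_has_derivative[OF assms(1) c y], of r]
    show ?thesis using True
      by (simp add: lie_form_def scaleR_fun_def frechet_derivative_at[symmetric] algebra_simps)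
  qed (simp add: lie_form_outside scaleR_fun_def)
qed

lemma lie_form_local:
  assumes "open U" "x \<in> U" "\<And>z. z \<in> U \<Longrightarrow> \<mu> z = 0"
  shows "lie_form A X \<mu> x = 0"
proof
  fix c
  show "lie_form A X \<mu> x c = 0 c"
  proof (cases "c \<in> A \<and> x \<in> cdom c")
    case True
    have "frechet_derivative (\<lambda>y. \<mu> (cinv c y) c) (at (cmap c x)) v = 0" for v
      by (rule frechet_derivative_eq_0[of "cmap c ` (cdom c \<inter> U)"])
        (use True assms cinv_cmap[of c] in \<open>auto intro!: open_cmap_image open_cdom\<close>)
    then show ?thesis using assms(3)[OF assms(2)] True by (simp add: lie_form_def)
  qed (simp add: lie_form_outside)
qed

lemma supp_lie_form: "supp (lie_form A X \<mu>) \<subseteq> supp \<mu>"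
proof (rule supp_minimal[OF closed_supp])
  fix x assume x: "lie_form A X \<mu> x \<noteq> 0"
  show "x \<in> supp \<mu>"
  proof (rule ccontr)
    assume "x \<notin> supp \<mu>"
    then have "lie_form A X \<mu> x = 0"
      using closed_supp in_supp by (intro lie_form_local[of "- supp \<mu>"]) (auto simp: open_Compl)
    with x show False by simp
  qed
qed

lemma lie_fun_outside_supp:
  assumes "x \<notin> supp f"
  shows "lie_fun A X f x = 0"
proof -
  have "lie_fun A X (\<lambda>_. 0) x = lie_fun A X f x"
  proof (rule lie_fun_local[OF smooth_fun_const])
    show "open (- supp f)" by (simp add: closed_supp open_Compl)
    show "0 = f z" if "z \<in> - supp f" for z using that in_supp[of f z] by auto
  qed (use assms in simp)
  then show ?thesis by (simp add: lie_fun_zero)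
qed

lemma smooth_on_lie_form:
  assumes "\<mu> \<in> forms A" "X \<in> vfields A" "c \<in> A"
  shows "smooth_on (cimg c) (\<lambda>y. lie_form A X \<mu> (cinv c y) c)"
proof -
  have "smooth_on (cimg c) (\<lambda>y. frechet_derivative (\<lambda>y. X (cinv c y) c) (at y) (axis i 1) $ i)" for i
    by (intro smooth_on_vec_nth smooth_on_deriv vfieldsD open_cimg assms)
  then have "smooth_on (cimg c) (\<lambda>y. \<Sum>i\<in>UNIV. frechet_derivative (\<lambda>y. X (cinv c y) c) (at y) (axis i 1) $ i)"
    by (intro smooth_on_sum open_cimg assms)
  then have "smooth_on (cimg c) (\<lambda>y. trace (matrix (frechet_derivative (\<lambda>y. X (cinv c y) c) (at y))))"
    by (simp add: trace_def matrix_def)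
  then have "smooth_on (cimg c) (\<lambda>y. frechet_derivative (\<lambda>y. \<mu> (cinv c y) c) (at y) (X (cinv c y) c) +
    \<mu> (cinv c y) c * trace (matrix (frechet_derivative (\<lambda>y. X (cinv c y) c) (at y))))"
    by (intro smooth_on_add smooth_on_mult smooth_on_deriv_along formsD(3) vfieldsD open_cimg assms)
  then show ?thesis
    by (rule smooth_on_eqI[OF open_cimg[OF assms(3)]]) (simp add: lie_form_chart assms(3))
qed

text \<open>The integrand is the coordinate divergence of the field \<open>f \<mu> X\<close>: the
  term \<open>div X\<close> in \<open>lie_form\<close> is what the product rule leaves over. Compact
  support inside the chart makes the integral of each partial derivative vanish.\<close>

lemma chart_divergence:
  assumes f: "smooth_fun A f" and \<mu>: "\<mu> \<in> forms A" and X: "X \<in> vfields A" and c: "c \<in> A"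
    and K: "compact K" "K \<subseteq> cdom c" "\<And>x. x \<notin> K \<Longrightarrow> f x = 0 \<or> \<mu> x = 0"
  shows "integral (cimg c) (\<lambda>y. lie_fun A X f (cinv c y) * \<mu> (cinv c y) c +
    f (cinv c y) * lie_form A X \<mu> (cinv c y) c) = 0"
proof -
  define a where "a = f \<circ> cinv c"
  define m where "m y = \<mu> (cinv c y) c" for y
  define V where "V y = X (cinv c y) c" for y
  have sm: "smooth_on (cimg c) a" "smooth_on (cimg c) m" "smooth_on (cimg c) V"
    unfolding a_def m_def V_def using f \<mu> X c by (auto intro: smooth_funD formsD vfieldsD)
  \<comment> \<open>The components of this field, extended by zero so that they are smooth on the
    whole coordinate space.\<close>
  define W where "W i y = (if y \<in> cimg c then a y * m y * V y $ i else 0)" for i y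
  let ?K = "cmap c ` K"
  have K': "compact ?K" "?K \<subseteq> cimg c"
    using compact_cmap_image[OF c K(1,2)] K(2) cmap_in_cimg[of _ c] by auto
  have am: "a y * m y = 0" if "y \<in> cimg c" "y \<notin> ?K" for y
  proof -
    have "cinv c y \<notin> K" using that cmap_cinv[OF c] by (metis imageI)
    from K(3)[OF this] show ?thesis by (auto simp: a_def m_def)
  qed
  have W0: "W i y = 0" if "y \<notin> ?K" for i y
    using am that by (simp add: W_def)
  have smW: "smooth_on UNIV (W i)" for i
    unfolding W_def
    by (rule smooth_on_extend_zero[OF open_cimg[OF c] _ compact_imp_closed[OF K'(1)] K'(2)])
      (use am in \<open>auto intro!: smooth_on_mult smooth_on_vec_nth sm open_cimg c\<close>)
  have dW0: "frechet_derivative (W i) (at y) v = 0" if "y \<notin> ?K" for i y v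
    by (rule frechet_derivative_eq_0[of "- ?K"]) (use that W0 K' in \<open>auto simp: compact_imp_closed open_Compl\<close>)
  have "lie_fun A X f (cinv c y) * \<mu> (cinv c y) c + f (cinv c y) * lie_form A X \<mu> (cinv c y) c =
      (\<Sum>i\<in>UNIV. frechet_derivative (W i) (at y) (axis i 1))" if y: "y \<in> cimg c" for y
  proof -
    define Da where "Da = frechet_derivative a (at y)"
    define Dm where "Dm = frechet_derivative m (at y)"
    define DV where "DV = frechet_derivative V (at y)"
    have der: "(a has_derivative Da) (at y)" "(m has_derivative Dm) (at y)" "(V has_derivative DV) (at y)"
      unfolding Da_def Dm_def DV_def using sm y by (auto intro: smooth_on_imp_has_derivative)
    have "((\<lambda>y. a y * m y * V y $ i) has_derivative
        (\<lambda>v. a y * m y * DV v $ i + (a y * Dm v + Da v * m y) * V y $ i)) (at y)" for i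
      by (intro has_derivative_mult der bounded_linear.has_derivative[OF bounded_linear_vec_nth])
    then have "(W i has_derivative
        (\<lambda>v. a y * m y * DV v $ i + (a y * Dm v + Da v * m y) * V y $ i)) (at y)" for i
      by (rule has_derivative_transform_within_open[OF _ open_cimg[OF c] y]) (simp add: W_def)
    then have "frechet_derivative (W i) (at y) (axis i 1) =
        a y * m y * DV (axis i 1) $ i + (a y * Dm (axis i 1) + Da (axis i 1) * m y) * V y $ i" for i
      by (rule fun_cong[OF frechet_derivative_at[symmetric]])
    then have "(\<Sum>i\<in>UNIV. frechet_derivative (W i) (at y) (axis i 1)) =
        (\<Sum>i\<in>UNIV. a y * m y * DV (axis i 1) $ i + (a y * Dm (axis i 1) + Da (axis i 1) * m y) * V y $ i)"
      by simp
    also have "\<dots> = a y * m y * (\<Sum>i\<in>UNIV. DV (axis i 1) $ i) +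
        a y * (\<Sum>i\<in>UNIV. V y $ i *\<^sub>R Dm (axis i 1)) + m y * (\<Sum>i\<in>UNIV. V y $ i *\<^sub>R Da (axis i 1))"
      by (simp add: sum.distrib sum_distrib_left algebra_simps)
    also have "\<dots> = a y * m y * trace (matrix DV) + a y * Dm (V y) + m y * Da (V y)"
      using linear_axis_sum[OF has_derivative_linear[OF der(2)], of "V y"]
        linear_axis_sum[OF has_derivative_linear[OF der(1)], of "V y"]
      by (simp add: trace_def matrix_def)
    finally show ?thesis
      using lie_fun_chart[OF f X c cinv_in_cdom[OF c y]] lie_form_chart[OF c y, of X \<mu>] cmap_cinv[OF c y]
      by (simp add: a_def[symmetric] m_def[symmetric] V_def[symmetric] Da_def[symmetric] Dm_def[symmetric]
          DV_def[symmetric] algebra_simps) (simp add: a_def m_def V_def algebra_simps)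
  qed
  then have "integral (cimg c) (\<lambda>y. lie_fun A X f (cinv c y) * \<mu> (cinv c y) c + f (cinv c y) * lie_form A X \<mu> (cinv c y) c)
      = integral (cimg c) (\<lambda>y. \<Sum>i\<in>UNIV. frechet_derivative (W i) (at y) (axis i 1))"
    by (rule integral_cong)
  also have "\<dots> = integral UNIV (\<lambda>y. \<Sum>i\<in>UNIV. frechet_derivative (W i) (at y) (axis i 1))"
  proof (rule integral_supset_eq_UNIV)
    fix y assume "y \<notin> cimg c"
    then have "y \<notin> ?K" using K'(2) by blast
    then show "(\<Sum>i\<in>UNIV. frechet_derivative (W i) (at y) (axis i 1)) = 0"
      by (simp add: dW0)
  qed
  also have "\<dots> = (\<Sum>i\<in>UNIV. integral UNIV (\<lambda>y. frechet_derivative (W i) (at y) (axis i 1)))"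
  proof (rule integral_sum)
    fix i
    have "(\<lambda>y. frechet_derivative (W i) (at y) (axis i 1)) absolutely_integrable_on UNIV"
      by (rule absolutely_integrable_compact_support[OF _ K'(1)])
        (auto intro!: smooth_on_imp_continuous_on smooth_on_deriv smW dW0)
    then show "(\<lambda>y. frechet_derivative (W i) (at y) (axis i 1)) integrable_on UNIV"
      using set_lebesgue_integral_eq_integral(1) by blast
  qed simp
  also have "\<dots> = 0"
    by (intro sum.neutral ballI integral_directional_derivative_eq_0[OF smW K'(1) W0])
  finally show ?thesis .
qed

text \<open>Support of either \<open>f\<close> or \<open>\<mu>\<close> in \<open>K\<close> makes
  both products vanish off \<open>K\<close>, so each is integrable on its own.
  \<open>lie_form_transform\<close> uses the alternative for \<open>f\<close>,
  \<open>stokes_chart\<close> the one for \<open>\<mu>\<close>.\<close>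

lemma chart_divergence_split:
  assumes f: "smooth_fun A f" and \<mu>: "\<mu> \<in> forms A" and X: "X \<in> vfields A" and c: "c \<in> A"
    and K: "compact K" "K \<subseteq> cdom c" "supp f \<subseteq> K \<or> supp \<mu> \<subseteq> K"
  shows "integral (cimg c) (\<lambda>y. lie_fun A X f (cinv c y) * \<mu> (cinv c y) c) =
    - integral (cimg c) (\<lambda>y. f (cinv c y) * lie_form A X \<mu> (cinv c y) c)"
proof -
  have zero: "f x = 0 \<or> \<mu> x = 0" "lie_fun A X f x * \<mu> x c = 0" "f x * lie_form A X \<mu> x c = 0"
    if x: "x \<notin> K" for x
  proof -
    consider "x \<notin> supp f" | "x \<notin> supp \<mu>" using K(3) x by blast
    then have "(f x = 0 \<and> lie_fun A X f x = 0) \<or> (\<mu> x = 0 \<and> lie_form A X \<mu> x = 0)"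
      using lie_fun_outside_supp[of x f X] in_supp[of f x] in_supp[of \<mu> x] in_supp[of "lie_form A X \<mu>" x]
        supp_lie_form[of X \<mu>] by cases blast+
    then show "f x = 0 \<or> \<mu> x = 0" "lie_fun A X f x * \<mu> x c = 0" "f x * lie_form A X \<mu> x c = 0"
      by (metis mult_zero_left mult_zero_right zero_fun_apply)+
  qed
  have K': "compact (cmap c ` K)" "cmap c ` K \<subseteq> cimg c"
    using compact_cmap_image[OF c K(1,2)] K(2) cmap_in_cimg[of _ c] by auto
  have outside: "cinv c y \<notin> K" if "y \<in> cimg c" "y \<notin> cmap c ` K" for y
    using that cmap_cinv[OF c] by (metis imageI)
  have 1: "(\<lambda>y. lie_fun A X f (cinv c y) * \<mu> (cinv c y) c) integrable_on cimg c"
    by (intro set_lebesgue_integral_eq_integral(1) absolutely_integrable_compact_support[OF _ K']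
       zero outside smooth_on_imp_continuous_on smooth_on_mult open_cimg c smooth_fun_comp_cinv formsD(3)
       smooth_fun_lie_fun f X \<mu>)
  have 2: "(\<lambda>y. f (cinv c y) * lie_form A X \<mu> (cinv c y) c) integrable_on cimg c"
    by (intro set_lebesgue_integral_eq_integral(1) absolutely_integrable_compact_support[OF _ K']
       zero outside smooth_on_imp_continuous_on smooth_on_mult open_cimg c smooth_fun_comp_cinv smooth_on_lie_form
       f X \<mu>)
  show ?thesis
    using chart_divergence[OF f \<mu> X c K(1,2) zero(1)] integral_add[OF 1 2] by simp
qed

lemma smooth_on_det_jacobian:
  assumes "c \<in> A" "d \<in> A"
  shows "smooth_on (cmap c ` (cdom c \<inter> cdom d)) (\<lambda>y. det (jacobian c d (cinv c y)))"
proof -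
  let ?S = "cmap c ` (cdom c \<inter> cdom d)"
  have S: "open ?S"
    by (intro open_cmap_image assms open_Int open_cdom) auto
  have "smooth_on ?S (\<lambda>y. frechet_derivative (cmap d \<circ> cinv c) (at y) (axis j 1) $ i)" for i j
    by (intro smooth_on_vec_nth smooth_on_deriv smooth_on_transition S assms)
  then have "smooth_on ?S (\<lambda>y. det (matrix (frechet_derivative (cmap d \<circ> cinv c) (at y))))"
    unfolding det_def matrix_def
    by (simp, intro smooth_on_sum smooth_on_mult smooth_on_const smooth_on_prod S)
  then show ?thesis
    by (rule smooth_on_eqI[OF S]) (use cinv_cmap[OF assms(1)] in \<open>auto simp: jacobian_def\<close>)
qed

text \<open>The integral of \<open>(L\<^sub>X f) \<mu>\<close>, which is minus that of \<open>f L\<^sub>X \<mu>\<close>, does not depend on the chart. Hence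
  both sides agree when tested against all functions \<open>f\<close> supported in the overlap. Taking for \<open>f\<close> a bump
  function times the difference of the two sides avoids the derivative of the Jacobian determinant.\<close>

lemma lie_form_transform:
  assumes \<mu>: "\<mu> \<in> forms A" and X: "X \<in> vfields A" and c: "c \<in> A" and d: "d \<in> A" and x: "x \<in> cdom c" "x \<in> cdom d"
  shows "lie_form A X \<mu> x c = det (jacobian c d x) * lie_form A X \<mu> x d"
proof -
  define S where "S = cmap c ` (cdom c \<inter> cdom d)"
  have S: "open S" "S \<subseteq> cimg c" "cmap c x \<in> S" unfolding S_def
    using c d x cmap_in_cimg[of _ c] by (auto intro!: open_cmap_image open_Int open_cdom)
  have in_S: "cinv c y \<in> cdom d" if "y \<in> S" for y
    using that cinv_cmap[OF c] by (auto simp: S_def)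
  have S_in: "y \<in> S" if "y \<in> cimg c" "cinv c y \<in> cdom d" for y
    using that cmap_cinv[OF c] cinv_in_cdom[OF c] unfolding S_def by (metis IntI imageI)
  \<comment> \<open>The defect of the transformation law, to be shown zero at
    \<open>cmap c x\<close>.\<close>
  define g where "g y = lie_form A X \<mu> (cinv c y) c - det (jacobian c d (cinv c y)) * lie_form A X \<mu> (cinv c y) d" for y
  have "smooth_on S (\<lambda>y. lie_form A X \<mu> (cinv d ((cmap d \<circ> cinv c) y)) d)"
    by (rule smooth_on_compose[OF S(1) open_cimg[OF d] _ smooth_on_lie_form[OF \<mu> X d]])
      (use in_S smooth_on_transition[OF c d] cmap_in_cimg[of _ d] in \<open>simp_all add: S_def[symmetric] image_subset_iff o_def\<close>)
  then have "smooth_on S (\<lambda>y. lie_form A X \<mu> (cinv c y) d)"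
    by (rule smooth_on_eqI[OF S(1)]) (simp add: cinv_cmap[OF d] in_S)
  then have g: "smooth_on S g"
    unfolding g_def using smooth_on_det_jacobian[OF c d] smooth_on_subset[OF smooth_on_lie_form[OF \<mu> X c] S(2)]
    by (intro smooth_on_diff smooth_on_mult S(1)) (auto simp: S_def)
  obtain \<psi> :: "(real, 'n) vec \<Rightarrow> real" and V K where \<psi>: "smooth_on UNIV \<psi>" "\<And>y. 0 \<le> \<psi> y" "\<And>y. \<psi> y \<le> 1"
    "open V" "cmap c x \<in> V" "\<And>y. y \<in> V \<Longrightarrow> \<psi> y = 1"
    "compact K" "K \<subseteq> S" "\<And>y. y \<notin> K \<Longrightarrow> \<psi> y = 0"
    by (rule bump_exists[OF S(1,3)]) (rule that)
  have h: "smooth_on S (\<lambda>y. \<psi> y * g y)"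
    by (intro smooth_on_mult S g smooth_on_subset[OF \<psi>(1) subset_UNIV])
  define f where "f z = (if z \<in> cdom c \<and> cmap c z \<in> S then \<psi> (cmap c z) * g (cmap c z) else 0)" for z
  have f: "smooth_fun A f" "supp f \<subseteq> cinv c ` K"
    unfolding f_def by (rule extend_from_chart[OF c S(1,2) h \<psi>(7,8)]; simp add: \<psi>(9))+
  let ?K = "cinv c ` K"
  have K: "compact ?K" "?K \<subseteq> cdom c" "?K \<subseteq> cdom d"
    using \<psi>(7,8) S(2) in_S cinv_in_cdom[OF c] by (auto intro!: compact_cinv_image[OF c])
  have fz: "f z = 0" if "z \<notin> ?K" for z using that f(2) in_supp[of f z] by auto
  have Lf: "mult_form (lie_fun A X f) \<mu> \<in> cforms A" "supp (mult_form (lie_fun A X f) \<mu>) \<subseteq> ?K"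
  proof -
    show *: "supp (mult_form (lie_fun A X f) \<mu>) \<subseteq> ?K"
    proof (rule supp_minimal[OF compact_imp_closed[OF K(1)]])
      fix z assume "mult_form (lie_fun A X f) \<mu> z \<noteq> 0"
      then have "lie_fun A X f z \<noteq> 0" using mult_form_eq_0(1) by metis
      then show "z \<in> ?K" using lie_fun_outside_supp f(2) by blast
    qed
    show "mult_form (lie_fun A X f) \<mu> \<in> cforms A"
      using compact_supp_subset[OF K(1) *] by (simp add: cforms_def forms_mult smooth_fun_lie_fun f X \<mu>)
  qed
  have div: "chart_integral e (mult_form (lie_fun A X f) \<mu>) =
      - integral (cimg e) (\<lambda>y. f (cinv e y) * lie_form A X \<mu> (cinv e y) e)" if "e \<in> A" "?K \<subseteq> cdom e" for e
    unfolding chart_integral_def mult_form_def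
    by (rule chart_divergence_split[OF f(1) \<mu> X that(1) K(1) that(2)]) (simp add: f(2))
  \<comment> \<open>Only \<open>\<mu>\<close> and the function \<open>lie_fun A X f\<close> occur
    here, so this product is already known to be a form.\<close>
  have "chart_integral c (mult_form (lie_fun A X f) \<mu>) = chart_integral d (mult_form (lie_fun A X f) \<mu>)"
    using Lf(2) K by (intro chart_integral_change Lf(1) c d) auto
  then have "integral (cimg c) (\<lambda>y. f (cinv c y) * lie_form A X \<mu> (cinv c y) c) =
      integral (cimg d) (\<lambda>y. f (cinv d y) * lie_form A X \<mu> (cinv d y) d)"
    using div[OF c K(2)] div[OF d K(3)] by simp
  \<comment> \<open>Back to the chart \<open>c\<close> by plain substitution; no transformation law
    for \<open>lie_form\<close> is presupposed.\<close>
  also have "\<dots> = integral (cimg c) (\<lambda>y. det (jacobian c d (cinv c y)) * (f (cinv c y) * lie_form A X \<mu> (cinv c y) d))"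
    by (rule integral_change_chart[OF c d K, of "\<lambda>z. f z * lie_form A X \<mu> z d", OF _ smooth_on_imp_continuous_on
        [OF smooth_on_mult[OF open_cimg[OF d] smooth_fun_comp_cinv[OF f(1) d] smooth_on_lie_form[OF \<mu> X d]]]])
      (simp add: fz)
  finally have eq: "integral (cimg c) (\<lambda>y. f (cinv c y) * lie_form A X \<mu> (cinv c y) c) =
    integral (cimg c) (\<lambda>y. det (jacobian c d (cinv c y)) * (f (cinv c y) * lie_form A X \<mu> (cinv c y) d))" .
  have fg: "smooth_on S (\<lambda>y. \<psi> y * g y * g y)"
    by (intro smooth_on_mult S g h)
  \<comment> \<open>On \<open>cimg c\<close> this is the difference of the integrands in
    \<open>eq\<close>. It equals \<psi> times the square of \<open>g\<close>, hence is nonnegative,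
    and its integral is zero; at \<open>cmap c x\<close> the bump is 1, so \<open>g\<close> vanishes
    there.\<close>
  define G where "G y = (if y \<in> S then \<psi> y * g y * g y else 0)" for y
  have smG: "smooth_on UNIV G"
    unfolding G_def by (rule smooth_on_extend_zero[OF S(1) fg compact_imp_closed[OF \<psi>(7)] \<psi>(8)]) (simp add: \<psi>(9))
  have fS: "f (cinv c y) = (if y \<in> S then \<psi> y * g y else 0)" if "y \<in> cimg c" for y
    using that cmap_cinv[OF c] cinv_in_cdom[OF c] by (simp add: f_def)
  have G_eq: "G y = f (cinv c y) * lie_form A X \<mu> (cinv c y) c -
      det (jacobian c d (cinv c y)) * (f (cinv c y) * lie_form A X \<mu> (cinv c y) d)" if "y \<in> cimg c" for y
    using fS[OF that] by (simp add: G_def) (simp add: g_def algebra_simps)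
  have Kc: "K \<subseteq> cimg c" using \<psi>(8) S(2) by blast
  have G0: "G y = 0" if "y \<notin> K" for y using \<psi>(9)[OF that] by (simp add: G_def)
  have intc: "(\<lambda>y. f (cinv c y) * lie_form A X \<mu> (cinv c y) c) integrable_on cimg c"
    by (intro set_lebesgue_integral_eq_integral(1) absolutely_integrable_compact_support[OF _ \<psi>(7) Kc]
       smooth_on_imp_continuous_on smooth_on_mult open_cimg c smooth_fun_comp_cinv smooth_on_lie_form f X \<mu>)
     (simp add: fS \<psi>(9))
  have intG: "G integrable_on cimg c"
    by (intro set_lebesgue_integral_eq_integral(1) absolutely_integrable_compact_support[OF _ \<psi>(7) Kc] G0
        continuous_on_subset[OF smooth_on_imp_continuous_on[OF smG]]) auto
  have "integral (cimg c) (\<lambda>y. det (jacobian c d (cinv c y)) * (f (cinv c y) * lie_form A X \<mu> (cinv c y) d)) =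
      integral (cimg c) (\<lambda>y. f (cinv c y) * lie_form A X \<mu> (cinv c y) c - G y)"
    by (rule integral_cong) (simp add: G_eq)
  also have "\<dots> = integral (cimg c) (\<lambda>y. f (cinv c y) * lie_form A X \<mu> (cinv c y) c) - integral (cimg c) G"
    by (rule integral_diff[OF intc intG])
  finally have "integral (cimg c) G = 0" using eq by simp
  moreover have "integral (cimg c) G = integral UNIV G"
    by (rule integral_supset_eq_UNIV) (use S(2) in \<open>auto simp: G_def\<close>)
  ultimately have "integral UNIV G = 0" by simp
  from integral_nonneg_eq_0_imp[OF smooth_on_imp_continuous_on[OF smG] _ \<psi>(7) G0 this]
  have "G (cmap c x) = 0"
    using \<psi>(2) by (simp add: G_def mult.assoc)
  then have "g (cmap c x) = 0"
    using S(3) \<psi>(5,6) by (simp add: G_def)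
  then show ?thesis by (simp add: g_def cinv_cmap[OF c x(1)])
qed

lemma forms_lie_form: "\<mu> \<in> forms A \<Longrightarrow> X \<in> vfields A \<Longrightarrow> lie_form A X \<mu> \<in> forms A"
  by (rule formsI) (blast intro: lie_form_outside lie_form_transform smooth_on_lie_form)+

lemma cforms_lie_form: "\<mu> \<in> cforms A \<Longrightarrow> X \<in> vfields A \<Longrightarrow> lie_form A X \<mu> \<in> cforms A"
  using compact_supp_subset[OF _ supp_lie_form] by (simp add: cforms_def forms_lie_form)

section \<open>Stokes' theorem for Lie derivatives\<close>

lemma stokes_chart:
  assumes f: "smooth_fun A f" and \<mu>: "\<mu> \<in> cforms A" and X: "X \<in> vfields A" and c: "c \<in> A" "supp \<mu> \<subseteq> cdom c"
  shows "form_integral A (mult_form (lie_fun A X f) \<mu>) = - form_integral A (mult_form f (lie_form A X \<mu>))"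
proof -
  have 1: "form_integral A (mult_form (lie_fun A X f) \<mu>) = chart_integral c (mult_form (lie_fun A X f) \<mu>)"
    by (rule form_integral_chart[OF cforms_mult[OF smooth_fun_lie_fun[OF f X] \<mu>] c(1)
      order_trans[OF supp_mult_form(2) c(2)]])
  have 2: "form_integral A (mult_form f (lie_form A X \<mu>)) = chart_integral c (mult_form f (lie_form A X \<mu>))"
    by (rule form_integral_chart[OF cforms_mult[OF f cforms_lie_form[OF \<mu> X]] c(1)
      order_trans[OF supp_mult_form(2) order_trans[OF supp_lie_form c(2)]]])
  show ?thesis
    unfolding 1 2 unfolding chart_integral_def mult_form_def
    by (rule chart_divergence_split[OF f cformsD(1)[OF \<mu>] X c(1) cformsD(2)[OF \<mu>] c(2)]) simp
qed

text \<open>Both sides are additive in \<open>\<mu>\<close>, so the pieces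
  \<open>mult_form (\<rho> i) \<mu>\<close> can be treated one by one, each in its own chart. As
  \<open>\<mu>\<close> is cut up and not \<open>f\<close>, derivatives of the partition functions
  stay inside \<open>lie_form\<close> and need not be seen to cancel.\<close>

lemma stokes:
  assumes f: "smooth_fun A f" and \<mu>: "\<mu> \<in> cforms A" and X: "X \<in> vfields A"
  shows "form_integral A (mult_form (lie_fun A X f) \<mu>) = - form_integral A (mult_form f (lie_form A X \<mu>))"
proof -
  obtain N c \<rho> where p: "partition_on_compact (supp \<mu>) N c \<rho>"
    using partition_exists[OF cformsD(2)[OF \<mu>]] .
  \<comment> \<open>Partial sums, so that the induction only needs additivity for two forms; the
    last one is \<open>\<mu>\<close>.\<close>
  define \<nu> where "\<nu> k = (\<Sum>i<k. mult_form (\<rho> i) \<mu>)" for k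
  have "\<nu> k \<in> cforms A \<and>
      form_integral A (mult_form (lie_fun A X f) (\<nu> k)) = - form_integral A (mult_form f (lie_form A X (\<nu> k)))"
    if "k \<le> N" for k
    using that
  proof (induction k)
    case 0
    have 1: "mult_form g 0 = (0 :: ('a, 'n) form)" for g
      by (simp add: mult_form_def fun_eq_iff)
    have 2: "lie_form A X 0 = 0"
      using lie_form_scaleR[OF forms_zero, of X 0] by simp
    have 3: "form_integral A 0 = 0"
      using form_integral_add[OF cforms_zero cforms_zero] by simp
    have 4: "\<nu> 0 = 0" by (simp add: \<nu>_def)
    show ?case unfolding 4 2 1 3 by (simp only: cforms_zero minus_zero)
  next
    case (Suc k)
    then have k: "k < N" by simp
    have \<rho>\<mu>: "mult_form (\<rho> k) \<mu> \<in> cforms A" by (rule partition_mult_form(1)[OF p k \<mu>])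
    have IH: "\<nu> k \<in> cforms A"
      "form_integral A (mult_form (lie_fun A X f) (\<nu> k)) = - form_integral A (mult_form f (lie_form A X (\<nu> k)))"
      using Suc by auto
    have eq: "\<nu> (Suc k) = \<nu> k + mult_form (\<rho> k) \<mu>" by (simp add: \<nu>_def)
    note st = stokes_chart[OF f \<rho>\<mu> X partitionD(1)[OF p k] partition_mult_form(2)[OF p k \<mu>]]
    have "form_integral A (mult_form (lie_fun A X f) (\<nu> (Suc k))) =
      form_integral A (mult_form (lie_fun A X f) (\<nu> k)) + form_integral A (mult_form (lie_fun A X f) (mult_form (\<rho> k) \<mu>))"
      unfolding eq mult_form_add
      by (intro form_integral_add cforms_mult smooth_fun_lie_fun f X IH \<rho>\<mu>)
    moreover have "form_integral A (mult_form f (lie_form A X (\<nu> (Suc k)))) =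
      form_integral A (mult_form f (lie_form A X (\<nu> k))) + form_integral A (mult_form f (lie_form A X (mult_form (\<rho> k) \<mu>)))"
      unfolding eq lie_form_add[OF cformsD(1)[OF IH(1)] cformsD(1)[OF \<rho>\<mu>]] mult_form_add
      by (intro form_integral_add cforms_mult cforms_lie_form f X IH \<rho>\<mu>)
    ultimately have "form_integral A (mult_form (lie_fun A X f) (\<nu> (Suc k))) =
        - form_integral A (mult_form f (lie_form A X (\<nu> (Suc k))))"
      using IH(2) st by simp
    moreover have "\<nu> (Suc k) \<in> cforms A"
      unfolding eq by (rule cforms_add[OF IH(1) \<rho>\<mu>])
    ultimately show ?case by blast
  qed
  moreover have "\<nu> N = \<mu>"
  proof (intro ext)
    fix x e
    have "\<nu> k x e = (\<Sum>i<k. \<rho> i x) * \<mu> x e" for k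
      by (induction k) (simp_all add: \<nu>_def mult_form_def distrib_right)
    moreover have "(\<Sum>i<N. \<rho> i x) = 1 \<or> \<mu> x = 0"
      using partition_sum[OF p] in_supp[of \<mu> x] by blast
    ultimately show "\<nu> N x e = \<mu> x e" by auto
  qed
  ultimately show ?thesis by blast
qed

end

section \<open>Smooth maps into locally convex spaces\<close>

text \<open>The record type imposes no conditions; these are the ones on which the calculus below
  rests. Separation is not among them: uniqueness of derivatives is proved for each space on its
  own, in \<open>lc_deriv_Omega_c\<close> and \<open>lc_deriv_Cinf\<close>.\<close>

definition lcs :: "'v::real_vector lcs \<Rightarrow> bool" where
  "lcs E \<longleftrightarrow> subspace (pts E) \<and> (\<forall>p\<in>seminorms E. seminorm_on (pts E) p)"

lemma seminorm_onD:
  assumes "seminorm_on V p" "subspace V"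
  shows "v \<in> V \<Longrightarrow> w \<in> V \<Longrightarrow> p (v + w) \<le> p v + p w"
    "v \<in> V \<Longrightarrow> p (r *\<^sub>R v) = \<bar>r\<bar> * p v" "p 0 = 0" "v \<in> V \<Longrightarrow> 0 \<le> p v"
proof -
  show add: "v \<in> V \<Longrightarrow> w \<in> V \<Longrightarrow> p (v + w) \<le> p v + p w" for v w
    using assms unfolding seminorm_on_def by blast
  show scale: "v \<in> V \<Longrightarrow> p (r *\<^sub>R v) = \<bar>r\<bar> * p v" for r v
    using assms unfolding seminorm_on_def by blast
  show zero: "p 0 = 0" using scale[of 0 0] subspace_0[OF assms(2)] by simp
  assume v: "v \<in> V"
  have "(- 1) *\<^sub>R v \<in> V" by (rule subspace_scale[OF assms(2) v])
  from add[OF v this] scale[OF v, of "- 1"] show "0 \<le> p v" by (simp add: zero)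
qed

lemma seminorm_on_sum:
  assumes "seminorm_on V p" "subspace V" "finite I" "\<And>i. i \<in> I \<Longrightarrow> v i \<in> V"
  shows "p (\<Sum>i\<in>I. v i) \<le> (\<Sum>i\<in>I. p (v i))"
  using assms(3,4)
proof (induction I)
  case empty
  show ?case by (simp add: seminorm_onD(3)[OF assms(1,2)])
next
  case (insert i I)
  then have "p (v i + (\<Sum>i\<in>I. v i)) \<le> p (v i) + p (\<Sum>i\<in>I. v i)"
    by (intro seminorm_onD(1)[OF assms(1,2)] subspace_sum[OF assms(2)]) auto
  with insert show ?case by simp
qed

definition lc_partials :: "'v::real_vector lcs \<Rightarrow> (real ^ 'n::finite \<Rightarrow> 'v) \<Rightarrow> ('n \<Rightarrow> 'v) \<Rightarrow> real ^ 'n \<Rightarrow> bool" where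
  "lc_partials E g G y \<longleftrightarrow>
     lc_tendsto E (\<lambda>h. (g (y + h) - g y - (\<Sum>i\<in>UNIV. (h $ i) *\<^sub>R G i)) /\<^sub>R norm h) 0 (at 0)"

text \<open>The witness of \<open>lc_smooth_on\<close> made explicit, so that statements can refer
  to a fixed family of iterated partial derivatives.\<close>

definition lc_jet :: "'v::real_vector lcs \<Rightarrow> (real ^ 'n::finite) set \<Rightarrow> ('n list \<Rightarrow> real ^ 'n \<Rightarrow> 'v) \<Rightarrow> bool" where
  "lc_jet E S D \<longleftrightarrow> (\<forall>is. \<forall>y\<in>S. D is y \<in> pts E \<and> lc_partials E (D is) (\<lambda>i. D (i # is) y) y)"

lemma lc_jetD:
  assumes "lc_jet E S D" "y \<in> S"
  shows "D is y \<in> pts E" "lc_partials E (D is) (\<lambda>i. D (i # is) y) y"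
  using assms by (auto simp: lc_jet_def)

lemma lc_smooth_on_alt: "lc_smooth_on E S g \<longleftrightarrow> (\<exists>D. (\<forall>y\<in>S. D [] y = g y) \<and> lc_jet E S D)"
  by (simp add: lc_smooth_on_def lc_jet_def lc_partials_def)

lemma eventually_translate_in:
  fixes y :: "'e::real_normed_vector"
  assumes "open S" "y \<in> S"
  shows "\<forall>\<^sub>F h in at 0. y + h \<in> S"
proof -
  have "((\<lambda>h. y + h) \<longlongrightarrow> y + 0) (at 0)" by (intro tendsto_intros)
  from topological_tendstoD[OF this assms(1)] show ?thesis using assms(2) by simp
qed

lemma lc_partials_add:
  assumes E: "lcs E" and S: "open S" "y \<in> S"
    and f: "\<And>z. z \<in> S \<Longrightarrow> f z \<in> pts E" "\<And>i. F i \<in> pts E" "lc_partials E f F y"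
    and g: "\<And>z. z \<in> S \<Longrightarrow> g z \<in> pts E" "\<And>i. G i \<in> pts E" "lc_partials E g G y"
  shows "lc_partials E (\<lambda>z. f z + g z) (\<lambda>i. F i + G i) y"
  unfolding lc_partials_def lc_tendsto_def
proof
  fix p assume p: "p \<in> seminorms E"
  have sub: "subspace (pts E)" and sn: "seminorm_on (pts E) p" using E p by (auto simp: lcs_def)
  let ?R = "\<lambda>f F h. (f (y + h) - f y - (\<Sum>i\<in>UNIV. (h $ i) *\<^sub>R F i)) /\<^sub>R norm h"
  \<comment> \<open>Seminorms are controlled on \<open>pts E\<close> only, so the estimate is
    confined to those \<open>h\<close> for which \<open>y + h\<close> lies in \<open>S\<close>; this
    is eventually the case.\<close>
  have in_pts: "?R f F h \<in> pts E" if "y + h \<in> S" "\<And>z. z \<in> S \<Longrightarrow> f z \<in> pts E" "\<And>i. F i \<in> pts E" for f F h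
    using that S by (intro subspace_scale[OF sub] subspace_diff[OF sub] subspace_sum[OF sub]) auto
  have lim: "((\<lambda>h. p (?R f F h) + p (?R g G h)) \<longlongrightarrow> 0 + 0) (at 0)"
    using f(3) g(3) p by (intro tendsto_add) (auto simp: lc_partials_def lc_tendsto_def)
  have bound: "0 \<le> p (?R (\<lambda>z. f z + g z) (\<lambda>i. F i + G i) h) \<and>
      p (?R (\<lambda>z. f z + g z) (\<lambda>i. F i + G i) h) \<le> p (?R f F h) + p (?R g G h)" if h: "y + h \<in> S" for h
  proof -
    have eq: "?R (\<lambda>z. f z + g z) (\<lambda>i. F i + G i) h = ?R f F h + ?R g G h"
    proof -
      have "(\<Sum>i\<in>UNIV. (h $ i) *\<^sub>R (F i + G i)) = (\<Sum>i\<in>UNIV. (h $ i) *\<^sub>R F i) + (\<Sum>i\<in>UNIV. (h $ i) *\<^sub>R G i)"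
        by (simp add: scaleR_add_right sum.distrib)
      then show ?thesis
        by (simp add: scaleR_add_right scaleR_diff_right)
    qed
    have P: "?R f F h \<in> pts E" "?R g G h \<in> pts E"
      by (rule in_pts[OF h f(1,2)], assumption) (rule in_pts[OF h g(1,2)], assumption)
    show ?thesis
      unfolding eq
      by (intro conjI seminorm_onD(4)[OF sn sub] seminorm_onD(1)[OF sn sub] subspace_add[OF sub] P)
  qed
  show "((\<lambda>h. p (?R (\<lambda>z. f z + g z) (\<lambda>i. F i + G i) h - 0)) \<longlongrightarrow> 0) (at 0)"
    unfolding diff_zero
    by (rule tendsto_sandwich[OF _ _ tendsto_const lim[unfolded add_0_left]])
      (use eventually_translate_in[OF S] in \<open>auto elim!: eventually_mono dest!: bound\<close>)
qed

lemma lc_partials_scaleR: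
  fixes a :: "real ^ 'n::finite \<Rightarrow> real"
  assumes E: "lcs E" and S: "open S" "y \<in> S" and a: "(a has_derivative a') (at y)"
    and g: "\<And>z. z \<in> S \<Longrightarrow> g z \<in> pts E" "\<And>i. G i \<in> pts E" "lc_partials E g G y"
  shows "lc_partials E (\<lambda>z. a z *\<^sub>R g z) (\<lambda>i. a' (axis i 1) *\<^sub>R g y + a y *\<^sub>R G i) y"
  unfolding lc_partials_def lc_tendsto_def
proof
  fix p assume p: "p \<in> seminorms E"
  have sub: "subspace (pts E)" and sn: "seminorm_on (pts E) p" using E p by (auto simp: lcs_def)
  note sn' = seminorm_onD[OF sn sub]
  define R where "R h = (g (y + h) - g y - (\<Sum>i\<in>UNIV. (h $ i) *\<^sub>R G i)) /\<^sub>R norm h" for h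
  define Q where "Q h = (a (y + h) *\<^sub>R g (y + h) - a y *\<^sub>R g y -
    (\<Sum>i\<in>UNIV. (h $ i) *\<^sub>R (a' (axis i 1) *\<^sub>R g y + a y *\<^sub>R G i))) /\<^sub>R norm h" for h
  define e where "e h = (a (y + h) - a y - a' h) / norm h" for h
  \<comment> \<open>The bound comes from splitting \<open>Q h\<close> into \<open>a (y + h)\<close>
    times the remainder of \<open>g\<close>, the increment of \<open>a\<close> times the partial
    derivatives \<open>G i\<close>, and the remainder of \<open>a\<close> times
    \<open>g y\<close>.\<close>
  define B where "B h = (\<bar>a (y + h)\<bar> * p (R h) + \<bar>a (y + h) - a y\<bar> * (\<Sum>i\<in>UNIV. p (G i))) + \<bar>e h\<bar> * p (g y)" for h
  have ac: "((\<lambda>h. a (y + h)) \<longlongrightarrow> a y) (at 0)"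
    using has_derivative_continuous[OF a] by (simp add: isCont_def LIM_offset_zero_iff)
  have "(e \<longlongrightarrow> 0) (at 0)"
    using a unfolding has_derivative_at e_def
    by (intro tendsto_norm_zero_cancel[of "\<lambda>h. (a (y + h) - a y - a' h) / norm h"]) simp
  moreover have "((\<lambda>h. p (R h)) \<longlongrightarrow> 0) (at 0)"
    using g(3) p by (simp add: lc_partials_def lc_tendsto_def R_def)
  ultimately have "(B \<longlongrightarrow> (\<bar>a y\<bar> * 0 + \<bar>a y - a y\<bar> * (\<Sum>i\<in>UNIV. p (G i))) + \<bar>0\<bar> * p (g y)) (at 0)"
    unfolding B_def by (intro tendsto_intros ac)
  then have lim: "(B \<longlongrightarrow> 0) (at 0)" by simp
  have bound: "0 \<le> p (Q h) \<and> p (Q h) \<le> B h" if h: "y + h \<in> S" "h \<noteq> 0" for h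
  proof -
    have Rp: "R h \<in> pts E" unfolding R_def
      using h g S by (intro subspace_scale[OF sub] subspace_diff[OF sub] subspace_sum[OF sub]) auto
    define s where "s i = ((a (y + h) - a y) * (h $ i) / norm h) *\<^sub>R G i" for i
    have sp: "s i \<in> pts E" for i unfolding s_def by (intro subspace_scale[OF sub] g)
    have ssum: "(\<Sum>i\<in>UNIV. s i) \<in> pts E" by (intro subspace_sum[OF sub] sp)
    have gy: "g y \<in> pts E" using g S by auto
    have a'h: "a' h = (\<Sum>i\<in>UNIV. h $ i * a' (axis i 1))"
      using linear_axis_sum[OF has_derivative_linear[OF a], of h] by simp
    have eh: "e h *\<^sub>R g y = (a (y + h) *\<^sub>R g y - a y *\<^sub>R g y - (\<Sum>i\<in>UNIV. (h $ i) *\<^sub>R a' (axis i 1) *\<^sub>R g y)) /\<^sub>R norm h"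
      by (simp add: e_def a'h scaleR_diff_left[symmetric] scaleR_sum_left[symmetric] divide_inverse mult.commute)
    have sh: "(\<Sum>i\<in>UNIV. s i) = ((a (y + h) - a y) *\<^sub>R (\<Sum>i\<in>UNIV. (h $ i) *\<^sub>R G i)) /\<^sub>R norm h"
      by (simp add: s_def scaleR_sum_right divide_inverse mult.commute mult.left_commute)
    have Qh: "Q h = (a (y + h) *\<^sub>R R h + (\<Sum>i\<in>UNIV. s i)) + e h *\<^sub>R g y"
      unfolding eh sh unfolding Q_def R_def
      by (simp add: scaleR_left_commute[of "a (y + h)" "inverse (norm h)"] flip: scaleR_add_right)
         (simp add: algebra_simps sum.distrib scaleR_sum_right sum_subtractf)
    then have "p (Q h) \<le> (p (a (y + h) *\<^sub>R R h) + p (\<Sum>i\<in>UNIV. s i)) + p (e h *\<^sub>R g y)"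
      using sn'(1)[of "a (y + h) *\<^sub>R R h" "\<Sum>i\<in>UNIV. s i"]
        sn'(1)[of "a (y + h) *\<^sub>R R h + (\<Sum>i\<in>UNIV. s i)" "e h *\<^sub>R g y"]
        subspace_scale[OF sub Rp] subspace_scale[OF sub gy] ssum subspace_add[OF sub] by force
    moreover have "p (\<Sum>i\<in>UNIV. s i) \<le> \<bar>a (y + h) - a y\<bar> * (\<Sum>i\<in>UNIV. p (G i))"
    proof -
      have "p (s i) \<le> \<bar>a (y + h) - a y\<bar> * p (G i)" for i
      proof -
        have "\<bar>h $ i\<bar> / norm h \<le> 1"
          using component_le_norm_cart[of h i] h by (simp add: divide_le_eq_1)
        then have "\<bar>a (y + h) - a y\<bar> * (\<bar>h $ i\<bar> / norm h) * p (G i) \<le> \<bar>a (y + h) - a y\<bar> * 1 * p (G i)"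
          using sn'(4)[OF g(2)] by (intro mult_right_mono mult_left_mono) auto
        then show ?thesis
          by (simp add: s_def sn'(2)[OF g(2)] abs_mult)
      qed
      then have "(\<Sum>i\<in>UNIV. p (s i)) \<le> \<bar>a (y + h) - a y\<bar> * (\<Sum>i\<in>UNIV. p (G i))"
        unfolding sum_distrib_left by (intro sum_mono)
      then show ?thesis
        using seminorm_on_sum[OF sn sub, of UNIV s] sp by force
    qed
    ultimately have "p (Q h) \<le> B h"
      by (simp add: B_def sn'(2)[OF Rp] sn'(2)[OF gy])
    moreover have "Q h \<in> pts E"
      unfolding Qh by (intro subspace_add[OF sub] subspace_scale[OF sub] Rp ssum gy)
    ultimately show ?thesis using sn'(4) by blast
  qed
  have "\<forall>\<^sub>F h in at 0. y + h \<in> S \<and> h \<noteq> 0"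
    using eventually_translate_in[OF S] eventually_neq_at_within[of 0 0 UNIV] by (rule eventually_conj)
  then have "\<forall>\<^sub>F h in at 0. 0 \<le> p (Q h) \<and> p (Q h) \<le> B h"
    by (rule eventually_mono) (use bound in blast)
  then have "((\<lambda>h. p (Q h)) \<longlongrightarrow> 0) (at 0)"
    by (intro tendsto_sandwich[OF _ _ tendsto_const lim]) (auto elim: eventually_mono)
  then show "((\<lambda>h. p ((a (y + h) *\<^sub>R g (y + h) - a y *\<^sub>R g y -
    (\<Sum>i\<in>UNIV. (h $ i) *\<^sub>R (a' (axis i 1) *\<^sub>R g y + a y *\<^sub>R G i))) /\<^sub>R norm h - 0)) \<longlongrightarrow> 0) (at 0)"
    by (simp add: Q_def)
qed

text \<open>Choice fixes one partial derivative for each function with property \<open>P\<close> and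
  each index; since these have property \<open>P\<close> again, following an index list yields the
  entire family that \<open>lc_smooth_on\<close> asks for.\<close>

lemma lc_smooth_on_coinduct:
  assumes "P g" and step: "\<And>f. P f \<Longrightarrow> (\<forall>y\<in>S. f y \<in> pts E) \<and>
    (\<exists>F. (\<forall>i. P (F i)) \<and> (\<forall>y\<in>S. lc_partials E f (\<lambda>i. F i y) y))"
  shows "lc_smooth_on E S g"
proof -
  from step obtain part where part: "\<And>f i. P f \<Longrightarrow> P (part f i)"
    "\<And>f y. P f \<Longrightarrow> y \<in> S \<Longrightarrow> lc_partials E f (\<lambda>i. part f i y) y" by metis
  define D where "D is = foldr (\<lambda>i f. part f i) is g" for "is"
  have P: "P (D is)" for "is"
    by (induction "is") (auto simp: D_def assms(1) part(1))
  have "D [] = g" "D (i # is) = part (D is) i" for i "is"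
    by (simp_all add: D_def)
  then show ?thesis
    unfolding lc_smooth_on_alt lc_jet_def using P step part(2) by (intro exI[of _ D]) auto
qed

text \<open>The span of the partial derivatives over smooth scalar functions is closed under partial derivatives.\<close>

inductive smooth_span for S :: "(real ^ 'n::finite) set" and D :: "'n list \<Rightarrow> real ^ 'n \<Rightarrow> 'v::real_vector" where
  scaled: "smooth_on S a \<Longrightarrow> smooth_span S D (\<lambda>y. a y *\<^sub>R D is y)"
| add: "smooth_span S D f \<Longrightarrow> smooth_span S D g \<Longrightarrow> smooth_span S D (\<lambda>y. f y + g y)"

lemma smooth_span_sum:
  assumes "finite I" "\<And>i. i \<in> I \<Longrightarrow> smooth_span S D (f i)"
  shows "smooth_span S D (\<lambda>y. \<Sum>i\<in>I. f i y)"
  using assms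
proof (induction I)
  case empty
  have "smooth_span S D (\<lambda>y. 0 *\<^sub>R D [] y)" by (rule scaled) (rule smooth_on_const)
  then show ?case by simp
next
  case (insert i I)
  then show ?case using add[of S D "f i" "\<lambda>y. \<Sum>i\<in>I. f i y"] by simp
qed

text \<open>By the product rule the partial derivatives of \<open>a y *\<^sub>R D is y\<close> lie
  in the span again, so \<open>smooth_span S D\<close> is an invariant for the coinduction. The
  purpose is \<open>lie_par\<close>, which in a chart is a combination of first partial derivatives
  with the components of a vector field as coefficients.\<close>

lemma lc_smooth_on_span:
  assumes E: "lcs E" and S: "open S"
    and D: "lc_jet E S D"
    and g: "smooth_span S D g"
  shows "lc_smooth_on E S g"
  using g
proof (rule lc_smooth_on_coinduct)
  have sub: "subspace (pts E)" using E by (simp add: lcs_def)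
  fix f assume "smooth_span S D f"
  then show "(\<forall>y\<in>S. f y \<in> pts E) \<and> (\<exists>F. (\<forall>i. smooth_span S D (F i)) \<and> (\<forall>y\<in>S. lc_partials E f (\<lambda>i. F i y) y))"
  proof induction
    case (scaled a "is")
    define F where "F i y = frechet_derivative a (at y) (axis i 1) *\<^sub>R D is y + a y *\<^sub>R D (i # is) y" for i y
    have "smooth_span S D (F i)" for i
      unfolding F_def by (intro smooth_span.intros smooth_on_deriv scaled)
    moreover have "lc_partials E (\<lambda>y. a y *\<^sub>R D is y) (\<lambda>i. F i y) y" if "y \<in> S" for y
      unfolding F_def using that
      by (intro lc_partials_scaleR[OF E S] smooth_on_imp_has_derivative[OF scaled] lc_jetD[OF D]) auto
    moreover have "\<forall>y\<in>S. a y *\<^sub>R D is y \<in> pts E"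
      by (auto intro: subspace_scale[OF sub] lc_jetD(1)[OF D])
    ultimately show ?case by blast
  next
    case (add f g)
    then obtain F G where F: "\<forall>i. smooth_span S D (F i)" "\<forall>y\<in>S. lc_partials E f (\<lambda>i. F i y) y"
      and G: "\<forall>i. smooth_span S D (G i)" "\<forall>y\<in>S. lc_partials E g (\<lambda>i. G i y) y" by blast
    have pts: "h y \<in> pts E" if "smooth_span S D h" "y \<in> S" for h y
      using that by induction (auto intro: subspace_scale[OF sub] subspace_add[OF sub] lc_jetD(1)[OF D])
    have "\<forall>i. smooth_span S D (\<lambda>y. F i y + G i y)"
      using F G by (auto intro: smooth_span.intros)
    moreover have "\<forall>y\<in>S. lc_partials E (\<lambda>y. f y + g y) (\<lambda>i. F i y + G i y) y"
      using F G add pts by (intro ballI lc_partials_add[OF E S]) blast+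
    moreover have "\<forall>y\<in>S. f y + g y \<in> pts E"
      using add by (auto intro: subspace_add[OF sub])
    ultimately show ?case by (intro conjI exI[of _ "\<lambda>i y. F i y + G i y"])
  qed
qed

lemma lc_smooth_on_add:
  assumes E: "lcs E" and S: "open S" and "lc_smooth_on E S f" "lc_smooth_on E S g"
  shows "lc_smooth_on E S (\<lambda>y. f y + g y)"
proof -
  have sub: "subspace (pts E)" using E by (simp add: lcs_def)
  from assms obtain D D' where D: "\<forall>y\<in>S. D [] y = f y" "lc_jet E S D"
    and D': "\<forall>y\<in>S. D' [] y = g y" "lc_jet E S D'"
    unfolding lc_smooth_on_alt by blast
  have "lc_jet E S (\<lambda>is y. D is y + D' is y)"
    unfolding lc_jet_def
    by (intro allI ballI conjI subspace_add[OF sub] lc_partials_add[OF E S] lc_jetD[OF D(2)] lc_jetD[OF D'(2)])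
  then show ?thesis
    unfolding lc_smooth_on_alt using D(1) D'(1) by (intro exI[of _ "\<lambda>is y. D is y + D' is y"]) simp
qed

lemma lc_smooth_on_scaleR:
  assumes E: "lcs E" and S: "open S" and "lc_smooth_on E S f"
  shows "lc_smooth_on E S (\<lambda>y. r *\<^sub>R f y)"
proof -
  from assms obtain D where D: "\<forall>y\<in>S. D [] y = f y" "lc_jet E S D"
    unfolding lc_smooth_on_alt by blast
  have "lc_smooth_on E S (\<lambda>y. r *\<^sub>R D [] y)"
    using D by (intro lc_smooth_on_span[OF E S _ scaled[OF smooth_on_const]]) auto
  then show ?thesis
    unfolding lc_smooth_on_alt using D(1) by simp
qed

lemma lc_smooth_on_eqI:
  "lc_smooth_on E S f \<Longrightarrow> (\<And>y. y \<in> S \<Longrightarrow> f y = g y) \<Longrightarrow> lc_smooth_on E S g"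
  unfolding lc_smooth_on_alt by simp

text \<open>Links two notions of derivative: \<open>lc_smooth_on\<close> has a total derivative in
  the chart, \<open>lie_par\<close> a derivative along a line.\<close>

lemma lc_partials_direction:
  assumes E: "lcs E" and S: "open S" "y \<in> S"
    and g: "\<And>z. z \<in> S \<Longrightarrow> g z \<in> pts E" "\<And>i. G i \<in> pts E" "lc_partials E g G y"
  shows "lc_tendsto E (\<lambda>t. (g (y + t *\<^sub>R v) - g y) /\<^sub>R t) (\<Sum>i\<in>UNIV. v $ i *\<^sub>R G i) (at 0)"
  unfolding lc_tendsto_def
proof
  fix p assume p: "p \<in> seminorms E"
  have sub: "subspace (pts E)" and sn: "seminorm_on (pts E) p" using E p by (auto simp: lcs_def)
  note sn' = seminorm_onD[OF sn sub]
  define R where "R h = (g (y + h) - g y - (\<Sum>i\<in>UNIV. (h $ i) *\<^sub>R G i)) /\<^sub>R norm h" for h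
  show "((\<lambda>t. p ((g (y + t *\<^sub>R v) - g y) /\<^sub>R t - (\<Sum>i\<in>UNIV. v $ i *\<^sub>R G i))) \<longlongrightarrow> 0) (at 0)"
  \<comment> \<open>The substitution \<open>h = t *\<^sub>R v\<close> requires \<open>h\<close> to
    be nonzero, so \<open>v = 0\<close> is treated apart.\<close>
  proof (cases "v = 0")
    case True
    then show ?thesis by (simp add: sn'(3))
  next
    case False
    have tv: "((\<lambda>t. t *\<^sub>R v) \<longlongrightarrow> 0) (at 0)"
      using tendsto_scaleR[OF tendsto_ident_at[of 0 UNIV] tendsto_const[of v]] by simp
    have fl: "filterlim (\<lambda>t. t *\<^sub>R v) (at 0) (at 0)"
      using tv False by (auto simp: filterlim_at eventually_at_filter)
    have "((\<lambda>h. p (R h)) \<longlongrightarrow> 0) (at 0)"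
      using g(3) p by (simp add: lc_partials_def lc_tendsto_def R_def)
    from tendsto_mult[OF tendsto_const[of "norm v"] filterlim_compose[OF this fl]]
    have lim: "((\<lambda>t. norm v * p (R (t *\<^sub>R v))) \<longlongrightarrow> 0) (at 0)" by simp
    have "\<forall>\<^sub>F t in at 0. y + t *\<^sub>R v \<in> S"
      using filterlim_iff[THEN iffD1, OF fl] eventually_translate_in[OF S] by blast
    moreover have "\<forall>\<^sub>F t::real in at 0. t \<noteq> 0" by (rule eventually_neq_at_within)
    ultimately have "\<forall>\<^sub>F t in at 0. norm v * p (R (t *\<^sub>R v)) = p ((g (y + t *\<^sub>R v) - g y) /\<^sub>R t - (\<Sum>i\<in>UNIV. v $ i *\<^sub>R G i))"
    proof eventually_elim
      case (elim t)
      have R: "R (t *\<^sub>R v) \<in> pts E" unfolding R_def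
        using elim g S by (intro subspace_scale[OF sub] subspace_diff[OF sub] subspace_sum[OF sub]) auto
      have "(\<Sum>i\<in>UNIV. ((t *\<^sub>R v) $ i) *\<^sub>R G i) = t *\<^sub>R (\<Sum>i\<in>UNIV. v $ i *\<^sub>R G i)"
        by (simp add: scaleR_sum_right)
      then have "(norm (t *\<^sub>R v) / t) *\<^sub>R R (t *\<^sub>R v) = (g (y + t *\<^sub>R v) - g y) /\<^sub>R t - (\<Sum>i\<in>UNIV. v $ i *\<^sub>R G i)"
        using elim False by (simp add: R_def scaleR_diff_right field_simps)
      then have "p ((g (y + t *\<^sub>R v) - g y) /\<^sub>R t - (\<Sum>i\<in>UNIV. v $ i *\<^sub>R G i)) = \<bar>norm (t *\<^sub>R v) / t\<bar> * p (R (t *\<^sub>R v))"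
        using sn'(2)[OF R] by metis
      then show ?case using elim by (simp add: abs_mult)
    qed
    then show ?thesis by (rule Lim_transform_eventually[OF lim])
  qed
qed

text \<open>If the modulus of \<open>u\<close> is itself one of the seminorms, convergence in
  \<open>E\<close> gives convergence of the values of \<open>u\<close>. \<open>Omega_c A\<close> has
  all continuous seminorms, so every distribution qualifies.\<close>

lemma lc_partials_functional:
  fixes u :: "'v::real_vector \<Rightarrow> real"
  assumes E: "lcs E" and S: "open S" "y \<in> S"
    and u: "\<And>v w. v \<in> pts E \<Longrightarrow> w \<in> pts E \<Longrightarrow> u (v + w) = u v + u w" "\<And>r v. v \<in> pts E \<Longrightarrow> u (r *\<^sub>R v) = r * u v"
      "(\<lambda>v. \<bar>u v\<bar>) \<in> seminorms E"
    and g: "\<And>z. z \<in> S \<Longrightarrow> g z \<in> pts E" "\<And>i. G i \<in> pts E" "lc_partials E g G y"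
  shows "((\<lambda>y. u (g y)) has_derivative (\<lambda>h. \<Sum>i\<in>UNIV. h $ i * u (G i))) (at y)"
proof -
  have sub: "subspace (pts E)" using E by (simp add: lcs_def)
  have u0: "u 0 = 0" using u(2)[OF subspace_0[OF sub], of 0] by simp
  have diff: "u (v - w) = u v - u w" if "v \<in> pts E" "w \<in> pts E" for v w
    using u(1)[OF that(1) subspace_scale[OF sub that(2), of "-1"]] u(2)[OF that(2), of "-1"] by simp
  have usum: "u (\<Sum>i\<in>I. v i) = (\<Sum>i\<in>I. u (v i))" if "finite I" "\<And>i. i \<in> I \<Longrightarrow> v i \<in> pts E" for I :: "'b set" and v
    using that by (induction I) (auto simp: u0 u(1) subspace_sum[OF sub])
  have "((\<lambda>h. \<bar>u ((g (y + h) - g y - (\<Sum>i\<in>UNIV. (h $ i) *\<^sub>R G i)) /\<^sub>R norm h)\<bar>) \<longlongrightarrow> 0) (at 0)"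
    using bspec[OF g(3)[unfolded lc_partials_def lc_tendsto_def] u(3)] by simp
  moreover have "\<forall>\<^sub>F h in at 0. \<bar>u ((g (y + h) - g y - (\<Sum>i\<in>UNIV. (h $ i) *\<^sub>R G i)) /\<^sub>R norm h)\<bar> =
      norm (u (g (y + h)) - u (g y) - (\<Sum>i\<in>UNIV. h $ i * u (G i))) / norm h"
    using eventually_translate_in[OF S]
  proof eventually_elim
    case (elim h)
    have "u (g (y + h) - g y - (\<Sum>i\<in>UNIV. (h $ i) *\<^sub>R G i)) = u (g (y + h)) - u (g y) - (\<Sum>i\<in>UNIV. h $ i * u (G i))"
      using elim g S by (simp add: diff usum u(2) subspace_diff[OF sub] subspace_sum[OF sub] subspace_scale[OF sub])
    moreover have "g (y + h) - g y - (\<Sum>i\<in>UNIV. (h $ i) *\<^sub>R G i) \<in> pts E"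
      using elim g S by (intro subspace_diff[OF sub] subspace_sum[OF sub] subspace_scale[OF sub]) auto
    ultimately show ?case by (simp add: u(2) abs_mult divide_inverse mult.commute)
  qed
  ultimately have "((\<lambda>h. norm (u (g (y + h)) - u (g y) - (\<Sum>i\<in>UNIV. h $ i * u (G i))) / norm h) \<longlongrightarrow> 0) (at 0)"
    by (rule Lim_transform_eventually)
  moreover have "bounded_linear (\<lambda>h. \<Sum>i\<in>UNIV. h $ i * u (G i))"
    by (intro bounded_linear_sum bounded_linear_compose[OF bounded_linear_mult_left bounded_linear_vec_nth])
  ultimately show ?thesis by (simp add: has_derivative_at)
qed

section \<open>Distributions and smoothing kernels\<close>

context oriented_atlas
begin

lemma pts_Omega_c [simp]: "pts (Omega_c A) = cforms A"
  by (simp add: Omega_c_def)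

lemma subspace_cforms: "subspace (cforms A)"
  unfolding subspace_def using cforms_zero cforms_add cforms_scaleR by blast

lemma lcs_Omega_c: "lcs (Omega_c A)"
  by (simp add: lcs_def subspace_cforms) (simp add: Omega_c_def)

lemma distributionsD:
  assumes "u \<in> distributions A"
  shows "\<mu> \<in> cforms A \<Longrightarrow> \<nu> \<in> cforms A \<Longrightarrow> u (\<mu> + \<nu>) = u \<mu> + u \<nu>"
    "\<mu> \<in> cforms A \<Longrightarrow> u (r *\<^sub>R \<mu>) = r * u \<mu>"
    "(\<lambda>\<mu>. \<bar>u \<mu>\<bar>) \<in> seminorms (Omega_c A)"
  using assms unfolding distributions_def by blast+

lemma distribution_diff:
  assumes u: "u \<in> distributions A" and "\<mu> \<in> cforms A" "\<nu> \<in> cforms A"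
  shows "u (\<mu> - \<nu>) = u \<mu> - u \<nu>"
  using distributionsD(1)[OF u assms(2) cforms_scaleR[OF assms(3), of "- 1"]]
    distributionsD(2)[OF u assms(3), of "- 1"] by simp

lemma distribution_sum:
  assumes u: "u \<in> distributions A" and "finite I" "\<And>i. i \<in> I \<Longrightarrow> v i \<in> cforms A"
  shows "u (\<Sum>i\<in>I. v i) = (\<Sum>i\<in>I. u (v i))"
  using assms(2,3)
proof (induction I)
  case empty
  show ?case
    unfolding sum.empty using distributionsD(2)[OF u cforms_zero, of 0] by (simp only: scaleR_zero_left mult_zero_left)
next
  case (insert i I)
  have "u (v i + sum v I) = u (v i) + u (sum v I)"
    by (rule distributionsD(1)[OF u]) (use insert.prems in \<open>auto intro: subspace_sum[OF subspace_cforms]\<close>)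
  moreover have "u (sum v I) = (\<Sum>i\<in>I. u (v i))"
    by (rule insert.IH) (use insert.prems in blast)
  ultimately show ?case
    by (simp only: sum.insert[OF insert.hyps])
qed

lemma abs_linear_seminorm_on:
  assumes "\<And>\<mu> \<nu>. \<mu> \<in> cforms A \<Longrightarrow> \<nu> \<in> cforms A \<Longrightarrow> u (\<mu> + \<nu>) = u \<mu> + u \<nu>"
    "\<And>r \<mu>. \<mu> \<in> cforms A \<Longrightarrow> u (r *\<^sub>R \<mu>) = r * u \<mu>"
  shows "seminorm_on (cforms A) (\<lambda>\<mu>. \<bar>u \<mu>\<bar>)"
  using assms by (simp add: seminorm_on_def abs_mult abs_triangle_ineq)

lemma distributionsI:
  assumes "\<And>\<mu> \<nu>. \<mu> \<in> cforms A \<Longrightarrow> \<nu> \<in> cforms A \<Longrightarrow> u (\<mu> + \<nu>) = u \<mu> + u \<nu>"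
    "\<And>r \<mu>. \<mu> \<in> cforms A \<Longrightarrow> u (r *\<^sub>R \<mu>) = r * u \<mu>"
    "\<And>K. compact K \<Longrightarrow> \<exists>Q C. finite Q \<and> Q \<subseteq> form_seminorms A \<and> (\<forall>\<mu>\<in>forms_in A K. \<bar>u \<mu>\<bar> \<le> C * (\<Sum>q\<in>Q. q \<mu>))"
  shows "u \<in> distributions A"
  unfolding distributions_def Omega_c_def
  using assms abs_linear_seminorm_on[of u, OF assms(1,2)] by simp

text \<open>Bounded by the seminorm with \<open>L = {x}\<close> and no Lie derivatives. These
  functionals are the reason why distributions separate forms.\<close>

lemma point_evaluation_distribution:
  assumes "c \<in> A" "x \<in> cdom c"
  shows "(\<lambda>\<mu>. \<mu> x c) \<in> distributions A"
proof (rule distributionsI)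
  let ?q = "\<lambda>\<mu>. SUP z\<in>{x}. \<bar>foldr (lie_form A) [] \<mu> z c\<bar>"
  have "?q \<in> form_seminorms A"
    unfolding form_seminorms_def
    by (rule CollectI, intro exI[of _ "{x}"] exI[of _ c] exI[of _ "[]"]) (use assms in simp)
  then show "\<exists>Q C. finite Q \<and> Q \<subseteq> form_seminorms A \<and> (\<forall>\<mu>\<in>forms_in A K. \<bar>\<mu> x c\<bar> \<le> C * (\<Sum>q\<in>Q. q \<mu>))" for K
    by (intro exI[of _ "{?q}"] exI[of _ 1]) auto
qed (simp_all add: scaleR_fun_def)

lemma forms_lie_forms: "\<mu> \<in> forms A \<Longrightarrow> set Xs \<subseteq> vfields A \<Longrightarrow> foldr (lie_form A) Xs \<mu> \<in> forms A"
  by (induction Xs) (auto intro: forms_lie_form)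

text \<open>A real \<open>SUP\<close> is an upper bound only for sets bounded above, whence the
  appeal to continuity of the coefficient on the compact set \<open>L\<close>.\<close>

lemma form_seminorm_nonneg:
  assumes "q \<in> form_seminorms A" "\<mu> \<in> forms A"
  shows "0 \<le> q \<mu>"
proof -
  obtain L c Xs where q: "q = (\<lambda>\<mu>. SUP x\<in>L. \<bar>foldr (lie_form A) Xs \<mu> x c\<bar>)"
    and L: "c \<in> A" "compact L" "L \<noteq> {}" "L \<subseteq> cdom c" "set Xs \<subseteq> vfields A"
    using assms(1) unfolding form_seminorms_def by blast
  let ?\<nu> = "foldr (lie_form A) Xs \<mu>"
  have "continuous_on (cdom c) (\<lambda>x. ?\<nu> (cinv c (cmap c x)) c)"
    by (rule continuous_on_compose2[OF smooth_on_imp_continuous_on[OF formsD(3)[OF forms_lie_forms[OF assms(2) L(5)] L(1)]]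
        continuous_on_cmap[OF L(1)]]) (use cmap_in_cimg[of _ c] in blast)
  then have "continuous_on L (\<lambda>x. ?\<nu> (cinv c (cmap c x)) c)"
    by (rule continuous_on_subset[OF _ L(4)])
  then have "continuous_on L (\<lambda>x. \<bar>?\<nu> x c\<bar>)"
    by (intro continuous_on_rabs) (rule continuous_on_eq, assumption, use L(4) cinv_cmap[OF L(1)] in auto)
  then have bdd: "bdd_above ((\<lambda>x. \<bar>?\<nu> x c\<bar>) ` L)"
    using L(2) by (intro bounded_imp_bdd_above compact_imp_bounded compact_continuous_image)
  obtain x where "x \<in> L" using L(3) by blast
  from order_trans[OF abs_ge_zero cSUP_upper[OF this bdd]] show ?thesis by (simp add: q)
qed

text \<open>\<open>foldr\<close> applies the last field of the list to the form itself, so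
  \<open>X\<close> is appended at the end.\<close>

lemma form_seminorm_lie_form:
  assumes "q \<in> form_seminorms A" "X \<in> vfields A"
  shows "(\<lambda>\<mu>. q (lie_form A X \<mu>)) \<in> form_seminorms A"
proof -
  obtain L c Xs where q: "q = (\<lambda>\<mu>. SUP x\<in>L. \<bar>foldr (lie_form A) Xs \<mu> x c\<bar>)"
    and L: "c \<in> A" "compact L" "L \<noteq> {}" "L \<subseteq> cdom c" "set Xs \<subseteq> vfields A"
    using assms(1) unfolding form_seminorms_def by blast
  show ?thesis
    unfolding form_seminorms_def
    by (rule CollectI, intro exI[of _ L] exI[of _ c] exI[of _ "Xs @ [X]"]) (use L assms(2) in \<open>simp add: q\<close>)
qed

lemma lie_dist_distribution:
  assumes T: "T \<in> distributions A" and X: "X \<in> vfields A"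
  shows "lie_dist A X T \<in> distributions A"
proof (rule distributionsI)
  show "lie_dist A X T (\<mu> + \<nu>) = lie_dist A X T \<mu> + lie_dist A X T \<nu>" if "\<mu> \<in> cforms A" "\<nu> \<in> cforms A" for \<mu> \<nu>
    using distributionsD(1)[OF T cforms_lie_form[OF that(1) X] cforms_lie_form[OF that(2) X]]
    by (simp add: lie_dist_def lie_form_add[OF cformsD(1)[OF that(1)] cformsD(1)[OF that(2)]])
  show "lie_dist A X T (r *\<^sub>R \<mu>) = r * lie_dist A X T \<mu>" if "\<mu> \<in> cforms A" for r \<mu>
    using distributionsD(2)[OF T cforms_lie_form[OF that X]]
    by (simp add: lie_dist_def lie_form_scaleR[OF cformsD(1)[OF that]])
  fix K :: "'a set" assume "compact K"
  then obtain Q C where Q: "finite Q" "Q \<subseteq> form_seminorms A" "\<And>\<mu>. \<mu> \<in> forms_in A K \<Longrightarrow> \<bar>T \<mu>\<bar> \<le> C * (\<Sum>q\<in>Q. q \<mu>)"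
    using distributionsD(3)[OF T] unfolding Omega_c_def by auto metis
  let ?L = "\<lambda>q \<mu>. q (lie_form A X \<mu>)"
  \<comment> \<open>Distinct seminorms may coincide after composition with
    \<open>lie_form A X\<close>, so the sum over the image can have fewer terms; bounding each term
    by the whole sum costs the factor \<open>card Q\<close>.\<close>
  have "\<bar>lie_dist A X T \<mu>\<bar> \<le> (\<bar>C\<bar> * card Q) * (\<Sum>q\<in>?L ` Q. q \<mu>)" if \<mu>: "\<mu> \<in> forms_in A K" for \<mu>
  proof -
    have f: "\<mu> \<in> forms A" using \<mu> by (simp add: forms_in_def)
    have nonneg: "0 \<le> q (lie_form A X \<mu>)" if "q \<in> Q" for q
      using form_seminorm_nonneg[OF _ forms_lie_form[OF f X]] Q(2) that by blast
    have "lie_form A X \<mu> \<in> forms_in A K"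
      using \<mu> forms_lie_form[OF f X] supp_lie_form[of X \<mu>] by (auto simp: forms_in_def)
    from Q(3)[OF this] have "\<bar>lie_dist A X T \<mu>\<bar> \<le> C * (\<Sum>q\<in>Q. q (lie_form A X \<mu>))"
      by (simp add: lie_dist_def)
    also have "\<dots> \<le> \<bar>C\<bar> * (\<Sum>q\<in>Q. q (lie_form A X \<mu>))"
      using nonneg by (intro mult_right_mono sum_nonneg) auto
    also have "(\<Sum>q\<in>Q. q (lie_form A X \<mu>)) \<le> (\<Sum>q\<in>Q. \<Sum>q'\<in>?L ` Q. q' \<mu>)"
    proof (rule sum_mono)
      fix q assume "q \<in> Q"
      have "?L q \<mu> \<le> (\<Sum>q'\<in>?L ` Q. q' \<mu>)"
        by (rule member_le_sum[of "?L q" "?L ` Q" "\<lambda>q'. q' \<mu>"]) (use Q(1) \<open>q \<in> Q\<close> nonneg in auto)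
      then show "q (lie_form A X \<mu>) \<le> (\<Sum>q'\<in>?L ` Q. q' \<mu>)" .
    qed
    finally show ?thesis by (simp add: mult_left_mono mult.assoc)
  qed
  moreover have "?L ` Q \<subseteq> form_seminorms A"
    using Q(2) form_seminorm_lie_form[OF _ X] by blast
  ultimately show "\<exists>Q C. finite Q \<and> Q \<subseteq> form_seminorms A \<and> (\<forall>\<mu>\<in>forms_in A K. \<bar>lie_dist A X T \<mu>\<bar> \<le> C * (\<Sum>q\<in>Q. q \<mu>))"
    using Q(1) by (intro exI[of _ "?L ` Q"] exI[of _ "\<bar>C\<bar> * card Q"]) blast
qed

lemma distributions_separate:
  assumes "\<mu> \<in> cforms A" "\<nu> \<in> cforms A" "\<And>u. u \<in> distributions A \<Longrightarrow> u \<mu> = u \<nu>"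
  shows "\<mu> = \<nu>"
proof (intro ext)
  fix x c
  show "\<mu> x c = \<nu> x c"
  proof (cases "c \<in> A \<and> x \<in> cdom c")
    case True
    then show ?thesis using assms(3)[OF point_evaluation_distribution] by blast
  next
    case False
    then show ?thesis
      using formsD(1)[OF cformsD(1)[OF assms(1)]] formsD(1)[OF cformsD(1)[OF assms(2)]] by metis
  qed
qed

text \<open>Two derivatives have the same value under every distribution, being limits of the same
  real quotients, and distributions separate forms. This resolves the \<open>THE\<close> in
  \<open>lc_deriv\<close>.\<close>

lemma lc_deriv_Omega_c:
  assumes \<gamma>: "\<And>t. \<gamma> t \<in> cforms A" and l: "lc_has_deriv (Omega_c A) \<gamma> l t"
  shows "lc_deriv (Omega_c A) \<gamma> t = l"
  unfolding lc_deriv_def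
proof (rule the_equality)
  show "lc_has_deriv (Omega_c A) \<gamma> l t" by (rule l)
  have lim: "((\<lambda>h. u ((\<gamma> (t + h) - \<gamma> t) /\<^sub>R h)) \<longlongrightarrow> u k) (at 0)"
    if k: "lc_has_deriv (Omega_c A) \<gamma> k t" and u: "u \<in> distributions A" for k u
  proof -
    have kp: "k \<in> cforms A" using k by (simp add: lc_has_deriv_def)
    have "((\<lambda>h. \<bar>u ((\<gamma> (t + h) - \<gamma> t) /\<^sub>R h - k)\<bar>) \<longlongrightarrow> 0) (at 0)"
      using k distributionsD(3)[OF u] by (auto simp: lc_has_deriv_def lc_tendsto_def)
    moreover have "u ((\<gamma> (t + h) - \<gamma> t) /\<^sub>R h - k) = u ((\<gamma> (t + h) - \<gamma> t) /\<^sub>R h) - u k" for h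
      by (intro distribution_diff u kp cforms_scaleR subspace_diff[OF subspace_cforms] \<gamma>)
    ultimately show ?thesis
      by (simp add: tendsto_rabs_zero_iff LIM_zero_iff)
  qed
  fix k assume k: "lc_has_deriv (Omega_c A) \<gamma> k t"
  show "k = l"
  proof (rule distributions_separate)
    show "k \<in> cforms A" "l \<in> cforms A" using k l by (auto simp: lc_has_deriv_def)
    fix u assume "u \<in> distributions A"
    from tendsto_unique[OF _ lim[OF k this] lim[OF l this]] show "u k = u l" by simp
  qed
qed

section \<open>Smoothing kernels and their parameter derivatives\<close>

lemma jet_cforms: "lc_jet (Omega_c A) S D \<Longrightarrow> y \<in> S \<Longrightarrow> D is y \<in> cforms A"
  using lc_jetD(1) by fastforce

lemma SK_chart:
  assumes "\<omega> \<in> pts (SK A)" "c \<in> A"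
  obtains D where "\<And>y. y \<in> cimg c \<Longrightarrow> D [] y = \<omega> (cinv c y)" "lc_jet (Omega_c A) (cimg c) D"
proof -
  have "lc_smooth_on (Omega_c A) (cimg c) (\<omega> \<circ> cinv c)"
    using assms by (simp add: SK_def)
  then show thesis
    unfolding lc_smooth_on_alt using that by auto
qed

lemma SK_cforms:
  assumes "\<omega> \<in> pts (SK A)"
  shows "\<omega> x \<in> cforms A"
proof -
  let ?c = "chart_at A x"
  obtain D where D: "\<And>y. y \<in> cimg ?c \<Longrightarrow> D [] y = \<omega> (cinv ?c y)" "lc_jet (Omega_c A) (cimg ?c) D"
    by (rule SK_chart[OF assms chart_at(1)[of x]]) (rule that)
  from jet_cforms[OF D(2) cmap_in_cimg[OF chart_at(2)], of "[]"]
  have "\<omega> (cinv ?c (cmap ?c x)) \<in> cforms A"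
    unfolding D(1)[OF cmap_in_cimg[OF chart_at(2)]] .
  then show ?thesis by (simp add: cinv_cmap[OF chart_at])
qed

lemma SK_I: "(\<And>c. c \<in> A \<Longrightarrow> lc_smooth_on (Omega_c A) (cimg c) (\<lambda>y. \<omega> (cinv c y))) \<Longrightarrow> \<omega> \<in> pts (SK A)"
  by (simp add: SK_def o_def)

lemma SK_D: "\<omega> \<in> pts (SK A) \<Longrightarrow> c \<in> A \<Longrightarrow> lc_smooth_on (Omega_c A) (cimg c) (\<lambda>y. \<omega> (cinv c y))"
  by (simp add: SK_def o_def)

lemma SK_add: "\<omega> \<in> pts (SK A) \<Longrightarrow> \<eta> \<in> pts (SK A) \<Longrightarrow> \<omega> + \<eta> \<in> pts (SK A)"
  by (rule SK_I) (simp add: lc_smooth_on_add[OF lcs_Omega_c open_cimg] SK_D)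

lemma SK_scaleR: "\<omega> \<in> pts (SK A) \<Longrightarrow> r *\<^sub>R \<omega> \<in> pts (SK A)"
  by (rule SK_I) (simp add: lc_smooth_on_scaleR[OF lcs_Omega_c open_cimg] SK_D scaleR_fun_def[of r \<omega>])

lemma SK_diff: "\<omega> \<in> pts (SK A) \<Longrightarrow> \<eta> \<in> pts (SK A) \<Longrightarrow> \<omega> - \<eta> \<in> pts (SK A)"
  using SK_add[of \<omega> "(- 1) *\<^sub>R \<eta>"] SK_scaleR[of \<eta> "- 1"] by simp

lemma distribution_has_derivative:
  assumes u: "u \<in> distributions A" and c: "c \<in> A" "y \<in> cimg c"
    and D: "lc_jet (Omega_c A) (cimg c) D"
  shows "((\<lambda>y. u (D is y)) has_derivative (\<lambda>h. \<Sum>i\<in>UNIV. h $ i * u (D (i # is) y))) (at y)"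
  by (rule lc_partials_functional[where g="D is" and u=u and E="Omega_c A", unfolded pts_Omega_c,
    OF lcs_Omega_c open_cimg[OF c(1)] c(2) distributionsD[OF u] jet_cforms[OF D] jet_cforms[OF D c(2)] lc_jetD(2)[OF D c(2)]])

text \<open>The induction covers all index lists at once, as differentiating \<open>D is\<close>
  leads to the lists \<open>i # is\<close>.\<close>

lemma distribution_Ck_on:
  assumes u: "u \<in> distributions A" and c: "c \<in> A"
    and D: "lc_jet (Omega_c A) (cimg c) D"
  shows "Ck_on k (cimg c) (\<lambda>y. u (D is y))"
proof (induction k arbitrary: "is")
  case 0
  have "isCont (\<lambda>y. u (D is y)) y" if "y \<in> cimg c" for y
    by (rule has_derivative_continuous[OF distribution_has_derivative[OF u c that D]])
  then show ?case by (simp add: continuous_at_imp_continuous_on)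
next
  case (Suc k)
  note der = distribution_has_derivative[OF u c _ D]
  have "Ck_on k (cimg c) (\<lambda>y. \<Sum>i\<in>UNIV. v $ i * u (D (i # is) y))" for v
    by (intro Ck_on_sum Ck_on_linear[OF _ bounded_linear_mult_right] open_cimg c Suc.IH)
  then have "Ck_on k (cimg c) (\<lambda>y. frechet_derivative (\<lambda>y. u (D is y)) (at y) v)" for v
    by (rule Ck_on_eqI[OF open_cimg[OF c]]) (rule fun_cong[OF frechet_derivative_at[OF der]])
  moreover have "(\<lambda>y. u (D is y)) differentiable (at y)" if "y \<in> cimg c" for y
    using der[OF that] by (auto simp: differentiable_def)
  ultimately show ?case by simp
qed

lemma smooth_fun_distribution:
  assumes \<omega>: "\<omega> \<in> pts (SK A)" and u: "u \<in> distributions A"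
  shows "smooth_fun A (\<lambda>x. u (\<omega> x))"
  unfolding smooth_fun_def o_def
proof
  fix c assume c: "c \<in> A"
  obtain D where D: "\<And>y. y \<in> cimg c \<Longrightarrow> D [] y = \<omega> (cinv c y)" "lc_jet (Omega_c A) (cimg c) D"
    by (rule SK_chart[OF \<omega> c]) (rule that)
  have "smooth_on (cimg c) (\<lambda>y. u (D [] y))"
    unfolding smooth_on_def using distribution_Ck_on[OF u c D(2)] by blast
  then show "smooth_on (cimg c) (\<lambda>y. u (\<omega> (cinv c y)))"
    by (rule smooth_on_eqI[OF open_cimg[OF c]]) (simp add: D(1))
qed

text \<open>The sum is the parameter derivative of the kernel in a chart \<open>c\<close> of free
  choice, whereas \<open>lie_par\<close> is tied to \<open>chart_at\<close>. The right-hand side no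
  longer mentions the chart except through the point, by \<open>lie_fun_chart\<close>.\<close>

lemma distribution_lie_chart:
  assumes \<omega>: "\<omega> \<in> pts (SK A)" and u: "u \<in> distributions A" and X: "X \<in> vfields A" and c: "c \<in> A" "y \<in> cimg c"
    and D: "\<And>y. y \<in> cimg c \<Longrightarrow> D [] y = \<omega> (cinv c y)" "lc_jet (Omega_c A) (cimg c) D"
  shows "u (\<Sum>i\<in>UNIV. X (cinv c y) c $ i *\<^sub>R D [i] y) = lie_fun A X (\<lambda>x. u (\<omega> x)) (cinv c y)"
proof -
  have "((\<lambda>y. u (\<omega> (cinv c y))) has_derivative (\<lambda>h. \<Sum>i\<in>UNIV. h $ i * u (D [i] y))) (at y)"
    by (rule has_derivative_transform_within_open[OF distribution_has_derivative[OF u c D(2), of "[]"] open_cimg[OF c(1)] c(2)])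
      (rule arg_cong[OF D(1)])
  from fun_cong[OF frechet_derivative_at[OF this], of "X (cinv c y) c"]
  have "lie_fun A X (\<lambda>x. u (\<omega> x)) (cinv c y) = (\<Sum>i\<in>UNIV. X (cinv c y) c $ i * u (D [i] y))"
    using lie_fun_chart[OF smooth_fun_distribution[OF \<omega> u] X c(1) cinv_in_cdom[OF c]] cmap_cinv[OF c] by (simp add: o_def)
  also have "\<dots> = u (\<Sum>i\<in>UNIV. X (cinv c y) c $ i *\<^sub>R D [i] y)"
    by (subst distribution_sum[OF u]) (simp_all add: cforms_scaleR jet_cforms[OF D(2)] c distributionsD(2)[OF u])
  finally show ?thesis ..
qed

text \<open>Differentiability in the chart \<open>chart_at A x\<close> identifies the limit defining
  \<open>lie_par\<close> with a finite sum of partial derivatives, on which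
  \<open>distribution_lie_chart\<close> evaluates \<open>u\<close>.\<close>

lemma lie_par_weak:
  assumes \<omega>: "\<omega> \<in> pts (SK A)" and X: "X \<in> vfields A"
  shows "lie_par A X \<omega> x \<in> cforms A"
    and "u \<in> distributions A \<Longrightarrow> u (lie_par A X \<omega> x) = lie_fun A X (\<lambda>x. u (\<omega> x)) x"
proof -
  define c where "c = chart_at A x"
  have c: "c \<in> A" "x \<in> cdom c" using chart_at by (auto simp: c_def)
  obtain D where D: "\<And>y. y \<in> cimg c \<Longrightarrow> D [] y = \<omega> (cinv c y)" "lc_jet (Omega_c A) (cimg c) D"
    by (rule SK_chart[OF \<omega> c(1)]) (rule that)
  define y where "y = cmap c x"
  have y: "y \<in> cimg c" "cinv c y = x" using c by (simp_all add: y_def cmap_in_cimg cinv_cmap)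
  let ?l = "\<Sum>i\<in>UNIV. X x c $ i *\<^sub>R D [i] y"
  have lp: "?l \<in> cforms A"
    by (intro subspace_sum[OF subspace_cforms] cforms_scaleR jet_cforms[OF D(2)] y)
  \<comment> \<open>\<open>D []\<close> agrees with the kernel on \<open>cimg c\<close> only, so the
    limit is transferred along those \<open>h\<close> for which \<open>y + h\<close> stays
    there.\<close>
  have part: "lc_partials (Omega_c A) (\<lambda>y. \<omega> (cinv c y)) (\<lambda>i. D [i] y) y"
  proof -
    have "((\<lambda>h. p ((\<omega> (cinv c (y + h)) - \<omega> (cinv c y) - (\<Sum>i\<in>UNIV. h $ i *\<^sub>R D [i] y)) /\<^sub>R norm h - 0)) \<longlongrightarrow> 0) (at 0)"
      if "p \<in> seminorms (Omega_c A)" for p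
    proof (rule Lim_transform_eventually)
      show "((\<lambda>h. p ((D [] (y + h) - D [] y - (\<Sum>i\<in>UNIV. h $ i *\<^sub>R D [i] y)) /\<^sub>R norm h - 0)) \<longlongrightarrow> 0) (at 0)"
        using bspec[OF lc_jetD(2)[OF D(2) y(1), of "[]", unfolded lc_partials_def lc_tendsto_def] that] .
      show "\<forall>\<^sub>F h in at 0. p ((D [] (y + h) - D [] y - (\<Sum>i\<in>UNIV. h $ i *\<^sub>R D [i] y)) /\<^sub>R norm h - 0) =
          p ((\<omega> (cinv c (y + h)) - \<omega> (cinv c y) - (\<Sum>i\<in>UNIV. h $ i *\<^sub>R D [i] y)) /\<^sub>R norm h - 0)"
        using eventually_translate_in[OF open_cimg[OF c(1)] y(1)]
        by (rule eventually_mono) (simp add: D(1) y(1))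
    qed
    then show ?thesis unfolding lc_partials_def lc_tendsto_def by blast
  qed
  have "lc_tendsto (Omega_c A) (\<lambda>t. (\<omega> (cinv c (y + t *\<^sub>R X x c)) - \<omega> (cinv c y)) /\<^sub>R t) ?l (at 0)"
    by (rule lc_partials_direction[OF lcs_Omega_c open_cimg[OF c(1)] y(1) _ _ part])
      (simp_all add: SK_cforms[OF \<omega>] jet_cforms[OF D(2)] y(1))
  then have "lc_has_deriv (Omega_c A) (\<lambda>t. \<omega> (cinv c (y + t *\<^sub>R X x c))) ?l 0"
    using lp by (simp add: lc_has_deriv_def)
  from lc_deriv_Omega_c[OF SK_cforms[OF \<omega>] this] have eq: "lie_par A X \<omega> x = ?l"
    by (simp add: lie_par_def c_def[symmetric] y_def)
  show "lie_par A X \<omega> x \<in> cforms A" using lp eq by simp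
  show "u (lie_par A X \<omega> x) = lie_fun A X (\<lambda>x. u (\<omega> x)) x" if u: "u \<in> distributions A"
    using distribution_lie_chart[OF \<omega> u X c(1) y(1) D] by (simp add: y(2) eq)
qed

text \<open>In a fixed chart the coordinate sum is smooth by \<open>lc_smooth_on_span\<close>. That
  it equals \<open>lie_par\<close>, which is computed in charts varying with the point, is tested
  against all distributions: both sides become the same Lie derivative of a function.\<close>

lemma SK_lie_par:
  assumes \<omega>: "\<omega> \<in> pts (SK A)" and X: "X \<in> vfields A"
  shows "lie_par A X \<omega> \<in> pts (SK A)"
proof (rule SK_I)
  fix c assume c: "c \<in> A"
  obtain D where D: "\<And>y. y \<in> cimg c \<Longrightarrow> D [] y = \<omega> (cinv c y)" "lc_jet (Omega_c A) (cimg c) D"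
    by (rule SK_chart[OF \<omega> c]) (rule that)
  have span: "smooth_span (cimg c) D (\<lambda>y. \<Sum>i\<in>UNIV. X (cinv c y) c $ i *\<^sub>R D [i] y)"
    by (intro smooth_span_sum smooth_span.scaled smooth_on_vec_nth open_cimg c vfieldsD X) simp
  have "lc_smooth_on (Omega_c A) (cimg c) (\<lambda>y. \<Sum>i\<in>UNIV. X (cinv c y) c $ i *\<^sub>R D [i] y)"
    by (rule lc_smooth_on_span[OF lcs_Omega_c open_cimg[OF c] D(2) span])
  then show "lc_smooth_on (Omega_c A) (cimg c) (\<lambda>y. lie_par A X \<omega> (cinv c y))"
  proof (rule lc_smooth_on_eqI)
    fix y assume y: "y \<in> cimg c"
    show "(\<Sum>i\<in>UNIV. X (cinv c y) c $ i *\<^sub>R D [i] y) = lie_par A X \<omega> (cinv c y)"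
    proof (rule distributions_separate)
      show "(\<Sum>i\<in>UNIV. X (cinv c y) c $ i *\<^sub>R D [i] y) \<in> cforms A"
        by (intro subspace_sum[OF subspace_cforms] cforms_scaleR jet_cforms[OF D(2)] y)
      show "lie_par A X \<omega> (cinv c y) \<in> cforms A" by (rule lie_par_weak(1)[OF \<omega> X])
      show "u (\<Sum>i\<in>UNIV. X (cinv c y) c $ i *\<^sub>R D [i] y) = u (lie_par A X \<omega> (cinv c y))"
        if u: "u \<in> distributions A" for u
        using distribution_lie_chart[OF \<omega> u X c y D] lie_par_weak(2)[OF \<omega> X u] by simp
    qed
  qed
qed

text \<open>Membership in \<open>pts (SK A)\<close> is part of the claim because each further
  derivative has to be taken of a kernel.\<close>

lemma distribution_lie_pars:
  assumes \<omega>: "\<omega> \<in> pts (SK A)" and u: "u \<in> distributions A" and "set Xs \<subseteq> vfields A"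
  shows "foldr (lie_par A) Xs \<omega> \<in> pts (SK A) \<and>
    (\<lambda>x. u (foldr (lie_par A) Xs \<omega> x)) = foldr (lie_fun A) Xs (\<lambda>x. u (\<omega> x))"
  using assms(3)
proof (induction Xs)
  case (Cons X Xs)
  then have IH: "foldr (lie_par A) Xs \<omega> \<in> pts (SK A)"
    "(\<lambda>x. u (foldr (lie_par A) Xs \<omega> x)) = foldr (lie_fun A) Xs (\<lambda>x. u (\<omega> x))" and X: "X \<in> vfields A" by auto
  show ?case
    using SK_lie_par[OF IH(1) X] lie_par_weak(2)[OF IH(1) X u] by (simp add: IH(2))
qed (simp add: \<omega>)

end

section \<open>Generalised functions and association\<close>

lemma unif_bigo_zero: "unif_bigo K (\<lambda>\<epsilon> x. 0) e"
  unfolding unif_bigo_def by (intro exI[of _ 0]) simp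

lemma eventually_at_right_unit: "\<forall>\<^sub>F \<epsilon>::real in at_right 0. \<epsilon> \<in> {0<..1}"
  unfolding eventually_at_right_field by (intro exI[of _ 1]) auto

lemma unif_bigo_cong:
  assumes "unif_bigo K f e" "\<And>\<epsilon> x. \<epsilon> \<in> {0<..1} \<Longrightarrow> f \<epsilon> x = g \<epsilon> x"
  shows "unif_bigo K g e"
proof -
  obtain C where C: "\<forall>\<^sub>F \<epsilon> in at_right 0. \<forall>x\<in>K. \<bar>f \<epsilon> x\<bar> \<le> C * \<epsilon> powi e"
    using assms(1) unfolding unif_bigo_def by blast
  have "\<forall>\<^sub>F \<epsilon> in at_right 0. \<forall>x\<in>K. \<bar>g \<epsilon> x\<bar> \<le> C * \<epsilon> powi e"
    using C eventually_at_right_unit by eventually_elim (simp add: assms(2))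
  then show ?thesis unfolding unif_bigo_def by blast
qed

text \<open>For \<epsilon> \<le> 1 both powers are dominated by the one with exponent
  \<open>- int (M + N)\<close>.\<close>

lemma unif_bigo_diff:
  assumes "unif_bigo K f (- int M)" "unif_bigo K g (- int N)"
    and "\<And>\<epsilon> x. \<epsilon> \<in> {0<..1} \<Longrightarrow> h \<epsilon> x = f \<epsilon> x - g \<epsilon> x"
  shows "unif_bigo K h (- int (M + N))"
proof -
  obtain C D where C: "\<forall>\<^sub>F \<epsilon> in at_right 0. \<forall>x\<in>K. \<bar>f \<epsilon> x\<bar> \<le> C * \<epsilon> powi (- int M)"
    and D: "\<forall>\<^sub>F \<epsilon> in at_right 0. \<forall>x\<in>K. \<bar>g \<epsilon> x\<bar> \<le> D * \<epsilon> powi (- int N)"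
    using assms(1,2) unfolding unif_bigo_def by blast
  have "\<forall>\<^sub>F \<epsilon> in at_right 0. \<forall>x\<in>K. \<bar>h \<epsilon> x\<bar> \<le> (\<bar>C\<bar> + \<bar>D\<bar>) * \<epsilon> powi (- int (M + N))"
    using C D eventually_at_right_unit
  proof eventually_elim
    case (elim \<epsilon>)
    have pow: "\<epsilon> powi (- int M) \<le> \<epsilon> powi (- int (M + N))" "\<epsilon> powi (- int N) \<le> \<epsilon> powi (- int (M + N))"
    proof -
      have "\<epsilon> powi (- int j) = inverse (\<epsilon> ^ j)" for j by (simp add: power_int_minus)
      then show "\<epsilon> powi (- int M) \<le> \<epsilon> powi (- int (M + N))" "\<epsilon> powi (- int N) \<le> \<epsilon> powi (- int (M + N))"
        using elim by (simp_all only:) (auto intro!: le_imp_inverse_le power_decreasing)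
    qed
    have nonneg: "0 \<le> \<epsilon> powi k" for k using elim by simp
    show ?case
    proof
      fix x assume x: "x \<in> K"
      have "\<bar>h \<epsilon> x\<bar> \<le> \<bar>f \<epsilon> x\<bar> + \<bar>g \<epsilon> x\<bar>" using assms(3) elim by simp
      also have "\<dots> \<le> C * \<epsilon> powi (- int M) + D * \<epsilon> powi (- int N)" using elim x by (intro add_mono) auto
      also have "\<dots> \<le> \<bar>C\<bar> * \<epsilon> powi (- int (M + N)) + \<bar>D\<bar> * \<epsilon> powi (- int (M + N))"
        using pow nonneg by (intro add_mono mult_mono) auto
      finally show "\<bar>h \<epsilon> x\<bar> \<le> (\<bar>C\<bar> + \<bar>D\<bar>) * \<epsilon> powi (- int (M + N))" by (simp only: distrib_right)
    qed
  qed
  then show ?thesis unfolding unif_bigo_def by blast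
qed

context oriented_atlas
begin

section \<open>Derivatives in the space of smooth functions and differentials of linear maps\<close>

lemma pts_Cinf [simp]: "pts (Cinf A) = {f. smooth_fun A f}"
  by (simp add: Cinf_def)

lemma seminorms_CinfE:
  assumes "p \<in> seminorms (Cinf A)"
  obtains K Xs where "p = (\<lambda>f. SUP x\<in>K. \<bar>foldr (lie_fun A) Xs f x\<bar>)" "compact K" "K \<noteq> {}" "set Xs \<subseteq> vfields A"
  using assms unfolding Cinf_def by auto

lemma Cinf_seminorm:
  "compact K \<Longrightarrow> K \<noteq> {} \<Longrightarrow> set Xs \<subseteq> vfields A \<Longrightarrow>
    (\<lambda>f. SUP x\<in>K. \<bar>foldr (lie_fun A) Xs f x\<bar>) \<in> seminorms (Cinf A)"
  unfolding Cinf_def by auto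

lemma seminorm_Cinf_zero: "p \<in> seminorms (Cinf A) \<Longrightarrow> p (\<lambda>_. 0) = 0"
  by (erule seminorms_CinfE) (simp add: lie_funs_zero)

text \<open>The difference quotient equals \<open>b\<close> for every nonzero \<open>h\<close>, so
  each seminorm is evaluated at zero.\<close>

lemma lc_has_deriv_Cinf_affine:
  assumes "smooth_fun A b"
  shows "lc_has_deriv (Cinf A) (\<lambda>t x. a x + t * b x) b t"
  unfolding lc_has_deriv_def lc_tendsto_def
proof (intro conjI ballI)
  fix p assume p: "p \<in> seminorms (Cinf A)"
  have "\<forall>\<^sub>F h in at 0. 0 = p ((((\<lambda>x. a x + (t + h) * b x) - (\<lambda>x. a x + t * b x)) /\<^sub>R h) - b)"
    using eventually_neq_at_within[of 0 "0 :: real" UNIV]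
  proof eventually_elim
    case (elim h)
    have "(((\<lambda>x. a x + (t + h) * b x) - (\<lambda>x. a x + t * b x)) /\<^sub>R h) - b = (\<lambda>_. 0)"
      using elim by (simp add: fun_eq_iff scaleR_fun_def field_simps)
    then show ?case using seminorm_Cinf_zero[OF p] by metis
  qed
  then show "((\<lambda>h. p ((((\<lambda>x. a x + (t + h) * b x) - (\<lambda>x. a x + t * b x)) /\<^sub>R h) - b)) \<longlongrightarrow> 0) (at 0)"
    by (rule Lim_transform_eventually[OF tendsto_const])
qed (use assms in simp)

text \<open>Limits in \<open>Cinf A\<close> are unique, since the seminorms with a one-point set and
  no fields give pointwise convergence.\<close>

lemma lc_deriv_Cinf:
  assumes l: "lc_has_deriv (Cinf A) \<gamma> l t"
  shows "lc_deriv (Cinf A) \<gamma> t = l"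
  unfolding lc_deriv_def
proof (rule the_equality)
  show "lc_has_deriv (Cinf A) \<gamma> l t" by (rule l)
  have lim: "((\<lambda>h. (\<gamma> (t + h) x - \<gamma> t x) / h) \<longlongrightarrow> k x) (at 0)" if k: "lc_has_deriv (Cinf A) \<gamma> k t" for k x
  proof -
    have "((\<lambda>h. SUP z\<in>{x}. \<bar>foldr (lie_fun A) [] ((\<gamma> (t + h) - \<gamma> t) /\<^sub>R h - k) z\<bar>) \<longlongrightarrow> 0) (at 0)"
      using k Cinf_seminorm[of "{x}" "[]"] unfolding lc_has_deriv_def lc_tendsto_def by auto
    then have "((\<lambda>h. \<bar>(\<gamma> (t + h) x - \<gamma> t x) / h - k x\<bar>) \<longlongrightarrow> 0) (at 0)"
      by (simp add: scaleR_fun_def divide_inverse mult.commute)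
    then show ?thesis by (simp add: tendsto_rabs_zero_iff LIM_zero_iff)
  qed
  fix k assume k: "lc_has_deriv (Cinf A) \<gamma> k t"
  show "k = l" using tendsto_unique[OF _ lim[OF k] lim[OF l]] by (intro ext) simp
qed

text \<open>Linearity is one identity in the shape \<open>\<omega> + r *\<^sub>R \<eta>\<close>, in
  which \<open>differential\<close> perturbs its argument. It is confined to smoothing kernels
  because distributions are linear on \<open>cforms A\<close> only.\<close>

definition kernel_linear where
  "kernel_linear F \<longleftrightarrow> (\<forall>\<omega>\<in>pts (SK A). smooth_fun A (F \<omega>)) \<and>
     (\<forall>\<omega>\<in>pts (SK A). \<forall>\<eta>\<in>pts (SK A). \<forall>r x. F (\<omega> + r *\<^sub>R \<eta>) x = F \<omega> x + r * F \<eta> x)"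

lemma kernel_linearD:
  assumes "kernel_linear F"
  shows "\<omega> \<in> pts (SK A) \<Longrightarrow> smooth_fun A (F \<omega>)"
    "\<omega> \<in> pts (SK A) \<Longrightarrow> \<eta> \<in> pts (SK A) \<Longrightarrow> F (\<omega> + r *\<^sub>R \<eta>) x = F \<omega> x + r * F \<eta> x"
  using assms unfolding kernel_linear_def by blast+

lemma differential_linear:
  assumes F: "kernel_linear F" and "set vs \<subseteq> pts (SK A)" "\<omega> \<in> pts (SK A)"
  shows "differential (Cinf A) F vs \<omega> = (case vs of [] \<Rightarrow> F \<omega> | [v] \<Rightarrow> F v | _ \<Rightarrow> (\<lambda>_. 0))"
  using assms(2,3)
proof (induction vs arbitrary: \<omega>)
  case (Cons v vs)
  have v: "v \<in> pts (SK A)" and vs: "set vs \<subseteq> pts (SK A)" using Cons.prems by auto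
  define b where "b = (case vs of [] \<Rightarrow> F v | _ \<Rightarrow> (\<lambda>_. 0))"
  define a where "a = (case vs of [] \<Rightarrow> F \<omega> | [w] \<Rightarrow> F w | _ \<Rightarrow> (\<lambda>_. 0))"
  \<comment> \<open>Affine in \<open>t\<close>: for \<open>vs = []\<close> the slope is
    \<open>F v\<close>, and otherwise the inner differential does not depend on the base
    point.\<close>
  have "differential (Cinf A) F vs (\<omega> + t *\<^sub>R v) = (\<lambda>x. a x + t * b x)" for t
  proof -
    note IH = Cons.IH[OF vs SK_add[OF Cons.prems(2) SK_scaleR[OF v, of t]]]
    show ?thesis
    proof (cases vs)
      case Nil
      show ?thesis
        unfolding IH unfolding Nil a_def b_def list.case
        by (rule ext) (rule kernel_linearD(2)[OF F Cons.prems(2) v])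
    next
      case (Cons w ws)
      show ?thesis
        unfolding IH unfolding Cons a_def b_def list.case by (simp split: list.split)
    qed
  qed
  moreover have "smooth_fun A b"
    using kernel_linearD(1)[OF F v] smooth_fun_const by (auto simp: b_def split: list.split)
  ultimately have "differential (Cinf A) F (v # vs) \<omega> = b"
    using lc_deriv_Cinf[OF lc_has_deriv_Cinf_affine[of b a 0]] by simp
  then show ?case by (auto simp: b_def split: list.split)
qed simp

lemma netsD: "\<omega> \<in> nets A \<Longrightarrow> \<epsilon> \<in> {0<..1} \<Longrightarrow> \<omega> \<epsilon> \<in> pts (SK A)"
  by (simp add: nets_def)

lemma delta_nets_SK: "\<omega> \<in> delta_nets A \<Longrightarrow> \<epsilon> \<in> {0<..1} \<Longrightarrow> \<omega> \<epsilon> \<in> pts (SK A)"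
  by (rule netsD) (simp_all only: delta_nets_def mem_Collect_eq)

lemma delta_nets0_SK: "\<omega> \<in> delta_nets0 A \<Longrightarrow> \<epsilon> \<in> {0<..1} \<Longrightarrow> \<omega> \<epsilon> \<in> pts (SK A)"
  by (rule netsD) (simp_all only: delta_nets0_def mem_Collect_eq)

lemma moderate_linear:
  assumes F: "kernel_linear F" "F \<in> Ehat A"
    and growth: "\<And>K k \<omega>. compact K \<Longrightarrow> \<omega> \<in> delta_nets A \<Longrightarrow> \<exists>N::nat. \<forall>Xs. length Xs = k \<longrightarrow> set Xs \<subseteq> vfields A \<longrightarrow>
      unif_bigo K (\<lambda>\<epsilon> x. foldr (lie_fun A) Xs (F (\<omega> \<epsilon>)) x) (- int N)"
  shows "F \<in> moderate A"
  unfolding moderate_def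
proof (intro CollectI conjI F allI impI ballI)
  fix K :: "'a set" and k j :: nat and \<omega> :: "('a, 'n) net" and \<eta>s
  assume K: "compact K" and \<omega>: "\<omega> \<in> delta_nets A" and \<eta>s: "set \<eta>s \<subseteq> delta_nets0 A"
  have SK: "set (map (\<lambda>\<eta>. \<eta> \<epsilon>) \<eta>s) \<subseteq> pts (SK A)" if "\<epsilon> \<in> {0<..1}" for \<epsilon>
    using \<eta>s delta_nets0_SK[OF _ that] by auto
  note diff = differential_linear[OF F(1) SK delta_nets_SK[OF \<omega>]]
  consider "\<eta>s = []" | \<eta> where "\<eta>s = [\<eta>]" | \<eta> \<eta>' \<eta>s' where "\<eta>s = \<eta> # \<eta>' # \<eta>s'"
    by (metis list.exhaust)
  then show "\<exists>N::nat. \<forall>Xs. length Xs = k \<longrightarrow> set Xs \<subseteq> vfields A \<longrightarrow> unif_bigo K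
       (\<lambda>\<epsilon> x. foldr (lie_fun A) Xs (differential (Cinf A) F (map (\<lambda>\<eta>. \<eta> \<epsilon>) \<eta>s) (\<omega> \<epsilon>)) x) (- int N)"
  proof cases
    case 1
    then show ?thesis using growth[OF K \<omega>] by simp
  next
    case 2
    \<comment> \<open>By definition of \<open>delta_nets0\<close>, adding \<omega> gives a delta
      net, so \<open>F (\<eta> \<epsilon>)\<close> is a difference of two values whose growth is
      known.\<close>
    then have \<eta>: "\<eta> \<in> delta_nets0 A" and sum: "\<eta> + \<omega> \<in> delta_nets A"
      using \<eta>s \<omega> by (auto simp: delta_nets0_def)
    obtain M N where M: "\<And>Xs. length Xs = k \<Longrightarrow> set Xs \<subseteq> vfields A \<Longrightarrow>
        unif_bigo K (\<lambda>\<epsilon> x. foldr (lie_fun A) Xs (F ((\<eta> + \<omega>) \<epsilon>)) x) (- int M)"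
      and N: "\<And>Xs. length Xs = k \<Longrightarrow> set Xs \<subseteq> vfields A \<Longrightarrow>
        unif_bigo K (\<lambda>\<epsilon> x. foldr (lie_fun A) Xs (F (\<omega> \<epsilon>)) x) (- int N)"
      using growth[OF K sum] growth[OF K \<omega>] by blast
    show ?thesis
    proof (intro exI[of _ "M + N"] allI impI unif_bigo_diff[OF M N])
      fix Xs \<epsilon> x assume Xs: "set Xs \<subseteq> vfields A" and \<epsilon>: "\<epsilon> \<in> {0<..1::real}"
      note pts = delta_nets0_SK[OF \<eta> \<epsilon>] delta_nets_SK[OF \<omega> \<epsilon>] delta_nets_SK[OF sum \<epsilon>]
      have sumeq: "(\<eta> + \<omega>) \<epsilon> = \<eta> \<epsilon> + 1 *\<^sub>R \<omega> \<epsilon>" by simp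
      have "F (\<eta> \<epsilon>) = (\<lambda>x. F ((\<eta> + \<omega>) \<epsilon>) x - F (\<omega> \<epsilon>) x)"
        unfolding sumeq using kernel_linearD(2)[OF F(1) pts(1,2), of 1] by (simp only: mult_1 add_diff_cancel_right')
      then have "foldr (lie_fun A) Xs (F (\<eta> \<epsilon>)) x =
          foldr (lie_fun A) Xs (F ((\<eta> + \<omega>) \<epsilon>)) x - foldr (lie_fun A) Xs (F (\<omega> \<epsilon>)) x"
        using lie_funs_diff[OF kernel_linearD(1)[OF F(1) pts(3)] kernel_linearD(1)[OF F(1) pts(2)] Xs] by simp
      then show "foldr (lie_fun A) Xs (differential (Cinf A) F (map (\<lambda>\<eta>. \<eta> \<epsilon>) \<eta>s) (\<omega> \<epsilon>)) x =
          foldr (lie_fun A) Xs (F ((\<eta> + \<omega>) \<epsilon>)) x - foldr (lie_fun A) Xs (F (\<omega> \<epsilon>)) x"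
        using diff[OF \<epsilon> \<epsilon>] 2 by simp
    qed auto
  next
    case 3
    have "unif_bigo K (\<lambda>\<epsilon> x. foldr (lie_fun A) Xs (differential (Cinf A) F (map (\<lambda>\<eta>. \<eta> \<epsilon>) \<eta>s) (\<omega> \<epsilon>)) x) (- int 0)" for Xs
      by (rule unif_bigo_cong[OF unif_bigo_zero]) (use diff 3 in \<open>simp add: lie_funs_zero\<close>)
    then show ?thesis by blast
  qed
qed

section \<open>The embedding of distributions: membership in the basic space and
  moderateness\<close>

lemma Ehat_smooth: "F \<in> Ehat A \<Longrightarrow> \<omega> \<in> pts (SK A) \<Longrightarrow> smooth_fun A (F \<omega>)"
  unfolding Ehat_def by auto

lemma EhatI:
  assumes "\<And>\<omega>. \<omega> \<in> pts (SK A) \<Longrightarrow> smooth_fun A (F \<omega>)" "convenient_smooth (SK A) (Cinf A) F"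
    and local: "\<And>\<omega> \<omega>' U x. \<omega> \<in> pts (SK A) \<Longrightarrow> \<omega>' \<in> pts (SK A) \<Longrightarrow> open U \<Longrightarrow>
      (\<And>x. x \<in> U \<Longrightarrow> \<omega> x = \<omega>' x) \<Longrightarrow> x \<in> U \<Longrightarrow> F \<omega> x = F \<omega>' x"
  shows "F \<in> Ehat A"
  unfolding Ehat_def
proof (intro CollectI conjI ballI allI impI)
  show "F ` pts (SK A) \<subseteq> pts (Cinf A)" using assms(1) by auto
  show "convenient_smooth (SK A) (Cinf A) F" by (rule assms(2))
  fix \<omega> \<omega>' U x
  assume \<omega>: "\<omega> \<in> pts (SK A)" "\<omega>' \<in> pts (SK A)" and U: "open U \<and> (\<forall>x\<in>U. \<omega> x = \<omega>' x)" and x: "x \<in> U"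
  show "F \<omega> x = F \<omega>' x"
    by (rule local[OF \<omega> conjunct1[OF U] bspec[OF conjunct2[OF U]] x])
qed

text \<open>\<open>lie_fun A X\<close> is linear, and composing a seminorm of \<open>Cinf A\<close>
  with it amounts to appending \<open>X\<close> to the list of fields; hence it commutes with
  derivatives of curves.\<close>

lemma smooth_curve_lie_fun:
  assumes \<gamma>: "smooth_curve (Cinf A) \<gamma>" and X: "X \<in> vfields A"
  shows "smooth_curve (Cinf A) (\<lambda>t. lie_fun A X (\<gamma> t))"
proof -
  obtain D where D: "D 0 = \<gamma>" "\<And>k t. smooth_fun A (D k t)" "\<And>k t. lc_has_deriv (Cinf A) (D k) (D (Suc k) t) t"
    using \<gamma> unfolding smooth_curve_def by auto
  have "lc_has_deriv (Cinf A) (\<lambda>t. lie_fun A X (D k t)) (lie_fun A X (D (Suc k) t)) t" for k t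
    unfolding lc_has_deriv_def lc_tendsto_def
  proof (intro conjI ballI)
    fix p assume "p \<in> seminorms (Cinf A)"
    then obtain K Xs where p: "p = (\<lambda>f. SUP x\<in>K. \<bar>foldr (lie_fun A) Xs f x\<bar>)"
      and K: "compact K" "K \<noteq> {}" "set Xs \<subseteq> vfields A" by (rule seminorms_CinfE)
    let ?q = "\<lambda>f. SUP x\<in>K. \<bar>foldr (lie_fun A) (Xs @ [X]) f x\<bar>"
    have "?q \<in> seminorms (Cinf A)"
      by (rule Cinf_seminorm[OF K(1,2)]) (use K(3) X in simp)
    then have "((\<lambda>h. ?q ((D k (t + h) - D k t) /\<^sub>R h - D (Suc k) t)) \<longlongrightarrow> 0) (at 0)"
      by (rule bspec[OF conjunct2[OF D(3)[of k t, unfolded lc_has_deriv_def lc_tendsto_def]]])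
    moreover have "?q ((D k (t + h) - D k t) /\<^sub>R h - D (Suc k) t) =
        p ((lie_fun A X (D k (t + h)) - lie_fun A X (D k t)) /\<^sub>R h - lie_fun A X (D (Suc k) t))" for h
    proof -
      have "(D k (t + h) - D k t) /\<^sub>R h - D (Suc k) t = (\<lambda>x. inverse h * (D k (t + h) x - D k t x) - D (Suc k) t x)"
        by (simp add: fun_eq_iff scaleR_fun_def)
      moreover have "lie_fun A X \<dots> =
          (\<lambda>x. inverse h * (lie_fun A X (D k (t + h)) x - lie_fun A X (D k t) x) - lie_fun A X (D (Suc k) t) x)"
        by (simp add: lie_fun_diff lie_fun_scale D(2) smooth_fun_diff smooth_fun_mult smooth_fun_const)
      moreover have "\<dots> = (lie_fun A X (D k (t + h)) - lie_fun A X (D k t)) /\<^sub>R h - lie_fun A X (D (Suc k) t)"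
        by (simp add: fun_eq_iff scaleR_fun_def)
      ultimately show ?thesis by (simp add: p)
    qed
    ultimately show "((\<lambda>h. p ((lie_fun A X (D k (t + h)) - lie_fun A X (D k t)) /\<^sub>R h - lie_fun A X (D (Suc k) t))) \<longlongrightarrow> 0) (at 0)"
      by simp
  qed (simp add: smooth_fun_lie_fun D(2) X)
  then show ?thesis
    unfolding smooth_curve_def
    by (intro exI[of _ "\<lambda>k t. lie_fun A X (D k t)"]) (simp add: D smooth_fun_lie_fun X)
qed

lemma Ehat_lie_fun:
  assumes F: "F \<in> Ehat A" and X: "X \<in> vfields A"
  shows "(\<lambda>\<omega>. lie_fun A X (F \<omega>)) \<in> Ehat A"
proof -
  have "convenient_smooth (SK A) (Cinf A) F" using F unfolding Ehat_def by blast
  then have cs: "convenient_smooth (SK A) (Cinf A) (\<lambda>\<omega>. lie_fun A X (F \<omega>))"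
    unfolding convenient_smooth_def o_def using smooth_curve_lie_fun[OF _ X] by blast
  have loc: "lie_fun A X (F \<omega>) x = lie_fun A X (F \<omega>') x"
    if "\<omega> \<in> pts (SK A)" "\<omega>' \<in> pts (SK A)" "open U" "\<And>x. x \<in> U \<Longrightarrow> \<omega> x = \<omega>' x" "x \<in> U" for \<omega> \<omega>' U x
  proof (rule lie_fun_local[OF Ehat_smooth[OF F that(1)] that(3) _ that(5)])
    show "F \<omega> x = F \<omega>' x" if "x \<in> U" for x
      using F that \<open>\<omega> \<in> pts (SK A)\<close> \<open>\<omega>' \<in> pts (SK A)\<close> \<open>open U\<close> \<open>\<And>x. x \<in> U \<Longrightarrow> \<omega> x = \<omega>' x\<close>
      unfolding Ehat_def by blast
  qed
  show ?thesis
    by (rule EhatI[OF smooth_fun_lie_fun[OF Ehat_smooth[OF F] X] cs loc])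
qed

definition embedding :: "(('a, 'n) form \<Rightarrow> real) \<Rightarrow> ('a, 'n) gmap" where
  "embedding T = (\<lambda>\<omega> x. T (\<omega> x))"

text \<open>The seminorms of \<open>T \<circ> \<omega>\<close> in \<open>Cinf A\<close> are seminorms of \<open>\<omega>\<close> in \<open>SK A\<close>, since \<open>\<bar>T\<bar>\<close> is a seminorm of \<open>Omega_c A\<close>
  and Lie derivatives commute with \<open>T\<close>.\<close>

lemma Ehat_embed:
  assumes T: "T \<in> distributions A"
  shows "embedding T \<in> Ehat A"
proof -
  have "convenient_smooth (SK A) (Cinf A) (embedding T)"
    unfolding convenient_smooth_def
  proof (intro allI impI)
    fix \<gamma> assume "smooth_curve (SK A) \<gamma>"
    then obtain D where D: "D 0 = \<gamma>" "\<And>k t. D k t \<in> pts (SK A)" "\<And>k t. lc_has_deriv (SK A) (D k) (D (Suc k) t) t"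
      unfolding smooth_curve_def by auto
    have "lc_has_deriv (Cinf A) (\<lambda>t. embedding T (D k t)) (embedding T (D (Suc k) t)) t" for k t
      unfolding lc_has_deriv_def lc_tendsto_def
    proof (intro conjI ballI)
      show "embedding T (D (Suc k) t) \<in> pts (Cinf A)"
        using smooth_fun_distribution[OF D(2) T] by (simp add: embedding_def)
      fix p assume "p \<in> seminorms (Cinf A)"
      then obtain K Xs where p: "p = (\<lambda>f. SUP x\<in>K. \<bar>foldr (lie_fun A) Xs f x\<bar>)"
        and K: "compact K" "K \<noteq> {}" "set Xs \<subseteq> vfields A" by (rule seminorms_CinfE)
      let ?q = "\<lambda>\<omega>. SUP x\<in>K. \<bar>T (foldr (lie_par A) Xs \<omega> x)\<bar>"
      have "?q \<in> seminorms (SK A)"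
        unfolding SK_def lcs.select_convs
        by (rule CollectI, intro exI[of _ K] exI[of _ Xs] exI[of _ "\<lambda>\<mu>. \<bar>T \<mu>\<bar>"])
          (simp add: K distributionsD(3)[OF T])
      then have lim: "((\<lambda>h. ?q ((D k (t + h) - D k t) /\<^sub>R h - D (Suc k) t)) \<longlongrightarrow> 0) (at 0)"
        by (rule bspec[OF conjunct2[OF D(3)[of k t, unfolded lc_has_deriv_def lc_tendsto_def]]])
      have eq: "?q ((D k (t + h) - D k t) /\<^sub>R h - D (Suc k) t) =
          p ((embedding T (D k (t + h)) - embedding T (D k t)) /\<^sub>R h - embedding T (D (Suc k) t))" for h
      proof -
        define \<Omega> where "\<Omega> = (D k (t + h) - D k t) /\<^sub>R h - D (Suc k) t"
        have \<Omega>: "\<Omega> \<in> pts (SK A)" unfolding \<Omega>_def by (intro SK_diff SK_scaleR D)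
        have "T (\<Omega> x) = (T (D k (t + h) x) - T (D k t x)) / h - T (D (Suc k) t x)" for x
        proof -
          have \<Omega>x: "\<Omega> x = (D k (t + h) x - D k t x) /\<^sub>R h - D (Suc k) t x"
            by (simp add: \<Omega>_def scaleR_fun_def[of "inverse h" "D k (t + h) - D k t"])
          have c: "D j s x \<in> cforms A" for j s by (rule SK_cforms[OF D(2)])
          have d: "D k (t + h) x - D k t x \<in> cforms A" by (intro subspace_diff[OF subspace_cforms] c)
          show ?thesis
            unfolding \<Omega>x distribution_diff[OF T cforms_scaleR[OF d] c] distributionsD(2)[OF T d]
              distribution_diff[OF T c c] by (simp add: divide_inverse mult.commute)
        qed
        then have "(\<lambda>x. T (\<Omega> x)) = (embedding T (D k (t + h)) - embedding T (D k t)) /\<^sub>R h - embedding T (D (Suc k) t)"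
          by (simp add: fun_eq_iff embedding_def scaleR_fun_def divide_inverse mult.commute)
        moreover have "T (foldr (lie_par A) Xs \<Omega> x) = foldr (lie_fun A) Xs (\<lambda>x. T (\<Omega> x)) x" for x
          using distribution_lie_pars[OF \<Omega> T K(3)] by metis
        ultimately show ?thesis unfolding \<Omega>_def[symmetric] p by simp
      qed
      show "((\<lambda>h. p ((embedding T (D k (t + h)) - embedding T (D k t)) /\<^sub>R h - embedding T (D (Suc k) t))) \<longlongrightarrow> 0) (at 0)"
        using lim unfolding eq .
    qed
    moreover have "(\<lambda>t. embedding T (D 0 t)) = embedding T \<circ> \<gamma>"
      unfolding D(1) o_def by (rule refl)
    moreover have "embedding T (D k t) \<in> pts (Cinf A)" for k t
      using smooth_fun_distribution[OF D(2) T] by (simp add: embedding_def)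
    ultimately show "smooth_curve (Cinf A) (embedding T \<circ> \<gamma>)"
      unfolding smooth_curve_def by (intro exI[of _ "\<lambda>k t. embedding T (D k t)"] conjI allI)
  qed
  moreover have "smooth_fun A (embedding T \<omega>)" if "\<omega> \<in> pts (SK A)" for \<omega>
    using smooth_fun_distribution[OF that T] by (simp add: embedding_def)
  moreover have "embedding T \<omega> x = embedding T \<omega>' x" if "\<omega> x = \<omega>' x" for \<omega> \<omega>' x
    unfolding embedding_def that by (rule refl)
  ultimately show ?thesis by (intro EhatI) blast+
qed

lemma kernel_linear_embed:
  assumes T: "T \<in> distributions A"
  shows "kernel_linear (embedding T)"
  unfolding kernel_linear_def
proof (intro conjI ballI allI)
  show "smooth_fun A (embedding T \<omega>)" if "\<omega> \<in> pts (SK A)" for \<omega>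
    using smooth_fun_distribution[OF that T] by (simp add: embedding_def)
  fix \<omega> \<eta> :: "('a, 'n) kernel" and r x assume "\<omega> \<in> pts (SK A)" "\<eta> \<in> pts (SK A)"
  then have c: "\<omega> x \<in> cforms A" "\<eta> x \<in> cforms A" by (auto intro: SK_cforms)
  have "(\<omega> + r *\<^sub>R \<eta>) x = \<omega> x + r *\<^sub>R \<eta> x" by (simp add: scaleR_fun_def[of r \<eta>])
  then show "embedding T (\<omega> + r *\<^sub>R \<eta>) x = embedding T \<omega> x + r * embedding T \<eta> x"
    unfolding embedding_def using distributionsD(1)[OF T c(1) cforms_scaleR[OF c(2)]] distributionsD(2)[OF T c(2)]
    by metis
qed

lemma kernel_linear_lie_fun:
  assumes F: "kernel_linear F" and X: "X \<in> vfields A"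
  shows "kernel_linear (\<lambda>\<omega>. lie_fun A X (F \<omega>))"
  unfolding kernel_linear_def
proof (intro conjI ballI allI)
  show "smooth_fun A (lie_fun A X (F \<omega>))" if "\<omega> \<in> pts (SK A)" for \<omega>
    by (rule smooth_fun_lie_fun[OF kernel_linearD(1)[OF F that] X])
  fix \<omega> \<eta> :: "('a, 'n) kernel" and r x assume \<omega>: "\<omega> \<in> pts (SK A)" and \<eta>: "\<eta> \<in> pts (SK A)"
  have "F (\<omega> + r *\<^sub>R \<eta>) = (\<lambda>x. F \<omega> x + r * F \<eta> x)"
    using kernel_linearD(2)[OF F \<omega> \<eta>] by (rule ext)
  then show "lie_fun A X (F (\<omega> + r *\<^sub>R \<eta>)) x = lie_fun A X (F \<omega>) x + r * lie_fun A X (F \<eta>) x"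
    using kernel_linearD(1)[OF F \<omega>] kernel_linearD(1)[OF F \<eta>]
    by (simp add: lie_fun_add lie_fun_scale smooth_fun_mult smooth_fun_const)
qed

text \<open>Property (3) of delta nets for the distribution \<open>T\<close>.\<close>

lemma embed_growth:
  assumes T: "T \<in> distributions A" and K: "compact K" and \<omega>: "\<omega> \<in> delta_nets A"
  shows "\<exists>N::nat. \<forall>Xs. length Xs = k \<longrightarrow> set Xs \<subseteq> vfields A \<longrightarrow>
    unif_bigo K (\<lambda>\<epsilon> x. foldr (lie_fun A) Xs (embedding T (\<omega> \<epsilon>)) x) (- int N)"
  unfolding embedding_def
  by (rule \<omega>[unfolded delta_nets_def mem_Collect_eq, THEN conjunct2, THEN conjunct1, THEN spec, THEN mp,
     OF K, THEN conjunct2, THEN conjunct2, THEN bspec, OF T, THEN spec])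

lemma moderate_embed: "T \<in> distributions A \<Longrightarrow> embedding T \<in> moderate A"
  by (intro moderate_linear kernel_linear_embed Ehat_embed embed_growth)

lemma moderate_lie_embed:
  assumes T: "T \<in> distributions A" and X: "X \<in> vfields A"
  shows "(\<lambda>\<omega>. lie_fun A X (embedding T \<omega>)) \<in> moderate A"
proof (intro moderate_linear kernel_linear_lie_fun kernel_linear_embed Ehat_lie_fun Ehat_embed T X)
  fix K :: "'a set" and k and \<omega> :: "('a, 'n) net" assume "compact K" "\<omega> \<in> delta_nets A"
  \<comment> \<open>The exponent for order \<open>Suc k\<close> is uniform in the fields, so the
    innermost of them may be fixed as \<open>X\<close>.\<close>
  from embed_growth[OF T this, of "Suc k"] obtain N where N:
    "\<And>Xs. length Xs = Suc k \<Longrightarrow> set Xs \<subseteq> vfields A \<Longrightarrow>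
      unif_bigo K (\<lambda>\<epsilon> x. foldr (lie_fun A) Xs (embedding T (\<omega> \<epsilon>)) x) (- int N)" by blast
  have "unif_bigo K (\<lambda>\<epsilon> x. foldr (lie_fun A) Xs (lie_fun A X (embedding T (\<omega> \<epsilon>))) x) (- int N)"
    if "length Xs = k" "set Xs \<subseteq> vfields A" for Xs
    using N[of "Xs @ [X]"] that X by simp
  then show "\<exists>N::nat. \<forall>Xs. length Xs = k \<longrightarrow> set Xs \<subseteq> vfields A \<longrightarrow>
      unif_bigo K (\<lambda>\<epsilon> x. foldr (lie_fun A) Xs (lie_fun A X (embedding T (\<omega> \<epsilon>))) x) (- int N)" by blast
qed

text \<open>It puts a moderate map into its own class, and \<open>associated\<close> demands
  nonempty classes.\<close>

lemma zero_negligible: "0 \<in> negligible_maps A"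
proof -
  have "smooth_curve (Cinf A) (\<lambda>_ _. 0)"
    unfolding smooth_curve_def using lc_has_deriv_Cinf_affine[OF smooth_fun_const[of 0], of "\<lambda>_. 0"] smooth_fun_const[of 0]
    by (intro exI[of _ "\<lambda>_ _ _. 0"]) simp
  then have "0 \<in> Ehat A"
    by (intro EhatI) (simp_all add: convenient_smooth_def o_def zero_fun_def smooth_fun_const)
  moreover have "differential (Cinf A) (0 :: ('a, 'n) gmap) vs \<omega> = (\<lambda>_. 0)" for vs \<omega>
  proof (induction vs arbitrary: \<omega>)
    case (Cons v vs)
    then show ?case
      using lc_deriv_Cinf[OF lc_has_deriv_Cinf_affine[OF smooth_fun_const[of 0], of "\<lambda>_. 0"]] by simp
  qed (simp add: zero_fun_def)
  ultimately show ?thesis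
    unfolding negligible_maps_def by (simp add: lie_funs_zero unif_bigo_zero)
qed

section \<open>Classes and association to zero\<close>

lemma gclass_self: "F \<in> moderate A \<Longrightarrow> F \<in> gclass A F"
  unfolding gclass_def Ghat_rel_def using zero_negligible by simp

text \<open>On the support of \<mu> the values are uniformly O(\<epsilon>), and
  \<open>form_integral_bound\<close> carries this over to the integral.\<close>

lemma assoc_zero_small:
  assumes F: "\<And>\<omega>. \<omega> \<in> pts (SK A) \<Longrightarrow> smooth_fun A (F \<omega>)"
    and small: "\<And>K \<omega>. compact K \<Longrightarrow> \<omega> \<in> delta_nets A \<Longrightarrow> unif_bigo K (\<lambda>\<epsilon> x. F (\<omega> \<epsilon>) x) 1"
  shows "assoc_zero A F"
  unfolding assoc_zero_def
proof (intro ballI)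
  fix \<mu> \<omega> assume \<mu>: "\<mu> \<in> cforms A" and \<omega>: "\<omega> \<in> delta_nets A"
  obtain B where B: "\<And>f b. smooth_fun A f \<Longrightarrow> (\<And>x. x \<in> supp \<mu> \<Longrightarrow> \<bar>f x\<bar> \<le> b) \<Longrightarrow>
      \<bar>form_integral A (mult_form f \<mu>)\<bar> \<le> B * b"
  proof (rule form_integral_bound[OF \<mu>])
    fix B assume "\<And>f b. smooth_fun A f \<Longrightarrow> (\<And>x. x \<in> supp \<mu> \<Longrightarrow> \<bar>f x\<bar> \<le> b) \<Longrightarrow>
      \<bar>form_integral A (mult_form f \<mu>)\<bar> \<le> B * b"
    then show thesis by (rule that)
  qed
  obtain C where C: "\<forall>\<^sub>F \<epsilon> in at_right 0. \<forall>x\<in>supp \<mu>. \<bar>F (\<omega> \<epsilon>) x\<bar> \<le> C * \<epsilon> powi 1"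
    using small[OF cformsD(2)[OF \<mu>] \<omega>] unfolding unif_bigo_def by blast
  have "\<forall>\<^sub>F \<epsilon> in at_right 0. norm (form_integral A (mult_form (F (\<omega> \<epsilon>)) \<mu>)) \<le> B * (C * \<epsilon>)"
    using C eventually_at_right_unit
    by eventually_elim (use B F delta_nets_SK[OF \<omega>] in simp)
  moreover have "((\<lambda>\<epsilon>. B * (C * \<epsilon>)) \<longlongrightarrow> 0) (at_right 0)"
    using tendsto_mult[OF tendsto_const[of B] tendsto_mult[OF tendsto_const[of C] tendsto_ident_at[of 0 "{0<..}"]]]
    by simp
  ultimately show "((\<lambda>\<epsilon>. form_integral A (mult_form (F (\<omega> \<epsilon>)) \<mu>)) \<longlongrightarrow> 0) (at_right 0)"
    by (rule Lim_null_comparison)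
qed

text \<open>The instance of negligibility without differentials, with fields \<open>Xs\<close> and
  the power 1.\<close>

lemma assoc_zero_lie_fun_negligible:
  assumes N: "N \<in> negligible_maps A" and "set Xs \<subseteq> vfields A"
  shows "assoc_zero A (\<lambda>\<omega>. foldr (lie_fun A) Xs (N \<omega>))"
proof (rule assoc_zero_small)
  have E: "N \<in> Ehat A" using N unfolding negligible_maps_def by blast
  show "smooth_fun A (foldr (lie_fun A) Xs (N \<omega>))" if "\<omega> \<in> pts (SK A)" for \<omega>
    by (rule smooth_fun_lie_funs[OF Ehat_smooth[OF E that] assms(2)])
  fix K :: "'a set" and \<omega> :: "('a, 'n) net" assume K: "compact K" and \<omega>: "\<omega> \<in> delta_nets A"
  have "unif_bigo K (\<lambda>\<epsilon> x. foldr (lie_fun A) Xs (differential (Cinf A) N (map (\<lambda>\<eta>. \<eta> \<epsilon>) []) (\<omega> \<epsilon>)) x) (int 1)"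
    by (rule conjunct2[OF N[unfolded negligible_maps_def mem_Collect_eq], rule_format, OF K refl assms(2) \<omega> refl]) simp
  then show "unif_bigo K (\<lambda>\<epsilon> x. foldr (lie_fun A) Xs (N (\<omega> \<epsilon>)) x) 1" by simp
qed

lemma assoc_zero_negligible: "N \<in> negligible_maps A \<Longrightarrow> assoc_zero A N"
  using assoc_zero_lie_fun_negligible[of N "[]"] by simp

text \<open>\<open>H\<close> has to agree with the combination on smoothing kernels only, since the
  values of a delta net are kernels for \<epsilon> in (0,1].\<close>

lemma assoc_zero_combine:
  assumes "assoc_zero A F" "assoc_zero A G" "\<And>\<omega>. \<omega> \<in> pts (SK A) \<Longrightarrow> smooth_fun A (F \<omega>)"
    "\<And>\<omega>. \<omega> \<in> pts (SK A) \<Longrightarrow> smooth_fun A (G \<omega>)"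
    "\<And>\<omega> x. \<omega> \<in> pts (SK A) \<Longrightarrow> H \<omega> x = F \<omega> x + r * G \<omega> x"
  shows "assoc_zero A H"
  unfolding assoc_zero_def
proof (intro ballI)
  fix \<mu> \<omega> assume \<mu>: "\<mu> \<in> cforms A" and \<omega>: "\<omega> \<in> delta_nets A"
  have lim: "((\<lambda>\<epsilon>. form_integral A (mult_form (F (\<omega> \<epsilon>)) \<mu>) + r * form_integral A (mult_form (G (\<omega> \<epsilon>)) \<mu>)) \<longlongrightarrow> 0 + r * 0) (at_right 0)"
    using assms(1,2) \<mu> \<omega> unfolding assoc_zero_def by (intro tendsto_intros) auto
  have "\<forall>\<^sub>F \<epsilon> in at_right 0. form_integral A (mult_form (F (\<omega> \<epsilon>)) \<mu>) + r * form_integral A (mult_form (G (\<omega> \<epsilon>)) \<mu>) =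
      form_integral A (mult_form (H (\<omega> \<epsilon>)) \<mu>)"
    using eventually_at_right_unit
  proof eventually_elim
    case (elim \<epsilon>)
    note s = delta_nets_SK[OF \<omega> elim]
    have "mult_form (H (\<omega> \<epsilon>)) \<mu> = mult_form (F (\<omega> \<epsilon>)) \<mu> + mult_form (\<lambda>x. r * G (\<omega> \<epsilon>) x) \<mu>"
      using assms(5)[OF s] by (simp add: mult_form_def fun_eq_iff distrib_right)
    moreover have "form_integral A \<dots> = form_integral A (mult_form (F (\<omega> \<epsilon>)) \<mu>) + form_integral A (mult_form (\<lambda>x. r * G (\<omega> \<epsilon>) x) \<mu>)"
      by (intro form_integral_add cforms_mult smooth_fun_mult smooth_fun_const assms(3,4) s \<mu>)
    ultimately show ?case
      using form_integral_scale[OF assms(4)[OF s] \<mu>, of r] by metis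
  qed
  from Lim_transform_eventually[OF lim this]
  show "((\<lambda>\<epsilon>. form_integral A (mult_form (H (\<omega> \<epsilon>)) \<mu>)) \<longlongrightarrow> 0) (at_right 0)" by simp
qed

lemma delta_nets_limit:
  assumes \<omega>: "\<omega> \<in> delta_nets A" and u: "u \<in> distributions A" and \<mu>: "\<mu> \<in> cforms A"
  shows "((\<lambda>\<epsilon>. form_integral A (mult_form (embedding u (\<omega> \<epsilon>)) \<mu>)) \<longlongrightarrow> u \<mu>) (at_right 0)"
  unfolding embedding_def
  by (rule \<omega>[unfolded delta_nets_def mem_Collect_eq, THEN conjunct2, THEN conjunct2, THEN bspec, OF u, THEN bspec, OF \<mu>])

lemma assoc_zero_lie_embed:
  assumes T: "T \<in> distributions A" and X: "X \<in> vfields A"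
  shows "assoc_zero A (\<lambda>\<omega> x. lie_fun A X (embedding T \<omega>) x - embedding (lie_dist A X T) \<omega> x)"
  unfolding assoc_zero_def
proof (intro ballI)
  fix \<mu> \<omega> assume \<mu>: "\<mu> \<in> cforms A" and \<omega>: "\<omega> \<in> delta_nets A"
  note L = lie_dist_distribution[OF T X]
  \<comment> \<open>Property (4) is used twice: for \<open>T\<close> tested with
    \<open>lie_form A X \<mu>\<close>, which has to be a compactly supported form, and for
    \<open>lie_dist A X T\<close>, which has to be a distribution.\<close>
  have lim: "((\<lambda>\<epsilon>. - form_integral A (mult_form (embedding T (\<omega> \<epsilon>)) (lie_form A X \<mu>)) -
      form_integral A (mult_form (embedding (lie_dist A X T) (\<omega> \<epsilon>)) \<mu>)) \<longlongrightarrow> - T (lie_form A X \<mu>) - lie_dist A X T \<mu>) (at_right 0)"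
    by (intro tendsto_intros delta_nets_limit \<omega> T L \<mu> cforms_lie_form X)
  have "\<forall>\<^sub>F \<epsilon> in at_right 0. - form_integral A (mult_form (embedding T (\<omega> \<epsilon>)) (lie_form A X \<mu>)) -
      form_integral A (mult_form (embedding (lie_dist A X T) (\<omega> \<epsilon>)) \<mu>) =
      form_integral A (mult_form (\<lambda>x. lie_fun A X (embedding T (\<omega> \<epsilon>)) x - embedding (lie_dist A X T) (\<omega> \<epsilon>) x) \<mu>)"
    using eventually_at_right_unit
  proof eventually_elim
    case (elim \<epsilon>)
    let ?f = "embedding T (\<omega> \<epsilon>)" and ?g = "embedding (lie_dist A X T) (\<omega> \<epsilon>)"
    note s = delta_nets_SK[OF \<omega> elim]
    have f: "smooth_fun A ?f" and g: "smooth_fun A ?g"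
      using kernel_linearD(1)[OF kernel_linear_embed s] T L by auto
    have split: "mult_form (\<lambda>x. lie_fun A X ?f x - ?g x) \<mu> = mult_form (lie_fun A X ?f) \<mu> + mult_form (\<lambda>x. - 1 * ?g x) \<mu>"
      by (simp add: mult_form_def fun_eq_iff algebra_simps)
    have add: "form_integral A (mult_form (lie_fun A X ?f) \<mu> + mult_form (\<lambda>x. - 1 * ?g x) \<mu>) =
        form_integral A (mult_form (lie_fun A X ?f) \<mu>) + form_integral A (mult_form (\<lambda>x. - 1 * ?g x) \<mu>)"
      by (intro form_integral_add cforms_mult smooth_fun_mult smooth_fun_const smooth_fun_lie_fun f g X \<mu>)
    show ?case
      unfolding split add stokes[OF f \<mu> X] form_integral_scale[OF g \<mu>] by linarith
  qed
  from Lim_transform_eventually[OF lim this]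
  show "((\<lambda>\<epsilon>. form_integral A (mult_form (\<lambda>x. lie_fun A X (embedding T (\<omega> \<epsilon>)) x - embedding (lie_dist A X T) (\<omega> \<epsilon>) x) \<mu>)) \<longlongrightarrow> 0) (at_right 0)"
    by (simp add: lie_dist_def)
qed

lemma gclassD:
  assumes "G \<in> gclass A F"
  shows "F \<in> moderate A" "G \<in> moderate A" "F - G \<in> negligible_maps A"
  using assms by (simp_all add: gclass_def Ghat_rel_def)

lemma moderate_smooth:
  assumes "F \<in> moderate A" "\<omega> \<in> pts (SK A)"
  shows "smooth_fun A (F \<omega>)"
  by (rule Ehat_smooth[OF _ assms(2)]) (use assms(1) in \<open>simp only: moderate_def mem_Collect_eq\<close>)

lemma lie_iota_associated:
  assumes T: "T \<in> distributions A" and X: "X \<in> vfields A"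
  shows "associated A (lie_gen A X (iota A T)) (iota A (lie_dist A X T))"
proof -
  note L = lie_dist_distribution[OF T X]
  have iota: "iota A u = gclass A (embedding u)" for u
    by (simp add: iota_def embedding_def)
  have self: "embedding T \<in> iota A T" "embedding (lie_dist A X T) \<in> iota A (lie_dist A X T)"
    unfolding iota by (intro gclass_self moderate_embed T L)+
  have "(\<lambda>\<omega>. lie_fun A X (embedding T \<omega>)) \<in> lie_gen A X (iota A T)"
    unfolding lie_gen_def using self(1) gclass_self[OF moderate_lie_embed[OF T X]] by blast
  moreover have "assoc_zero A (F' - G)"
    if F': "F' \<in> lie_gen A X (iota A T)" and G: "G \<in> iota A (lie_dist A X T)" for F' G
  proof -
    obtain F where F: "F \<in> iota A T" and F'F: "F' \<in> gclass A (\<lambda>\<omega>. lie_fun A X (F \<omega>))"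
      using F' unfolding lie_gen_def by blast
    note F = gclassD[OF F[unfolded iota]] and F' = gclassD[OF F'F] and G = gclassD[OF G[unfolded iota]]
    have sm: "smooth_fun A (F \<omega>)" "smooth_fun A (F' \<omega>)" "smooth_fun A (G \<omega>)"
        "smooth_fun A (embedding T \<omega>)" "smooth_fun A (embedding (lie_dist A X T) \<omega>)" if "\<omega> \<in> pts (SK A)" for \<omega>
      by (rule moderate_smooth[OF F(2) that] moderate_smooth[OF F'(2) that] moderate_smooth[OF G(2) that]
        moderate_smooth[OF F(1) that] moderate_smooth[OF G(1) that])+
    \<comment> \<open>On kernels, \<open>F' - G\<close> is \<open>H1 + H2 - H3 - H4\<close>. Here
      \<open>H1\<close> compares the canonical representatives, \<open>H2\<close> and
      \<open>H4\<close> are changes of representative after differentiation, and \<open>H3\<close>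
      is the Lie derivative of the change of representative before it.\<close>
    define H1 where "H1 = (\<lambda>\<omega> x. lie_fun A X (embedding T \<omega>) x - embedding (lie_dist A X T) \<omega> x)"
    define H2 where "H2 = embedding (lie_dist A X T) - G"
    define H3 where "H3 = (\<lambda>\<omega>. lie_fun A X ((embedding T - F) \<omega>))"
    define H4 where "H4 = (\<lambda>\<omega>. lie_fun A X (F \<omega>)) - F'"
    have H3: "H3 \<omega> = (\<lambda>x. lie_fun A X (embedding T \<omega>) x - lie_fun A X (F \<omega>) x)" if "\<omega> \<in> pts (SK A)" for \<omega>
      using lie_fun_diff[OF sm(4)[OF that] sm(1)[OF that], of X] by (simp add: H3_def fun_diff_def)
    have s1: "smooth_fun A (H1 \<omega>)" and s2: "smooth_fun A (H2 \<omega>)" and s3: "smooth_fun A (H3 \<omega>)"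
      and s4: "smooth_fun A (H4 \<omega>)" if "\<omega> \<in> pts (SK A)" for \<omega>
      using sm[OF that] X
      by (simp_all add: H1_def H2_def H3[OF that] H4_def fun_diff_def smooth_fun_diff smooth_fun_lie_fun)
    have a1: "assoc_zero A H1" unfolding H1_def by (rule assoc_zero_lie_embed[OF T X])
    have a2: "assoc_zero A H2" unfolding H2_def by (rule assoc_zero_negligible[OF G(3)])
    have a3: "assoc_zero A H3" unfolding H3_def
      using assoc_zero_lie_fun_negligible[OF F(3), of "[X]"] X by (simp only: foldr.simps list.set o_apply id_apply) simp
    have a4: "assoc_zero A H4" unfolding H4_def by (rule assoc_zero_negligible[OF F'(3)])
    have "assoc_zero A (\<lambda>\<omega> x. H1 \<omega> x + 1 * H2 \<omega> x)"
      by (rule assoc_zero_combine[where r=1, OF a1 a2 s1 s2]) simp_all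
    then have "assoc_zero A (\<lambda>\<omega> x. (H1 \<omega> x + 1 * H2 \<omega> x) + (- 1) * H3 \<omega> x)"
      by (rule assoc_zero_combine[where r="- 1", OF _ a3 _ s3]) (auto intro: smooth_fun_add s1 s2)
    then show ?thesis
    proof (rule assoc_zero_combine[where r="- 1", OF _ a4 _ s4])
      show "smooth_fun A (\<lambda>x. (H1 \<omega> x + 1 * H2 \<omega> x) + (- 1) * H3 \<omega> x)" if "\<omega> \<in> pts (SK A)" for \<omega>
        by (intro smooth_fun_add smooth_fun_mult smooth_fun_const s1 s2 s3 that)
      show "(F' - G) \<omega> x = (H1 \<omega> x + 1 * H2 \<omega> x) + (- 1) * H3 \<omega> x + (- 1) * H4 \<omega> x" if "\<omega> \<in> pts (SK A)" for \<omega> x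
        by (simp add: H1_def H2_def H3[OF that] H4_def)
    qed
  qed
  ultimately show ?thesis
    unfolding associated_def using self(2) by blast
qed

end

theorem proposition34:
  fixes A :: "('a::{t2_space, second_countable_topology}, 'n::{finite, wellorder}) chart set"
  assumes "oriented_smooth_atlas A"
    and "T \<in> distributions A"
    and "X \<in> vfields A"
  shows "cov_gen A X (iota A T) = lie_gen A X (iota A T) \<and>
         associated A (lie_gen A X (iota A T)) (iota A (lie_dist A X T)) \<and>
         iota A (lie_dist A X T) = iota A (cov_dist A X T)"
proof -
  interpret oriented_atlas A
    by (rule oriented_atlas.intro) (rule assms(1))
  have "cov_fun A = lie_fun A"
    by (simp add: cov_fun_def fun_eq_iff)
  moreover have "cov_dist A X T = lie_dist A X T"
    by (simp add: cov_dist_def)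
  ultimately show ?thesis
    using lie_iota_associated[OF assms(2,3)] by (simp add: cov_gen_def lie_gen_def)
qed

end
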